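(* Let $\mathcal P$ be a directly regular $n$-polytope whose facets are isomorphic to $\mathcal K$, whose vertex-figures are isomorphic to $\mathcal L$, and whose medial sections are isomorphic to $\mathcal M$. Let $\mathcal Q$ be a directly regular $n$-polytope whose facets are isomorphic to $\mathcal K'$, whose vertex-figures are isomorphic to $\mathcal L'$, and whose medial sections are isomorphic to $\mathcal M'$. Suppose that $\mathcal K\diamond\mathcal K'$ and $\mathcal L\diamond\mathcal L'$ are polytopal, and suppose that $\Gamma^+(\mathcal K\diamond\mathcal K')=\Gamma^+(\mathcal K)\times\Gamma^+(\mathcal K')$ and $\Gamma^+(\mathcal L\diamond\mathcal L')=\Gamma^+(\mathcal L)\times\Gamma^+(\mathcal L')$. Then $\mathcal P\diamond\mathcal Q$ is polytopal if and only if $\Gamma^+(\mathcal M\diamond\mathcal M')=\Gamma^+(\mathcal M)\times\Gamma^+(\mathcal M')$.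
   Context: Polytopes. An (abstract) $n$-polytope is a ranked poset with ranks $-1,\dots,n$ such that: there are a unique least face $F_{-1}$ (rank $-1$) and a unique greatest face $F_n$ (rank $n$); every flag (maximal chain) has $n+2$ faces; it is strongly flag-connected (any two flags $\Phi,\Psi$ are joined by a sequence of flags, consecutive ones differing in exactly one face, all containing $\Phi\cap\Psi$); and whenever $F<G$ have ranks $j-1$ and $j+1$ there are exactly two $j$-faces strictly between them. Facets are the $(n-1)$-faces $F$ (identified with the sections $F/F_{-1}$), the vertex-figure at a vertex $F_0$ is the section $F_n/F_0$, and a medial section is a section $F_{n-1}/F_0$ of a facet over a vertex (it is an $(n-2)$-polytope). Regularity. $\mathcal P$ is regular if its automorphism group $\Gamma(\mathcal P)$ is transitive on flags. Fixing a base flag $\Phi$, $\Gamma(\mathcal P)=\langle\rho_0,\dots,\rho_{n-1}\rangle$, where $\rho_i$ maps $\Phi$ to the flag differing from it exactly in the $i$-face. Put $\sigma_i=\rho_{i-1}\rho_i$ for $1\le i\le n-1$; the rotation subgroup is $\Gamma^+(\mathcal P)=\langle\sigma_1,\dots,\sigma_{n-1}\rangle$ (with these specified generators; trivial if $n\le 1$), and $\mathcal P$ is directly regular if it has index $2$ in $\Gamma(\mathcal P)$. All sections of a directly regular polytope are directly regular; with respect to the base flag the facets, vertex-figures and medial sections have rotation groups $\langle\sigma_1,\dots,\sigma_{n-2}\rangle$, $\langle\sigma_2,\dots,\sigma_{n-1}\rangle$ and $\langle\sigma_2,\dots,\sigma_{n-2}\rangle$ respectively. Mix. For directly regular $n$-polytopes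 with $\Gamma^+(\mathcal P)=\langle\sigma_1,\dots,\sigma_{n-1}\rangle$, $\Gamma^+(\mathcal Q)=\langle\sigma_1',\dots,\sigma_{n-1}'\rangle$, let $\beta_i=(\sigma_i,\sigma_i')$ and $\Gamma^+(\mathcal P)\diamond\Gamma^+(\mathcal Q)=\langle\beta_1,\dots,\beta_{n-1}\rangle\le\Gamma^+(\mathcal P)\times\Gamma^+(\mathcal Q)$. For a group $\Gamma^+$ with specified generators $\beta_1,\dots,\beta_{n-1}$ and $I\subseteq\{0,\dots,n-1\}$, put $\Gamma^+_I=\langle\beta_i\beta_{i+1}\cdots\beta_j \mid 1\le i\le j\le n-1,\ i-1\in I,\ j\in I\rangle$. The mix $\mathcal P\diamond\mathcal Q$ is the poset built from $\Gamma^+=\Gamma^+(\mathcal P)\diamond\Gamma^+(\mathcal Q)$: its $j$-faces ($0\le j\le n-1$) are the right cosets of $\Gamma^+_{\{0,\dots,n-1\}\setminus\{j\}}$, together with a least face of rank $-1$ and a greatest face of rank $n$, where a $j$-face is below a $k$-face ($j<k$) if and only if the two cosets intersect (this is for $n\ge3$; in rank 2 the mix of a $p$-gon and a $q$-gon is the $\mathrm{lcm}(p,q)$-gon, and in ranks 0 and 1 there is a unique polytope and the mix is that polytope). One writes $\Gamma^+(\mathcal P\diamond\mathcal Q)=\Gamma^+(\mathcal P)\diamond\Gamma^+(\mathcal Q)$; an equation $\Gamma^+(\mathcal P\diamond\mathcal Q)=\Gamma^+(\mathcal P)\times\Gamma^+(\mathcal Q)$ means that this subgroup is the whole direct product. The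 mix is called polytopal if it is a polytope; equivalently, $\Gamma^+$ satisfies the intersection property $\Gamma^+_I\cap\Gamma^+_J=\Gamma^+_{I\cap J}$ for all $I,J\subseteq\{0,\dots,n-1\}$. The facets and vertex-figures of $\mathcal P\diamond\mathcal Q$ are the mixes of the facets and of the vertex-figures of $\mathcal P$ and $\mathcal Q$. *)

theory Defs
  imports "HOL-Algebra.Bij" "HOL-Algebra.Elementary_Groups" "HOL-Number_Theory.Cong"
begin

section \<open>Abstract polytopes\<close>

text \<open>
  The face set of a ranked poset is the field of its (reflexive) order relation.
  Ranks are integers because the least face has rank -1.
\<close>

record 'a ranked_poset =
  face_ord :: "'a rel"
  face_rank :: "'a \<Rightarrow> int"

abbreviation faces :: "('a, 'm) ranked_poset_scheme \<Rightarrow> 'a set" where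
  "faces P \<equiv> Field (face_ord P)"

definition flags :: "('a, 'm) ranked_poset_scheme \<Rightarrow> 'a set set" where
  "flags P = {\<Phi> \<in> Chains (face_ord P). \<forall>C \<in> Chains (face_ord P). \<Phi> \<subseteq> C \<longrightarrow> C = \<Phi>}"

definition adjacent :: "'a set \<Rightarrow> 'a set \<Rightarrow> bool" where
  "adjacent \<Phi> \<Psi> \<longleftrightarrow> card (\<Phi> - \<Psi>) = 1 \<and> card (\<Psi> - \<Phi>) = 1"

definition strongly_flag_connected :: "('a, 'm) ranked_poset_scheme \<Rightarrow> bool" where
  "strongly_flag_connected P \<longleftrightarrow>
    (\<forall>\<Phi> \<in> flags P. \<forall>\<Psi> \<in> flags P.
      (\<Phi>, \<Psi>) \<in> {(X, Y). X \<in> flags P \<and> Y \<in> flags P \<and> adjacent X Y \<and>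
                    \<Phi> \<inter> \<Psi> \<subseteq> X \<and> \<Phi> \<inter> \<Psi> \<subseteq> Y}\<^sup>*)"

locale abstract_polytope =
  fixes n :: int and P :: "'a ranked_poset"
  assumes partial_order: "Partial_order (face_ord P)"
    and rank_range: "F \<in> faces P \<Longrightarrow> -1 \<le> face_rank P F \<and> face_rank P F \<le> n"
    and rank_strict: "(F, G) \<in> face_ord P \<Longrightarrow> F \<noteq> G \<Longrightarrow> face_rank P F < face_rank P G"
    and least_face: "\<exists>F \<in> faces P. face_rank P F = -1 \<and> (\<forall>G \<in> faces P. (F, G) \<in> face_ord P)"
    and greatest_face: "\<exists>F \<in> faces P. face_rank P F = n \<and> (\<forall>G \<in> faces P. (G, F) \<in> face_ord P)"
    and flag_card: "\<Phi> \<in> flags P \<Longrightarrow> finite \<Phi> \<and> int (card \<Phi>) = n + 2"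
    and connected: "strongly_flag_connected P"
    and diamond: "(F, G) \<in> face_ord P \<Longrightarrow> face_rank P F = j - 1 \<Longrightarrow> face_rank P G = j + 1 \<Longrightarrow>
      card {H. (F, H) \<in> face_ord P \<and> (H, G) \<in> face_ord P \<and> face_rank P H = j} = 2"

definition bottom_face :: "'a ranked_poset \<Rightarrow> 'a" where
  "bottom_face P = (THE F. F \<in> faces P \<and> (\<forall>G \<in> faces P. (F, G) \<in> face_ord P))"

definition top_face :: "'a ranked_poset \<Rightarrow> 'a" where
  "top_face P = (THE F. F \<in> faces P \<and> (\<forall>G \<in> faces P. (G, F) \<in> face_ord P))"

text \<open>The section \<open>G/F\<close>; its ranks are shifted so that \<open>F\<close> has rank -1.\<close>

definition poset_section :: "'a ranked_poset \<Rightarrow> 'a \<Rightarrow> 'a \<Rightarrow> 'a ranked_poset" where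
  "poset_section P G F =
    \<lparr>face_ord = Restr (face_ord P) {H. (F, H) \<in> face_ord P \<and> (H, G) \<in> face_ord P},
     face_rank = (\<lambda>H. face_rank P H - face_rank P F - 1)\<rparr>"

definition poset_isomorphic :: "'a ranked_poset \<Rightarrow> 'b ranked_poset \<Rightarrow> bool" where
  "poset_isomorphic P Q \<longleftrightarrow>
    (\<exists>f. bij_betw f (faces P) (faces Q) \<and>
      (\<forall>F \<in> faces P. \<forall>G \<in> faces P. (F, G) \<in> face_ord P \<longleftrightarrow> (f F, f G) \<in> face_ord Q))"

definition has_facets :: "int \<Rightarrow> 'a ranked_poset \<Rightarrow> 'b ranked_poset \<Rightarrow> bool" where
  "has_facets n P K \<longleftrightarrow>
    (\<forall>F \<in> faces P. face_rank P F = n - 1 \<longrightarrow>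
      poset_isomorphic (poset_section P F (bottom_face P)) K)"

definition has_vertex_figures :: "'a ranked_poset \<Rightarrow> 'b ranked_poset \<Rightarrow> bool" where
  "has_vertex_figures P L \<longleftrightarrow>
    (\<forall>V \<in> faces P. face_rank P V = 0 \<longrightarrow>
      poset_isomorphic (poset_section P (top_face P) V) L)"

definition has_medial_sections :: "int \<Rightarrow> 'a ranked_poset \<Rightarrow> 'b ranked_poset \<Rightarrow> bool" where
  "has_medial_sections n P M \<longleftrightarrow>
    (\<forall>F \<in> faces P. \<forall>V \<in> faces P.
      face_rank P F = n - 1 \<and> face_rank P V = 0 \<and> (V, F) \<in> face_ord P \<longrightarrow>
      poset_isomorphic (poset_section P F V) M)"

section \<open>Automorphisms and rotation groups\<close>

definition aut_group :: "'a ranked_poset \<Rightarrow> ('a \<Rightarrow> 'a) monoid" where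
  "aut_group P = BijGroup (faces P)
    \<lparr>carrier := {f \<in> Bij (faces P). \<forall>F \<in> faces P. \<forall>G \<in> faces P.
        (F, G) \<in> face_ord P \<longleftrightarrow> (f F, f G) \<in> face_ord P}\<rparr>"

definition regular :: "'a ranked_poset \<Rightarrow> bool" where
  "regular P \<longleftrightarrow>
    (\<forall>\<Phi> \<in> flags P. \<forall>\<Psi> \<in> flags P. \<exists>\<gamma> \<in> carrier (aut_group P). \<gamma> ` \<Phi> = \<Psi>)"

definition rho :: "'a ranked_poset \<Rightarrow> 'a set \<Rightarrow> int \<Rightarrow> 'a \<Rightarrow> 'a" where
  "rho P \<Phi> i = (THE \<gamma>. \<gamma> \<in> carrier (aut_group P) \<and> \<gamma> ` \<Phi> \<noteq> \<Phi> \<and>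
      {F \<in> \<gamma> ` \<Phi>. face_rank P F \<noteq> i} = {F \<in> \<Phi>. face_rank P F \<noteq> i})"

text \<open>
  Products in \<^const>\<open>BijGroup\<close> are compositions of maps acting on the left. Letting
  automorphisms act on the right instead gives the opposite group with generators
  \<open>\<sigma>\<^sub>i\<close> replaced by their inverses; inversion identifies the two as groups with specified
  generators, so this choice affects none of the notions below.
\<close>

definition sigma :: "'a ranked_poset \<Rightarrow> 'a set \<Rightarrow> int \<Rightarrow> 'a \<Rightarrow> 'a" where
  "sigma P \<Phi> i = rho P \<Phi> (i - 1) \<otimes>\<^bsub>aut_group P\<^esub> rho P \<Phi> i"

definition rotation_group :: "int \<Rightarrow> 'a ranked_poset \<Rightarrow> 'a set \<Rightarrow> ('a \<Rightarrow> 'a) monoid" where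
  "rotation_group n P \<Phi> = subgroup_generated (aut_group P) (sigma P \<Phi> ` {1..n - 1})"

text \<open>By regularity, different base flags give conjugate rotation groups.\<close>

definition directly_regular :: "int \<Rightarrow> 'a ranked_poset \<Rightarrow> bool" where
  "directly_regular n P \<longleftrightarrow> abstract_polytope n P \<and> regular P \<and>
    (\<forall>\<Phi> \<in> flags P. card (rcosets\<^bsub>aut_group P\<^esub> carrier (rotation_group n P \<Phi>)) = 2)"

section \<open>The mix\<close>

definition mix_gen ::
  "'a ranked_poset \<Rightarrow> 'a set \<Rightarrow> 'b ranked_poset \<Rightarrow> 'b set \<Rightarrow> int \<Rightarrow> ('a \<Rightarrow> 'a) \<times> ('b \<Rightarrow> 'b)" where
  "mix_gen P \<Phi> Q \<Psi> i = (sigma P \<Phi> i, sigma Q \<Psi> i)"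

definition mix_group ::
  "int \<Rightarrow> 'a ranked_poset \<Rightarrow> 'a set \<Rightarrow> 'b ranked_poset \<Rightarrow> 'b set \<Rightarrow>
    (('a \<Rightarrow> 'a) \<times> ('b \<Rightarrow> 'b)) monoid" where
  "mix_group n P \<Phi> Q \<Psi> =
    subgroup_generated (rotation_group n P \<Phi> \<times>\<times> rotation_group n Q \<Psi>)
      (mix_gen P \<Phi> Q \<Psi> ` {1..n - 1})"

definition mix_is_direct_product ::
  "int \<Rightarrow> 'a ranked_poset \<Rightarrow> 'a set \<Rightarrow> 'b ranked_poset \<Rightarrow> 'b set \<Rightarrow> bool" where
  "mix_is_direct_product n P \<Phi> Q \<Psi> \<longleftrightarrow>
    carrier (mix_group n P \<Phi> Q \<Psi>) = carrier (rotation_group n P \<Phi> \<times>\<times> rotation_group n Q \<Psi>)"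

text \<open>
  \<open>gen_word G \<beta> i j\<close> is the product \<open>\<beta>\<^sub>i \<beta>\<^sub>i\<^sub>+\<^sub>1 \<dots> \<beta>\<^sub>j\<close>, and \<open>gen_subgroup n G \<beta> I\<close>
  is the subgroup \<open>\<Gamma>\<^sup>+\<^sub>I\<close> for \<open>G = \<langle>\<beta>\<^sub>1, \<dots>, \<beta>\<^sub>n\<^sub>-\<^sub>1\<rangle>\<close>.
\<close>

definition gen_word :: "'g monoid \<Rightarrow> (int \<Rightarrow> 'g) \<Rightarrow> int \<Rightarrow> int \<Rightarrow> 'g" where
  "gen_word G \<beta> i j = foldr (\<lambda>k x. \<beta> k \<otimes>\<^bsub>G\<^esub> x) [i..j] \<one>\<^bsub>G\<^esub>"

definition gen_subgroup :: "int \<Rightarrow> 'g monoid \<Rightarrow> (int \<Rightarrow> 'g) \<Rightarrow> int set \<Rightarrow> 'g set" where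
  "gen_subgroup n G \<beta> I =
    generate G {gen_word G \<beta> i j | i j. 1 \<le> i \<and> i \<le> j \<and> j \<le> n - 1 \<and> i - 1 \<in> I \<and> j \<in> I}"

text \<open>
  Faces of a mix. In rank at least 3 the proper faces are cosets tagged with their rank (the
  subgroups for two different ranks might coincide as sets); ranks 1 and 2 use numbered
  vertices and edges.
\<close>

datatype 'g mix_face = MinFace | MaxFace | CosetFace int "'g set" | Vertex int | Edge int

fun mix_face_rank :: "int \<Rightarrow> 'g mix_face \<Rightarrow> int" where
  "mix_face_rank n MinFace = -1"
| "mix_face_rank n MaxFace = n"
| "mix_face_rank n (CosetFace j C) = j"
| "mix_face_rank n (Vertex a) = 0"
| "mix_face_rank n (Edge a) = 1"

text \<open>Adjoin a least and a greatest face to proper faces \<open>S\<close> with strict incidence \<open>R\<close>.\<close>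

definition bounded_poset ::
  "int \<Rightarrow> 'g mix_face set \<Rightarrow> ('g mix_face \<Rightarrow> 'g mix_face \<Rightarrow> bool) \<Rightarrow> 'g mix_face ranked_poset" where
  "bounded_poset n S R =
    \<lparr>face_ord = {(x, y). x \<in> insert MinFace (insert MaxFace S) \<and>
                        y \<in> insert MinFace (insert MaxFace S) \<and>
                        (x = y \<or> x = MinFace \<or> y = MaxFace \<or> x \<in> S \<and> y \<in> S \<and> R x y)},
     face_rank = mix_face_rank n\<rparr>"

definition coset_poset :: "int \<Rightarrow> 'g monoid \<Rightarrow> (int \<Rightarrow> 'g) \<Rightarrow> 'g mix_face ranked_poset" where
  "coset_poset n G \<beta> = bounded_poset n
    {CosetFace j C | j C. 0 \<le> j \<and> j \<le> n - 1 \<and>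
        C \<in> rcosets\<^bsub>G\<^esub> (gen_subgroup n G \<beta> ({0..n - 1} - {j}))}
    (\<lambda>x y. \<exists>j C k D. x = CosetFace j C \<and> y = CosetFace k D \<and> j < k \<and> C \<inter> D \<noteq> {})"

text \<open>
  The \<open>m\<close>-gon, where \<open>m = 0\<close> stands for the apeirogon: edge \<open>b\<close> joins the vertices \<open>b\<close> and
  \<open>b + 1\<close> modulo \<open>m\<close>.
\<close>

definition polygon :: "nat \<Rightarrow> 'g mix_face ranked_poset" where
  "polygon m = (let Z = {k. m = 0 \<or> 0 \<le> k \<and> k < int m} in
    bounded_poset 2 (Vertex ` Z \<union> Edge ` Z)
      (\<lambda>x y. \<exists>a b. x = Vertex a \<and> y = Edge b \<and>
        ([a = b] (mod int m) \<or> [a = b + 1] (mod int m))))"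

text \<open>
  For an apeirogon \<open>card\<close> yields 0, and \<open>lcm\<close> treats 0 as infinity, in accordance with the
  convention for \<^const>\<open>polygon\<close>.
\<close>

definition num_vertices :: "'a ranked_poset \<Rightarrow> nat" where
  "num_vertices P = card {F \<in> faces P. face_rank P F = 0}"

text \<open>The mix as a poset, for \<open>n \<ge> 0\<close>; in ranks 0 and 1 it is the unique polytope of that rank.\<close>

definition mix ::
  "int \<Rightarrow> 'a ranked_poset \<Rightarrow> 'a set \<Rightarrow> 'b ranked_poset \<Rightarrow> 'b set \<Rightarrow>
    (('a \<Rightarrow> 'a) \<times> ('b \<Rightarrow> 'b)) mix_face ranked_poset" where
  "mix n P \<Phi> Q \<Psi> =
    (if n \<ge> 3 then coset_poset n (mix_group n P \<Phi> Q \<Psi>) (mix_gen P \<Phi> Q \<Psi>)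
     else if n = 2 then polygon (lcm (num_vertices P) (num_vertices Q))
     else if n = 1 then bounded_poset 1 {Vertex 0, Vertex 1} (\<lambda>x y. False)
     else bounded_poset 0 {} (\<lambda>x y. False))"

definition mix_polytopal ::
  "int \<Rightarrow> 'a ranked_poset \<Rightarrow> 'a set \<Rightarrow> 'b ranked_poset \<Rightarrow> 'b set \<Rightarrow> bool" where
  "mix_polytopal n P \<Phi> Q \<Psi> \<longleftrightarrow> abstract_polytope n (mix n P \<Phi> Q \<Psi>)"

end

theory Submission
  imports Defs
begin

text \<open>
  Write \<open>r\<^sub>i = (\<rho>\<^sub>i, \<rho>'\<^sub>i)\<close> for the pairs of corresponding distinguished involutions of
  \<open>P\<close> and \<open>Q\<close>. For a set \<open>I\<close> of ranks let \<open>\<Delta>\<^sub>I\<close> be the group generated by the \<open>r\<^sub>i\<close>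
  with \<open>i \<in> I\<close>, and \<open>E\<^sub>I\<close> the subgroup of its even words. The group of the mix is \<open>E\<^sub>N\<close> with
  \<open>N = {0..n-1}\<close>, and direct regularity says that words have a well-defined parity, so that
  \<open>E\<^sub>I = \<Delta>\<^sub>I \<inter> E\<^sub>N\<close>. Working with \<open>\<Delta>\<^sub>N\<close> instead of the mix group pays off because its
  elements correspond to all flags of the mix, those of the mix group only to every other one:
  the \<open>j\<close>-face at \<open>x \<in> \<Delta>\<^sub>N\<close> is the even part of the coset of \<open>\<Delta>\<close> over \<open>N - {j}\<close> through \<open>x\<close>.

  The first half of the proof shows that, in rank at least 3, the coset poset is a polytope exactly if
  an element lying in the subgroups for \<open>N - {j}\<close>, for all \<open>j \<in> J\<close>, lies in the subgroup for
  \<open>N - J\<close> (\<open>polytope_iff_intersection_property\<close>). Such an element relates two flags that share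
  their faces with ranks in \<open>J\<close>, and words in the remaining generators are the flag paths fixing
  those faces, so this is strong flag-connectedness. The same reasoning, applied to the
  automorphism group of a regular polytope, yields the intersection property of \<open>P\<close> and of \<open>Q\<close>
  (\<open>stabilizer_generated\<close>).

  By regularity every section of \<open>P\<close> between base faces of ranks \<open>a\<close> and \<open>b\<close> has an isomorphism to
  the given model that respects base flags. Conjugation with it embeds the subgroup generated
  by the \<open>\<rho>\<^sub>i\<close> with \<open>a < i < b\<close> into the automorphism group of the model, taking generators to
  generators (\<open>section_embedding\<close>). So all hypotheses on facets, vertex-figures and medial
  sections become statements about subgroups of the single group \<open>\<Delta>\<^sub>N\<close> (\<open>mix_section\<close>).

  The rest is algebra. Let \<open>F = {0..n-2}\<close>, \<open>L = {1..n-1}\<close>, \<open>M = {1..n-2}\<close>, and let superscripts denote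
  the groups of \<open>P\<close> and \<open>Q\<close>. By assumption \<open>E\<^sub>F = E\<^sup>P\<^sub>F \<times> E\<^sup>Q\<^sub>F\<close> and \<open>E\<^sub>L = E\<^sup>P\<^sub>L \<times> E\<^sup>Q\<^sub>L\<close>, so the
  intersection properties of \<open>P\<close> and \<open>Q\<close> give \<open>E\<^sub>F \<inter> E\<^sub>L = E\<^sup>P\<^sub>M \<times> E\<^sup>Q\<^sub>M\<close>. The medial condition thus
  says precisely that \<open>E\<^sub>F \<inter> E\<^sub>L = E\<^sub>M\<close>. This is an instance of the intersection property, and
  conversely it suffices for it when \<open>\<Delta>\<^sub>F\<close> and \<open>\<Delta>\<^sub>L\<close> have the intersection property
  (\<open>intersection_property_from_ends\<close>), as they do because the mixes of the facets and of the
  vertex-figures are polytopal. In ranks 1 and 2 both sides of the equivalence hold: the mix is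
  a segment or a polygon with more than one vertex, and the medial rotation groups are trivial.
\<close>

section \<open>Groups generated by involutions\<close>

definition gen :: "('g, 'b) monoid_scheme \<Rightarrow> (int \<Rightarrow> 'g) \<Rightarrow> int set \<Rightarrow> 'g set" where
  "gen A r I = generate A (r ` I)"

definition even_gen :: "('g, 'b) monoid_scheme \<Rightarrow> (int \<Rightarrow> 'g) \<Rightarrow> int set \<Rightarrow> 'g set" where
  "even_gen A r I = generate A {r a \<otimes>\<^bsub>A\<^esub> r b | a b. a \<in> I \<and> b \<in> I}"

locale involution_system = group A for A (structure) +
  fixes r :: "int \<Rightarrow> 'a" and N :: "int set"
  assumes r_closed: "i \<in> N \<Longrightarrow> r i \<in> carrier A"
    and r_sq: "i \<in> N \<Longrightarrow> r i \<otimes> r i = \<one>"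
begin

lemma r_inv: "i \<in> N \<Longrightarrow> inv (r i) = r i"
  by (simp add: inv_equality r_closed r_sq)

lemma r_cancel: "i \<in> N \<Longrightarrow> x \<in> carrier A \<Longrightarrow> r i \<otimes> (r i \<otimes> x) = x"
  by (metis l_one m_assoc r_closed r_sq)

lemma gen_is_subgroup: "I \<subseteq> N \<Longrightarrow> subgroup (gen A r I) A"
  unfolding gen_def by (rule generate_is_subgroup) (auto simp: r_closed)

lemma gen_mono: "I \<subseteq> J \<Longrightarrow> gen A r I \<subseteq> gen A r J"
  unfolding gen_def by (intro mono_generate image_mono)

lemma r_in_gen: "i \<in> I \<Longrightarrow> r i \<in> gen A r I"
  unfolding gen_def by (simp add: generate.incl)

lemma gen_carrier: "I \<subseteq> N \<Longrightarrow> x \<in> gen A r I \<Longrightarrow> x \<in> carrier A"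
  using gen_is_subgroup subgroup.mem_carrier by metis

lemma gen_mult: "I \<subseteq> N \<Longrightarrow> x \<in> gen A r I \<Longrightarrow> y \<in> gen A r I \<Longrightarrow> x \<otimes> y \<in> gen A r I"
  using gen_is_subgroup subgroup.m_closed by metis

lemma gen_inv: "I \<subseteq> N \<Longrightarrow> x \<in> gen A r I \<Longrightarrow> inv x \<in> gen A r I"
  using gen_is_subgroup subgroup.m_inv_closed by metis

lemma gen_one: "\<one> \<in> gen A r I"
  unfolding gen_def by (rule generate.one)

lemma gen_induct [consumes 2, case_names one step]:
  assumes "x \<in> gen A r I" and I: "I \<subseteq> N"
    and one: "P \<one>"
    and step: "\<And>i y. i \<in> I \<Longrightarrow> y \<in> gen A r I \<Longrightarrow> P y \<Longrightarrow> P (r i \<otimes> y)"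
  shows "P x"
proof -
  \<comment> \<open>The generated subgroup is built from arbitrary products, so the property is shown to be
    preserved by left multiplication with any element.\<close>
  have "y \<in> gen A r I \<Longrightarrow> P y \<Longrightarrow> x \<otimes> y \<in> gen A r I \<and> P (x \<otimes> y)" for y
    using assms(1) unfolding gen_def
  proof (induction x arbitrary: y rule: generate.induct)
    case one
    then show ?case using gen_carrier[OF I] by (simp add: gen_def)
  next
    case (incl h)
    then obtain i where "i \<in> I" "h = r i" by auto
    then show ?case using incl step gen_mult[OF I] r_in_gen by (auto simp: gen_def)
  next
    case (inv h)
    then obtain i where "i \<in> I" "h = r i" by auto
    then show ?case using inv step gen_mult[OF I] r_in_gen r_inv I by (auto simp: gen_def)
  next
    case (eng h1 h2)
    have "h1 \<otimes> h2 \<otimes> y = h1 \<otimes> (h2 \<otimes> y)"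
      using eng gen_carrier[OF I] by (intro m_assoc) (auto simp: gen_def)
    then show ?case using eng by simp
  qed
  from this[OF gen_one one] show ?thesis
    using gen_carrier[OF I assms(1)] by simp
qed

lemma even_is_subgroup: "I \<subseteq> N \<Longrightarrow> subgroup (even_gen A r I) A"
  unfolding even_gen_def by (rule generate_is_subgroup) (auto simp: r_closed subset_iff)

lemma even_mult: "I \<subseteq> N \<Longrightarrow> x \<in> even_gen A r I \<Longrightarrow> y \<in> even_gen A r I \<Longrightarrow> x \<otimes> y \<in> even_gen A r I"
  using even_is_subgroup subgroup.m_closed by metis

lemma even_inv: "I \<subseteq> N \<Longrightarrow> x \<in> even_gen A r I \<Longrightarrow> inv x \<in> even_gen A r I"
  using even_is_subgroup subgroup.m_inv_closed by metis

lemma even_carrier: "I \<subseteq> N \<Longrightarrow> x \<in> even_gen A r I \<Longrightarrow> x \<in> carrier A"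
  using even_is_subgroup subgroup.mem_carrier by metis

lemma pair_in_even: "a \<in> I \<Longrightarrow> b \<in> I \<Longrightarrow> r a \<otimes> r b \<in> even_gen A r I"
  unfolding even_gen_def by (rule generate.incl) blast

lemma even_mono: "I \<subseteq> J \<Longrightarrow> even_gen A r I \<subseteq> even_gen A r J"
  unfolding even_gen_def by (rule mono_generate) blast

lemma even_subset_gen: "I \<subseteq> N \<Longrightarrow> even_gen A r I \<subseteq> gen A r I"
  unfolding even_gen_def
  by (rule generate_subgroup_incl) (auto intro: gen_mult r_in_gen gen_is_subgroup)

text \<open>
  As \<open>r\<^sub>j y = (r\<^sub>j r\<^sub>i) (r\<^sub>i y)\<close>, the even words have index at most two.
\<close>

lemma gen_even_cases:
  assumes I: "I \<subseteq> N" and i: "i \<in> I" and x: "x \<in> gen A r I"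
  shows "x \<in> even_gen A r I \<or> r i \<otimes> x \<in> even_gen A r I"
  using x I
proof (induction rule: gen_induct)
  case one
  then show ?case by (simp add: even_gen_def generate.one)
next
  case (step j y)
  have c: "y \<in> carrier A" "r i \<in> carrier A" "r j \<in> carrier A"
    using step gen_carrier[OF I] r_closed I i by auto
  from step(3) show ?case
  proof
    assume "y \<in> even_gen A r I"
    then have "(r i \<otimes> r j) \<otimes> y \<in> even_gen A r I"
      using even_mult[OF I] pair_in_even i step by blast
    then show ?thesis using c by (simp add: m_assoc)
  next
    assume "r i \<otimes> y \<in> even_gen A r I"
    then have "(r j \<otimes> r i) \<otimes> (r i \<otimes> y) \<in> even_gen A r I"
      using even_mult[OF I] pair_in_even i step by blast
    then show ?thesis using c r_cancel i I by (simp add: m_assoc subset_iff)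
  qed
qed

text \<open>
  Telescoping: \<open>r\<^sub>a r\<^sub>b\<close> is the product of the \<open>r\<^sub>i\<^sub>-\<^sub>1 r\<^sub>i\<close> with \<open>a < i \<le> b\<close>. This identifies the
  rotation subgroup with the subgroup of even words.
\<close>

lemma even_by_consecutive:
  assumes N: "{0..n-1} \<subseteq> N"
  shows "generate A ((\<lambda>i. r (i - 1) \<otimes> r i) ` {1..n-1}) = even_gen A r {0..n-1}" (is "generate A ?S = _")
proof
  show "generate A ?S \<subseteq> even_gen A r {0..n-1}"
    by (rule generate_subgroup_incl) (auto intro!: pair_in_even even_is_subgroup N)
  have sub: "subgroup (generate A ?S) A"
    by (rule generate_is_subgroup) (use N in \<open>auto intro!: m_closed r_closed\<close>)
  have up: "0 \<le> a \<Longrightarrow> a + int k \<le> n - 1 \<Longrightarrow> r a \<otimes> r (a + int k) \<in> generate A ?S" for a k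
  proof (induction k)
    case 0
    then have "a \<in> N" using N by auto
    then show ?case by (simp add: r_sq generate.one)
  next
    case (Suc k)
    have m: "a \<in> N" "a + int k \<in> N" "a + int (Suc k) \<in> N" using N Suc by auto
    have "r (a + int (Suc k) - 1) \<otimes> r (a + int (Suc k)) \<in> generate A ?S"
      by (rule generate.incl, rule image_eqI[where x = "a + int (Suc k)"]) (use Suc in auto)
    then have "(r a \<otimes> r (a + int k)) \<otimes> (r (a + int k) \<otimes> r (a + int (Suc k))) \<in> generate A ?S"
      using Suc subgroup.m_closed[OF sub] by simp
    moreover have "(r a \<otimes> r (a + int k)) \<otimes> (r (a + int k) \<otimes> r (a + int (Suc k))) = r a \<otimes> r (a + int (Suc k))"
      using m by (simp add: m_assoc r_closed r_cancel)
    ultimately show ?case by simp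
  qed
  show "even_gen A r {0..n-1} \<subseteq> generate A ?S"
    unfolding even_gen_def
  proof (rule generate_subgroup_incl[OF _ sub], clarify)
    fix a b assume ab: "a \<in> {0..n-1}" "b \<in> {0..n-1}"
    show "r a \<otimes> r b \<in> generate A ?S"
    proof (cases "a \<le> b")
      case True
      then show ?thesis using up[of a "nat (b - a)"] ab by simp
    next
      case False
      then have "r b \<otimes> r a \<in> generate A ?S" using up[of b "nat (a - b)"] ab by simp
      then have "inv (r b \<otimes> r a) \<in> generate A ?S" using subgroup.m_inv_closed[OF sub] by blast
      then show ?thesis using ab N by (simp add: inv_mult_group r_closed r_inv subset_iff)
    qed
  qed
qed

end

section \<open>String systems and the intersection property\<close>

text \<open>
  The usual intersection property for pairs of index sets follows by taking for \<open>J\<close> the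
  complement of their intersection. The form with a set \<open>J\<close> of forbidden indices is the one that
  matches flags sharing the faces with ranks in \<open>J\<close>.
\<close>

definition intersection_property :: "('g, 'b) monoid_scheme \<Rightarrow> (int \<Rightarrow> 'g) \<Rightarrow> int set \<Rightarrow> bool" where
  "intersection_property A r N \<longleftrightarrow>
    (\<forall>J \<subseteq> N. \<forall>x \<in> gen A r N. (\<forall>j \<in> J. x \<in> gen A r (N - {j})) \<longrightarrow> x \<in> gen A r (N - J))"

lemma intersection_propertyD:
  "intersection_property A r N \<Longrightarrow> J \<subseteq> N \<Longrightarrow> x \<in> gen A r N \<Longrightarrow>
    (\<And>j. j \<in> J \<Longrightarrow> x \<in> gen A r (N - {j})) \<Longrightarrow> x \<in> gen A r (N - J)"
  unfolding intersection_property_def by blast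

text \<open>
  The last two assumptions replace the geometry: parity of words is well defined, and an element
  that stabilizes every face of the base flag is trivial. Unlike the intersection property, both
  pass to direct products, so that they are available for every mix.
\<close>

locale string_system = involution_system +
  assumes r_comm: "i \<in> N \<Longrightarrow> j \<in> N \<Longrightarrow> i + 1 < j \<Longrightarrow> r i \<otimes> r j = r j \<otimes> r i"
    and parity: "i \<in> N \<Longrightarrow> r i \<notin> even_gen A r N"
    and faithful: "x \<in> gen A r N \<Longrightarrow> (\<And>j. j \<in> N \<Longrightarrow> x \<in> gen A r (N - {j})) \<Longrightarrow> x = \<one>"
begin

lemma even_part:
  assumes I: "I \<subseteq> N" shows "gen A r I \<inter> even_gen A r N = even_gen A r I"
proof -
  have "x \<in> even_gen A r I" if x: "x \<in> gen A r I" "x \<in> even_gen A r N" for x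
  proof (cases "I = {}")
    case True
    then show ?thesis using x by (simp add: gen_def even_gen_def)
  next
    case False
    then obtain i where i: "i \<in> I" by auto
    have xc: "x \<in> carrier A" "r i \<in> carrier A" using gen_carrier I x r_closed i by auto
    { assume "r i \<otimes> x \<in> even_gen A r I"
      then have "(r i \<otimes> x) \<otimes> inv x \<in> even_gen A r N"
        using even_mono[OF I] x by (blast intro: even_mult even_inv)
      then have "r i \<in> even_gen A r N" using xc by (simp add: m_assoc)
      then have False using parity i I by auto }
    then show ?thesis using gen_even_cases[OF I i x(1)] by auto
  qed
  then show ?thesis using even_subset_gen[OF I] even_mono[OF I] by auto
qed

text \<open>
  Otherwise \<open>r i\<close> would lie in all of these subgroups and be trivial, hence even.
\<close>

lemma r_notin_complement:
  assumes i: "i \<in> N" shows "r i \<notin> gen A r (N - {i})"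
proof
  assume "r i \<in> gen A r (N - {i})"
  then have "r i \<in> gen A r (N - {j})" if "j \<in> N" for j
    using that i r_in_gen[of i "N - {j}"] by (cases "j = i") auto
  then have "r i = \<one>" using faithful r_in_gen i by auto
  then show False using parity[OF i] by (simp add: even_gen_def generate.one)
qed

lemma gen_commute:
  assumes I: "I \<subseteq> N" "J \<subseteq> N" and far: "\<And>i j. i \<in> I \<Longrightarrow> j \<in> J \<Longrightarrow> i + 1 < j"
    and x: "x \<in> gen A r I" and y: "y \<in> gen A r J"
  shows "x \<otimes> y = y \<otimes> x"
proof -
  have one: "r i \<otimes> y = y \<otimes> r i" if i: "i \<in> I" for i
    using y I(2)
  proof (induction rule: gen_induct)
    case one
    then show ?case using r_closed i I by auto
  next
    case (step j z)
    have c: "r i \<in> carrier A" "r j \<in> carrier A" "z \<in> carrier A"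
      using r_closed i I step gen_carrier by auto
    have "r i \<otimes> (r j \<otimes> z) = (r i \<otimes> r j) \<otimes> z" using c by (simp add: m_assoc)
    also have "\<dots> = (r j \<otimes> r i) \<otimes> z" using r_comm[of i j] far[OF i step(1)] i I step(1) by (simp add: subset_iff)
    also have "\<dots> = r j \<otimes> (z \<otimes> r i)" using c step by (simp add: m_assoc)
    finally show ?case using c by (simp add: m_assoc)
  qed
  from x I(1) show ?thesis
  proof (induction rule: gen_induct)
    case one
    then show ?case using gen_carrier[OF I(2) y] by simp
  next
    case (step i z)
    have c: "r i \<in> carrier A" "z \<in> carrier A" "y \<in> carrier A"
      using r_closed I step gen_carrier y by auto
    have "(r i \<otimes> z) \<otimes> y = r i \<otimes> (y \<otimes> z)" using c step by (simp add: m_assoc)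
    also have "\<dots> = (y \<otimes> r i) \<otimes> z" using c one[OF step(1)] by (simp flip: m_assoc)
    finally show ?case using c by (simp add: m_assoc)
  qed
qed

text \<open>
  Deleting an index \<open>j\<close> disconnects the string: generators on its two sides commute.
\<close>

lemma gen_split:
  assumes I: "I \<subseteq> N" and j: "j \<notin> I" and x: "x \<in> gen A r I"
  shows "\<exists>u \<in> gen A r (I \<inter> {..<j}). \<exists>v \<in> gen A r (I \<inter> {j<..}). x = u \<otimes> v"
  using x I
proof (induction rule: gen_induct)
  case one
  then show ?case using gen_one by (metis l_one one_closed)
next
  case (step i y)
  then obtain u v where uv: "u \<in> gen A r (I \<inter> {..<j})" "v \<in> gen A r (I \<inter> {j<..})" "y = u \<otimes> v" by auto
  have c: "r i \<in> carrier A" "u \<in> carrier A" "v \<in> carrier A"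
    using uv gen_carrier[of "I \<inter> {..<j}"] gen_carrier[of "I \<inter> {j<..}"] I r_closed step by auto
  show ?case
  proof (cases "i < j")
    case True
    then have "r i \<otimes> u \<in> gen A r (I \<inter> {..<j})" using uv step I by (auto intro!: gen_mult r_in_gen)
    moreover have "r i \<otimes> y = (r i \<otimes> u) \<otimes> v" using c uv by (simp add: m_assoc)
    ultimately show ?thesis using uv by blast
  next
    case False
    then have ij: "i \<in> I \<inter> {j<..}" using step j by (cases "i = j") auto
    then have v': "r i \<otimes> v \<in> gen A r (I \<inter> {j<..})" using uv I by (auto intro!: gen_mult r_in_gen)
    have "u \<otimes> r i = r i \<otimes> u"
      using gen_commute[of "I \<inter> {..<j}" "I \<inter> {j<..}" u "r i"] uv ij I r_in_gen by fastforce
    then have "r i \<otimes> y = u \<otimes> (r i \<otimes> v)" using c uv by (simp flip: m_assoc)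
    then show ?thesis using uv v' by blast
  qed
qed

lemma intersection_property_pairwise:
  assumes ip: "intersection_property A r N'" and sub: "N' \<subseteq> N" "I \<subseteq> N'" "J \<subseteq> N'"
    and x: "x \<in> gen A r I" "x \<in> gen A r J"
  shows "x \<in> gen A r (I \<inter> J)"
proof -
  have "x \<in> gen A r (N' - {j})" if "j \<in> N' - I \<inter> J" for j
  proof (cases "j \<in> I")
    case False
    then show ?thesis using x gen_mono[of I "N' - {j}"] sub by auto
  next
    case True
    then show ?thesis using x that gen_mono[of J "N' - {j}"] sub by auto
  qed
  moreover have "x \<in> gen A r N'" using x gen_mono sub by blast
  ultimately have "x \<in> gen A r (N' - (N' - I \<inter> J))"
    using ip unfolding intersection_property_def by blast
  then show ?thesis using sub by (simp add: double_diff inf.coboundedI1)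
qed

end

section \<open>Posets whose faces are parametrized by chambers\<close>

text \<open>
  Chambers play the part of flags: \<open>fc i z\<close> is the \<open>i\<close>-face of chamber \<open>z\<close>, and two faces are incident
  if a chamber has both. The gluing condition makes this relation transitive. Several chambers
  may have the same faces.
\<close>

locale chamber_poset =
  fixes n :: int and X :: "'a ranked_poset" and C :: "'c set" and fc :: "int \<Rightarrow> 'c \<Rightarrow> 'a"
  assumes n_nonneg: "0 \<le> n" and C_nonempty: "C \<noteq> {}"
    and ord: "face_ord X = {(fc i z, fc j z) | i j z. -1 \<le> i \<and> i \<le> j \<and> j \<le> n \<and> z \<in> C}"
    and rank: "z \<in> C \<Longrightarrow> -1 \<le> i \<Longrightarrow> i \<le> n \<Longrightarrow> face_rank X (fc i z) = i"
    and least: "z \<in> C \<Longrightarrow> w \<in> C \<Longrightarrow> fc (-1) z = fc (-1) w"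
    and greatest: "z \<in> C \<Longrightarrow> w \<in> C \<Longrightarrow> fc n z = fc n w"
    and glue: "x \<in> C \<Longrightarrow> y \<in> C \<Longrightarrow> -1 \<le> j \<Longrightarrow> j \<le> n \<Longrightarrow> fc j x = fc j y \<Longrightarrow>
      \<exists>z \<in> C. (\<forall>i \<in> {-1..j}. fc i z = fc i x) \<and> (\<forall>k \<in> {j..n}. fc k z = fc k y)"
begin

lemma same_rank: "x \<in> C \<Longrightarrow> y \<in> C \<Longrightarrow> i \<in> {-1..n} \<Longrightarrow> j \<in> {-1..n} \<Longrightarrow> fc i x = fc j y \<Longrightarrow> i = j"
  by (metis atLeastAtMost_iff rank)

lemma faces_eq: "faces X = {fc i z | i z. i \<in> {-1..n} \<and> z \<in> C}"
proof (intro equalityI subsetI)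
  fix F assume "F \<in> faces X"
  then obtain G where "(F, G) \<in> face_ord X \<or> (G, F) \<in> face_ord X" by (auto simp: Field_def)
  then show "F \<in> {fc i z | i z. i \<in> {-1..n} \<and> z \<in> C}" unfolding ord by force
next
  fix F assume "F \<in> {fc i z | i z. i \<in> {-1..n} \<and> z \<in> C}"
  then obtain i z where "F = fc i z" "i \<in> {-1..n}" "z \<in> C" by blast
  then have "(F, F) \<in> face_ord X" unfolding ord by auto
  then show "F \<in> faces X" by (rule FieldI1)
qed

lemma ord_self: "z \<in> C \<Longrightarrow> -1 \<le> i \<Longrightarrow> i \<le> j \<Longrightarrow> j \<le> n \<Longrightarrow> (fc i z, fc j z) \<in> face_ord X"
  unfolding ord by blast

lemma ord_obtain:
  assumes "(F, G) \<in> face_ord X"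
  obtains i j z where "F = fc i z" "G = fc j z" "-1 \<le> i" "i \<le> j" "j \<le> n" "z \<in> C"
  using assms unfolding ord by blast

lemma ord_trans:
  assumes FG: "(F, G) \<in> face_ord X" and GH: "(G, H) \<in> face_ord X"
  shows "\<exists>i j k z. z \<in> C \<and> -1 \<le> i \<and> i \<le> j \<and> j \<le> k \<and> k \<le> n \<and> F = fc i z \<and> G = fc j z \<and> H = fc k z"
proof -
  obtain i j x where x: "F = fc i x" "G = fc j x" "-1 \<le> i" "i \<le> j" "j \<le> n" "x \<in> C"
    using FG by (rule ord_obtain)
  obtain j' k y where y: "G = fc j' y" "H = fc k y" "-1 \<le> j'" "j' \<le> k" "k \<le> n" "y \<in> C"
    using GH by (rule ord_obtain)
  have "j = j'" using same_rank[of x y j j'] x y by auto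
  then obtain z where "z \<in> C" "\<forall>i \<in> {-1..j}. fc i z = fc i x" "\<forall>k \<in> {j..n}. fc k z = fc k y"
    using glue[of x y j] x y by auto
  then show ?thesis using x y \<open>j = j'\<close> by (intro exI[of _ i] exI[of _ j] exI[of _ k] exI[of _ z]) auto
qed

lemma rank_less: "(F, G) \<in> face_ord X \<Longrightarrow> F \<noteq> G \<Longrightarrow> face_rank X F < face_rank X G"
proof -
  assume a: "(F, G) \<in> face_ord X" "F \<noteq> G"
  from a(1) obtain i j z where "F = fc i z" "G = fc j z" "-1 \<le> i" "i \<le> j" "j \<le> n" "z \<in> C"
    by (rule ord_obtain)
  then show ?thesis using a(2) rank[of z i] rank[of z j] by (cases "i = j") auto
qed

lemma partial_order: "Partial_order (face_ord X)"
proof -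
  have "refl_on (faces X) (face_ord X)"
    by (auto simp: refl_on_def faces_eq intro!: ord_self)
  moreover have "trans (face_ord X)"
  proof (rule transI)
    fix F G H assume "(F, G) \<in> face_ord X" "(G, H) \<in> face_ord X"
    from ord_trans[OF this] show "(F, H) \<in> face_ord X" by (auto intro!: ord_self)
  qed
  moreover have "antisym (face_ord X)"
  proof (rule antisymI, rule ccontr)
    fix F G assume "(F, G) \<in> face_ord X" "(G, F) \<in> face_ord X" "F \<noteq> G"
    then show False using rank_less[of F G] rank_less[of G F] by auto
  qed
  moreover have "face_ord X \<subseteq> faces X \<times> faces X" by (auto intro: FieldI1 FieldI2)
  ultimately show ?thesis unfolding partial_order_on_def preorder_on_def by blast
qed

definition chamber_flag :: "'c \<Rightarrow> 'a set" where
  "chamber_flag z = (\<lambda>i. fc i z) ` {-1..n}"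

lemma chamber_flagI: "-1 \<le> i \<Longrightarrow> i \<le> n \<Longrightarrow> F = fc i z \<Longrightarrow> F \<in> chamber_flag z"
  by (simp add: chamber_flag_def)

lemma chamber_flag_eq_iff:
  assumes "x \<in> C" "y \<in> C"
  shows "chamber_flag x = chamber_flag y \<longleftrightarrow> (\<forall>i \<in> {-1..n}. fc i x = fc i y)"
proof
  assume eq: "chamber_flag x = chamber_flag y"
  show "\<forall>i \<in> {-1..n}. fc i x = fc i y"
  proof
    fix i assume i: "i \<in> {-1..n}"
    then have "fc i x \<in> chamber_flag y" using eq by (auto simp: chamber_flag_def)
    then obtain j where "j \<in> {-1..n}" "fc i x = fc j y" by (auto simp: chamber_flag_def)
    then show "fc i x = fc i y" using same_rank assms i by metis
  qed
qed (auto simp: chamber_flag_def)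

lemma chain_ord_by_rank: "D \<in> Chains (face_ord X) \<Longrightarrow> F \<in> D \<Longrightarrow> G \<in> D \<Longrightarrow> face_rank X F \<le> face_rank X G \<Longrightarrow> (F, G) \<in> face_ord X"
  unfolding Chains_def using rank_less[of G F] by (cases "F = G") auto

text \<open>
  A chain is covered by adding its faces in order of rank: a chamber through the old faces and
  one through the new face and the highest old face are glued at the latter.
\<close>

lemma chain_in_chamber_flag:
  assumes D: "D \<in> Chains (face_ord X)"
  shows "\<exists>z \<in> C. D \<subseteq> chamber_flag z"
proof -
  have Df: "D \<subseteq> faces X" using D by (auto simp: Chains_def Field_def)
  have "face_rank X ` D \<subseteq> {-1..n}" using Df rank by (auto simp: faces_eq)
  moreover have "inj_on (face_rank X) D"
    using chain_ord_by_rank[OF D] rank_less by (intro inj_onI) (metis order.irrefl order.refl)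
  ultimately have "finite D" using finite_imageD finite_subset finite_atLeastAtMost_int by blast
  have "finite S \<Longrightarrow> S \<subseteq> D \<Longrightarrow> \<exists>z \<in> C. S \<subseteq> chamber_flag z" for S
  proof (induction S rule: finite_ranking_induct[where f = "face_rank X"])
    case empty
    then show ?case using C_nonempty by auto
  next
    case (insert F S)
    then obtain z where z: "z \<in> C" "S \<subseteq> chamber_flag z" by auto
    show ?case
    proof (cases "S = {}")
      case True
      have "F \<in> faces X" using insert.prems Df by auto
      then obtain i w where "F = fc i w" "w \<in> C" "i \<in> {-1..n}" unfolding faces_eq by blast
      then have "F \<in> chamber_flag w" by (auto simp: chamber_flag_def)
      then show ?thesis using True \<open>w \<in> C\<close> by auto
    next
      case False
      have "\<exists>E \<in> S. \<forall>G \<in> S. face_rank X G \<le> face_rank X E"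
        using Max_in[of "face_rank X ` S"] Max_ge[of "face_rank X ` S"] False insert.hyps(1) by fastforce
      then obtain E where E: "E \<in> S" "\<And>G. G \<in> S \<Longrightarrow> face_rank X G \<le> face_rank X E" by auto
      then obtain j where j: "E = fc j z" "j \<in> {-1..n}" using z by (auto simp: chamber_flag_def)
      have "(E, F) \<in> face_ord X"
        using chain_ord_by_rank[OF D, of E F] E insert by auto
      then obtain j' k u where u: "E = fc j' u" "F = fc k u" "-1 \<le> j'" "j' \<le> k" "k \<le> n" "u \<in> C"
        by (rule ord_obtain)
      then have "j' = j" using same_rank[of u z j' j] j z by auto
      then obtain v where v: "v \<in> C" "\<forall>i \<in> {-1..j}. fc i v = fc i z" "\<forall>i \<in> {j..n}. fc i v = fc i u"
        using glue[of z u j] z u j by auto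
      have "G \<in> chamber_flag v" if "G \<in> S" for G
      proof -
        have "G \<in> chamber_flag z" using that z by blast
        then obtain i where i: "G = fc i z" "i \<in> {-1..n}" by (auto simp: chamber_flag_def)
        then have "i \<le> j" using E(2)[OF that] j z rank by auto
        then show ?thesis using i v by (intro chamber_flagI[of i]) auto
      qed
      moreover have "F \<in> chamber_flag v"
        using u v \<open>j' = j\<close> by (intro chamber_flagI[of k]) auto
      ultimately show ?thesis using v by auto
    qed
  qed
  then show ?thesis using \<open>finite D\<close> by simp
qed

lemma chamber_flag_chain:
  assumes z: "z \<in> C" shows "chamber_flag z \<in> Chains (face_ord X)"
proof -
  have "(fc i z, fc j z) \<in> face_ord X \<or> (fc j z, fc i z) \<in> face_ord X"
    if "i \<in> {-1..n}" "j \<in> {-1..n}" for i j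
    using ord_self[OF z, of i j] ord_self[OF z, of j i] that by (cases "i \<le> j") auto
  then show ?thesis by (auto simp: Chains_def chamber_flag_def)
qed

lemma flags_eq: "flags X = chamber_flag ` C"
proof (intro equalityI subsetI)
  fix \<Phi> assume \<Phi>: "\<Phi> \<in> flags X"
  then obtain z where z: "z \<in> C" "\<Phi> \<subseteq> chamber_flag z"
    using chain_in_chamber_flag unfolding flags_def by blast
  moreover have "chamber_flag z \<in> Chains (face_ord X)"
    by (rule chamber_flag_chain[OF z(1)])
  ultimately show "\<Phi> \<in> chamber_flag ` C" using \<Phi> unfolding flags_def by blast
next
  fix \<Phi> assume "\<Phi> \<in> chamber_flag ` C"
  then obtain z where z: "z \<in> C" "\<Phi> = chamber_flag z" by auto
  have "\<Phi> \<in> Chains (face_ord X)"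
    unfolding z(2) by (rule chamber_flag_chain[OF z(1)])
  moreover have "D = \<Phi>" if D: "D \<in> Chains (face_ord X)" "\<Phi> \<subseteq> D" for D
  proof -
    obtain w where w: "w \<in> C" "D \<subseteq> chamber_flag w" using chain_in_chamber_flag D by blast
    have "fc i z = fc i w" if i: "i \<in> {-1..n}" for i
    proof -
      have "fc i z \<in> \<Phi>" using i z(2) by (auto simp: chamber_flag_def)
      then have "fc i z \<in> chamber_flag w" using D w by auto
      then obtain j where j: "j \<in> {-1..n}" "fc i z = fc j w" by (auto simp: chamber_flag_def)
      then show ?thesis using same_rank[of z w i j] z w i by simp
    qed
    then have "chamber_flag w = \<Phi>" using z w chamber_flag_eq_iff by simp
    then show ?thesis using D w by auto
  qed
  ultimately show "\<Phi> \<in> flags X" unfolding flags_def by blast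
qed

lemma chamber_flag_card: "z \<in> C \<Longrightarrow> finite (chamber_flag z) \<and> int (card (chamber_flag z)) = n + 2"
proof -
  assume z: "z \<in> C"
  have "inj_on (\<lambda>i. fc i z) {-1..n}" using same_rank[OF z z] by (intro inj_onI) auto
  then show ?thesis using n_nonneg by (simp add: chamber_flag_def card_image)
qed

end

locale polytopal_chamber_poset = chamber_poset +
  assumes connected: "x \<in> C \<Longrightarrow> y \<in> C \<Longrightarrow>
    \<exists>u \<in> C. (\<forall>k \<in> {-1..n}. fc k u = fc k y) \<and>
      (x, u) \<in> {(z, w). z \<in> C \<and> w \<in> C \<and>
        (\<exists>i \<in> {-1..n}. fc i z \<noteq> fc i w \<and> (\<forall>k \<in> {-1..n}. k \<noteq> i \<longrightarrow> fc k z = fc k w)) \<and>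
        (\<forall>k \<in> {-1..n}. fc k x = fc k y \<longrightarrow> fc k z = fc k x \<and> fc k w = fc k x)}\<^sup>*"
    and diamond: "z \<in> C \<Longrightarrow> 0 \<le> i \<Longrightarrow> i \<le> n - 1 \<Longrightarrow>
    \<exists>w \<in> C. fc i w \<noteq> fc i z \<and> fc (i - 1) w = fc (i - 1) z \<and> fc (i + 1) w = fc (i + 1) z \<and>
      (\<forall>u \<in> C. fc (i - 1) u = fc (i - 1) z \<and> fc (i + 1) u = fc (i + 1) z \<longrightarrow>
        fc i u = fc i z \<or> fc i u = fc i w)"
begin

lemma adjacentI:
  assumes z: "z \<in> C" "w \<in> C" and i: "i \<in> {-1..n}" "fc i z \<noteq> fc i w"
    and eq: "\<forall>k \<in> {-1..n}. k \<noteq> i \<longrightarrow> fc k z = fc k w"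
  shows "adjacent (chamber_flag z) (chamber_flag w)"
proof -
  have *: "chamber_flag x - chamber_flag y = {fc i x}"
    if "x \<in> C" "y \<in> C" "fc i x \<noteq> fc i y" "\<forall>k \<in> {-1..n}. k \<noteq> i \<longrightarrow> fc k x = fc k y" for x y
  proof -
    have "fc i x \<notin> chamber_flag y"
      using that i same_rank[of x y i] by (force simp: chamber_flag_def)
    then show ?thesis using that(4) i by (auto simp: chamber_flag_def)
  qed
  show ?thesis unfolding adjacent_def using *[of z w] *[of w z] assms by simp
qed

lemma strongly_connected: "strongly_flag_connected X"
  unfolding strongly_flag_connected_def
proof (intro ballI)
  fix \<Phi> \<Psi> assume "\<Phi> \<in> flags X" "\<Psi> \<in> flags X"
  then obtain x y where xy: "x \<in> C" "y \<in> C" "\<Phi> = chamber_flag x" "\<Psi> = chamber_flag y"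
    by (auto simp: flags_eq)
  let ?R = "{(z, w). z \<in> C \<and> w \<in> C \<and>
        (\<exists>i \<in> {-1..n}. fc i z \<noteq> fc i w \<and> (\<forall>k \<in> {-1..n}. k \<noteq> i \<longrightarrow> fc k z = fc k w)) \<and>
        (\<forall>k \<in> {-1..n}. fc k x = fc k y \<longrightarrow> fc k z = fc k x \<and> fc k w = fc k x)}"
  let ?S = "{(X', Y). X' \<in> flags X \<and> Y \<in> flags X \<and> adjacent X' Y \<and> \<Phi> \<inter> \<Psi> \<subseteq> X' \<and> \<Phi> \<inter> \<Psi> \<subseteq> Y}"
  have common: "F \<in> chamber_flag z"
    if F: "F \<in> \<Phi> \<inter> \<Psi>" and z: "\<forall>k \<in> {-1..n}. fc k x = fc k y \<longrightarrow> fc k z = fc k x" for F z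
  proof -
    obtain i where i: "i \<in> {-1..n}" "F = fc i x" using F xy by (auto simp: chamber_flag_def)
    obtain j where j: "j \<in> {-1..n}" "F = fc j y" using F xy by (auto simp: chamber_flag_def)
    then have "i = j" using same_rank xy i by metis
    then have "F = fc i z" using z i j by simp
    then show ?thesis using i by (auto simp: chamber_flag_def)
  qed
  have step: "(chamber_flag z, chamber_flag w) \<in> ?S" if "(z, w) \<in> ?R" for z w
    using that common[of _ z] common[of _ w] adjacentI[of z w] by (auto simp: flags_eq)
  obtain u where u: "u \<in> C" "\<forall>k \<in> {-1..n}. fc k u = fc k y" "(x, u) \<in> ?R\<^sup>*"
    using connected[OF xy(1,2)] by blast
  from u(3) have "(chamber_flag x, chamber_flag u) \<in> ?S\<^sup>*"
  proof induction
    case base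
    show ?case by (rule rtrancl_refl)
  next
    case (step z w)
    show ?case by (rule rtrancl_into_rtrancl[OF step(3)]) (rule \<open>\<And>z w. (z, w) \<in> ?R \<Longrightarrow> _\<close>[OF step(2)])
  qed
  moreover have "chamber_flag u = \<Psi>" using u xy chamber_flag_eq_iff by simp
  ultimately show "(\<Phi>, \<Psi>) \<in> ?S\<^sup>*" using xy by simp
qed

lemma diamond_card:
  assumes FG: "(F, G) \<in> face_ord X" and F: "face_rank X F = j - 1" and G: "face_rank X G = j + 1"
  shows "card {H. (F, H) \<in> face_ord X \<and> (H, G) \<in> face_ord X \<and> face_rank X H = j} = 2"
proof -
  obtain i k z where z: "F = fc i z" "G = fc k z" "-1 \<le> i" "i \<le> k" "k \<le> n" "z \<in> C"
    using FG by (rule ord_obtain)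
  then have ik: "i = j - 1" "k = j + 1" using F G rank by auto
  obtain w where w: "w \<in> C" "fc j w \<noteq> fc j z" "fc (j - 1) w = fc (j - 1) z" "fc (j + 1) w = fc (j + 1) z"
    and only: "\<And>u. u \<in> C \<Longrightarrow> fc (j - 1) u = fc (j - 1) z \<Longrightarrow> fc (j + 1) u = fc (j + 1) z \<Longrightarrow>
        fc j u = fc j z \<or> fc j u = fc j w"
    using diamond[of z j] z ik by auto
  have "{H. (F, H) \<in> face_ord X \<and> (H, G) \<in> face_ord X \<and> face_rank X H = j} = {fc j z, fc j w}"
  proof (intro equalityI subsetI)
    fix H assume "H \<in> {H. (F, H) \<in> face_ord X \<and> (H, G) \<in> face_ord X \<and> face_rank X H = j}"
    then have H: "(F, H) \<in> face_ord X" "(H, G) \<in> face_ord X" "face_rank X H = j" by auto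
    from ord_trans[OF H(1,2)] obtain a b c u where u: "u \<in> C" "-1 \<le> a" "a \<le> b" "b \<le> c" "c \<le> n"
      "F = fc a u" "H = fc b u" "G = fc c u" by blast
    then have "a = j - 1" "b = j" "c = j + 1" using F G H rank by auto
    then show "H \<in> {fc j z, fc j w}" using only[of u] u z ik by auto
  next
    fix H assume "H \<in> {fc j z, fc j w}"
    moreover have "(F, fc j z) \<in> face_ord X" "(fc j z, G) \<in> face_ord X"
      using z ik by (auto intro!: ord_self)
    moreover have "(F, fc j w) \<in> face_ord X" "(fc j w, G) \<in> face_ord X"
      using z ik w ord_self[of w "j - 1" j] ord_self[of w j "j + 1"] by auto
    moreover have "face_rank X (fc j z) = j" "face_rank X (fc j w) = j" using rank z w ik by auto
    ultimately show "H \<in> {H. (F, H) \<in> face_ord X \<and> (H, G) \<in> face_ord X \<and> face_rank X H = j}" by auto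
  qed
  then show ?thesis using w by simp
qed

theorem abstract_polytope: "abstract_polytope n X"
proof
  show "Partial_order (face_ord X)" by (rule partial_order)
  show "-1 \<le> face_rank X F \<and> face_rank X F \<le> n" if "F \<in> faces X" for F
    using that rank by (auto simp: faces_eq)
  show "face_rank X F < face_rank X G" if "(F, G) \<in> face_ord X" "F \<noteq> G" for F G
    using that by (rule rank_less)
  obtain z where z: "z \<in> C" using C_nonempty by auto
  have low: "(fc (-1) z, fc i w) \<in> face_ord X" if "i \<in> {-1..n}" "w \<in> C" for i w
    using ord_self[of w "-1" i] least[OF z that(2)] that by simp
  have high: "(fc i w, fc n z) \<in> face_ord X" if "i \<in> {-1..n}" "w \<in> C" for i w
    using ord_self[of w i n] greatest[OF z that(2)] that by simp
  show "\<exists>F \<in> faces X. face_rank X F = -1 \<and> (\<forall>G \<in> faces X. (F, G) \<in> face_ord X)"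
    using rank[OF z, of "-1"] low z n_nonneg by (intro bexI[of _ "fc (-1) z"]) (force simp: faces_eq)+
  show "\<exists>F \<in> faces X. face_rank X F = n \<and> (\<forall>G \<in> faces X. (G, F) \<in> face_ord X)"
    using rank[OF z, of n] high z n_nonneg by (intro bexI[of _ "fc n z"]) (force simp: faces_eq)+
  show "finite \<Phi> \<and> int (card \<Phi>) = n + 2" if "\<Phi> \<in> flags X" for \<Phi>
    using that chamber_flag_card by (auto simp: flags_eq)
  show "strongly_flag_connected X" by (rule strongly_connected)
  show "card {H. (F, H) \<in> face_ord X \<and> (H, G) \<in> face_ord X \<and> face_rank X H = j} = 2"
    if "(F, G) \<in> face_ord X" "face_rank X F = j - 1" "face_rank X G = j + 1" for F G j
    using that by (rule diamond_card)
qed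

end

section \<open>Flags of a polytope\<close>

context abstract_polytope
begin

lemma ord_refl: "F \<in> faces P \<Longrightarrow> (F, F) \<in> face_ord P"
  using partial_order by (auto simp: partial_order_on_def preorder_on_def refl_on_def)

lemma ord_trans: "(F, G) \<in> face_ord P \<Longrightarrow> (G, H) \<in> face_ord P \<Longrightarrow> (F, H) \<in> face_ord P"
  using partial_order by (meson partial_order_on_def preorder_on_def transD)

lemma ord_antisym: "(F, G) \<in> face_ord P \<Longrightarrow> (G, F) \<in> face_ord P \<Longrightarrow> F = G"
  using partial_order by (meson partial_order_on_def antisymD)

lemma ord_faces: "(F, G) \<in> face_ord P \<Longrightarrow> F \<in> faces P \<and> G \<in> faces P"
  by (auto intro: FieldI1 FieldI2)

lemma chain_faces: "D \<in> Chains (face_ord P) \<Longrightarrow> D \<subseteq> faces P"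
  by (auto simp: Chains_def Field_def)

lemma chain_ord:
  "D \<in> Chains (face_ord P) \<Longrightarrow> F \<in> D \<Longrightarrow> G \<in> D \<Longrightarrow> face_rank P F \<le> face_rank P G \<Longrightarrow> (F, G) \<in> face_ord P"
  unfolding Chains_def using rank_strict[of G F] by (cases "F = G") auto

lemma chain_rank_inj: "D \<in> Chains (face_ord P) \<Longrightarrow> inj_on (face_rank P) D"
  by (rule inj_onI) (metis chain_ord ord_antisym order.refl)

lemma chain_rank_range: "D \<in> Chains (face_ord P) \<Longrightarrow> face_rank P ` D \<subseteq> {-1..n}"
  using chain_faces rank_range by fastforce

lemma flag_chain: "\<Phi> \<in> flags P \<Longrightarrow> \<Phi> \<in> Chains (face_ord P)"
  by (simp add: flags_def)

lemma chain_with_all_ranks_is_flag: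
  assumes D: "D \<in> Chains (face_ord P)" and all: "{-1..n} \<subseteq> face_rank P ` D"
  shows "D \<in> flags P"
proof -
  have "E = D" if E: "E \<in> Chains (face_ord P)" "D \<subseteq> E" for E
  proof (intro equalityI subsetI)
    fix F assume F: "F \<in> E"
    then have "face_rank P F \<in> {-1..n}" using chain_rank_range[OF E(1)] by auto
    then obtain G where "G \<in> D" "face_rank P G = face_rank P F" using all by force
    then show "F \<in> D" using chain_rank_inj[OF E(1)] F E by (auto dest: inj_onD)
  qed (use E in auto)
  then show ?thesis using D by (auto simp: flags_def)
qed

lemma flag_ranks:
  assumes \<Phi>: "\<Phi> \<in> flags P" shows "face_rank P ` \<Phi> = {-1..n}"
proof (rule card_subset_eq)
  show "face_rank P ` \<Phi> \<subseteq> {-1..n}" using chain_rank_range flag_chain \<Phi> by auto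
  have "int (card (face_rank P ` \<Phi>)) = n + 2"
    using flag_card[OF \<Phi>] card_image[OF chain_rank_inj[OF flag_chain[OF \<Phi>]]] by simp
  then show "card (face_rank P ` \<Phi>) = card {-1..n}" by simp
qed simp

definition face_at :: "'a set \<Rightarrow> int \<Rightarrow> 'a" where
  "face_at \<Phi> i = (THE F. F \<in> \<Phi> \<and> face_rank P F = i)"

lemma face_at_eq: "\<Phi> \<in> flags P \<Longrightarrow> F \<in> \<Phi> \<Longrightarrow> face_rank P F = i \<Longrightarrow> face_at \<Phi> i = F"
  unfolding face_at_def using chain_rank_inj[OF flag_chain] by (auto dest: inj_onD)

lemma face_at_in_and_rank:
  assumes "\<Phi> \<in> flags P" "i \<in> {-1..n}"
  shows "face_at \<Phi> i \<in> \<Phi> \<and> face_rank P (face_at \<Phi> i) = i"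
proof -
  obtain F where "F \<in> \<Phi>" "face_rank P F = i" using flag_ranks assms by (metis imageE)
  then show ?thesis using face_at_eq assms by auto
qed

lemmas face_at_in = face_at_in_and_rank[THEN conjunct1]
lemmas face_at_rank = face_at_in_and_rank[THEN conjunct2]

lemma face_at_obtain:
  assumes "\<Phi> \<in> flags P" "F \<in> \<Phi>"
  obtains i where "i \<in> {-1..n}" "F = face_at \<Phi> i"
  using face_at_eq[OF assms refl] flag_ranks[OF assms(1)] assms(2) by (metis imageI)

lemma face_at_ord:
  "\<Phi> \<in> flags P \<Longrightarrow> i \<in> {-1..n} \<Longrightarrow> j \<in> {-1..n} \<Longrightarrow> i \<le> j \<Longrightarrow> (face_at \<Phi> i, face_at \<Phi> j) \<in> face_ord P"
  using chain_ord[OF flag_chain] face_at_in face_at_rank by simp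

lemma flag_eqI:
  assumes "\<Phi> \<in> flags P" "\<Psi> \<in> flags P" "\<And>i. i \<in> {-1..n} \<Longrightarrow> face_at \<Phi> i = face_at \<Psi> i"
  shows "\<Phi> = \<Psi>"
  using assms by (metis face_at_in face_at_obtain subsetI subset_antisym)

text \<open>
  This is why flags are never adjacent in rank \<open>-1\<close> or \<open>n\<close>.
\<close>

lemma extreme_faces:
  assumes "\<Phi> \<in> flags P" "\<Psi> \<in> flags P"
  shows "face_at \<Phi> (-1) = face_at \<Psi> (-1)" "face_at \<Phi> n = face_at \<Psi> n"
proof -
  obtain B where B: "B \<in> faces P" "face_rank P B = -1" "\<forall>G \<in> faces P. (B, G) \<in> face_ord P"
    using least_face by auto
  obtain T where T: "T \<in> faces P" "face_rank P T = n" "\<forall>G \<in> faces P. (G, T) \<in> face_ord P"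
    using greatest_face by auto
  have n: "-1 \<le> n" using rank_range[OF B(1)] B by auto
  have "face_at X (-1) = B \<and> face_at X n = T" if X: "X \<in> flags P" for X
  proof
    have F: "face_at X (-1) \<in> faces P" "face_at X n \<in> faces P"
      using face_at_in[OF X] chain_faces[OF flag_chain[OF X]] n by auto
    show "face_at X (-1) = B"
      using B F face_at_rank[OF X, of "-1"] rank_strict[of B "face_at X (-1)"] n by fastforce
    show "face_at X n = T"
      using T F face_at_rank[OF X, of n] rank_strict[of "face_at X n" T] n by fastforce
  qed
  then show "face_at \<Phi> (-1) = face_at \<Psi> (-1)" "face_at \<Phi> n = face_at \<Psi> n" using assms by auto
qed

definition adjacent_at :: "int \<Rightarrow> 'a set \<Rightarrow> 'a set \<Rightarrow> bool" where
  "adjacent_at i \<Phi> \<Psi> \<longleftrightarrow> \<Phi> \<in> flags P \<and> \<Psi> \<in> flags P \<and> i \<in> {0..n-1} \<and> face_at \<Phi> i \<noteq> face_at \<Psi> i \<and>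
    (\<forall>k \<in> {-1..n} - {i}. face_at \<Phi> k = face_at \<Psi> k)"

lemma adjacent_atE:
  assumes \<Phi>: "\<Phi> \<in> flags P" and \<Psi>: "\<Psi> \<in> flags P" and adj: "adjacent \<Phi> \<Psi>"
  obtains i where "adjacent_at i \<Phi> \<Psi>"
proof -
  obtain F where F: "\<Phi> - \<Psi> = {F}" using adj unfolding adjacent_def by (auto simp: card_1_singleton_iff)
  then obtain i where i: "i \<in> {-1..n}" "F = face_at \<Phi> i" using face_at_obtain[OF \<Phi>] by blast
  have "face_at \<Phi> k = face_at \<Psi> k" if k: "k \<in> {-1..n} - {i}" for k
  proof -
    have kr: "k \<in> {-1..n}" "k \<noteq> i" using k by auto
    have "face_at \<Phi> k \<noteq> F" using face_at_rank[OF \<Phi> i(1)] face_at_rank[OF \<Phi> kr(1)] i(2) kr(2) by auto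
    then have "face_at \<Phi> k \<in> \<Psi>" using F face_at_in[OF \<Phi> kr(1)] by blast
    then show ?thesis using face_at_eq[OF \<Psi> _ face_at_rank[OF \<Phi> kr(1)]] by simp
  qed
  moreover have ne: "face_at \<Phi> i \<noteq> face_at \<Psi> i"
  proof
    assume "face_at \<Phi> i = face_at \<Psi> i"
    then have "F \<in> \<Psi>" using face_at_in[OF \<Psi> i(1)] i(2) by simp
    then show False using F by blast
  qed
  moreover have "i \<in> {0..n-1}" using ne extreme_faces[OF \<Phi> \<Psi>] i(1) by (cases "i = -1 \<or> i = n") auto
  ultimately have "adjacent_at i \<Phi> \<Psi>" unfolding adjacent_at_def using \<Phi> \<Psi> by blast
  then show ?thesis by (rule that)
qed

lemma between_two:
  assumes \<Phi>: "\<Phi> \<in> flags P" and i: "i \<in> {0..n-1}"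
  shows "card {H. (face_at \<Phi> (i - 1), H) \<in> face_ord P \<and> (H, face_at \<Phi> (i + 1)) \<in> face_ord P \<and> face_rank P H = i} = 2"
  using diamond[of "face_at \<Phi> (i - 1)" "face_at \<Phi> (i + 1)" i] face_at_ord[OF \<Phi>] face_at_rank[OF \<Phi>] i
  by auto

text \<open>
  By the diamond condition, a flag leaves a single alternative for its \<open>i\<close>-face.
\<close>

lemma third_between:
  assumes \<Phi>: "\<Phi> \<in> flags P" and i: "i \<in> {0..n-1}"
    and H: "(face_at \<Phi> (i - 1), H) \<in> face_ord P" "(H, face_at \<Phi> (i + 1)) \<in> face_ord P" "face_rank P H = i" "H \<noteq> face_at \<Phi> i"
    and H': "(face_at \<Phi> (i - 1), H') \<in> face_ord P" "(H', face_at \<Phi> (i + 1)) \<in> face_ord P" "face_rank P H' = i" "H' \<noteq> face_at \<Phi> i"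
  shows "H = H'"
proof -
  let ?B = "{H. (face_at \<Phi> (i - 1), H) \<in> face_ord P \<and> (H, face_at \<Phi> (i + 1)) \<in> face_ord P \<and> face_rank P H = i}"
  obtain a b where "?B = {a, b}" using between_two[OF \<Phi> i] by (auto simp: card_2_iff)
  moreover have "face_at \<Phi> i \<in> ?B" using face_at_ord[OF \<Phi>] face_at_rank[OF \<Phi>] i by auto
  moreover have "H \<in> ?B" "H' \<in> ?B" using H H' by auto
  ultimately show ?thesis using H(4) H'(4) by auto
qed

lemma adjacent_at_between:
  assumes "adjacent_at i \<Phi> \<Psi>"
  shows "(face_at \<Phi> (i - 1), face_at \<Psi> i) \<in> face_ord P" "(face_at \<Psi> i, face_at \<Phi> (i + 1)) \<in> face_ord P"
    "face_rank P (face_at \<Psi> i) = i" "face_at \<Psi> i \<noteq> face_at \<Phi> i"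
proof -
  have \<Psi>: "\<Psi> \<in> flags P" and i: "i \<in> {0..n-1}" and ne: "face_at \<Phi> i \<noteq> face_at \<Psi> i"
    and "face_at \<Phi> (i - 1) = face_at \<Psi> (i - 1)" "face_at \<Phi> (i + 1) = face_at \<Psi> (i + 1)"
    using assms by (auto simp: adjacent_at_def)
  then show "(face_at \<Phi> (i - 1), face_at \<Psi> i) \<in> face_ord P" "(face_at \<Psi> i, face_at \<Phi> (i + 1)) \<in> face_ord P"
    "face_rank P (face_at \<Psi> i) = i" "face_at \<Psi> i \<noteq> face_at \<Phi> i"
    using face_at_ord[OF \<Psi>] face_at_rank[OF \<Psi>] by auto
qed

lemma adjacent_at_unique:
  assumes a: "adjacent_at i \<Phi> \<Psi>" "adjacent_at i \<Phi> \<Psi>'" shows "\<Psi> = \<Psi>'"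
proof (rule flag_eqI)
  show "\<Psi> \<in> flags P" "\<Psi>' \<in> flags P" using a by (auto simp: adjacent_at_def)
  fix k assume k: "k \<in> {-1..n}"
  have \<Phi>: "\<Phi> \<in> flags P" "i \<in> {0..n-1}" using a by (auto simp: adjacent_at_def)
  show "face_at \<Psi> k = face_at \<Psi>' k"
  proof (cases "k = i")
    case True
    then show ?thesis
      using third_between[OF \<Phi> adjacent_at_between[OF a(1)] adjacent_at_between[OF a(2)]] by simp
  next
    case False
    then show ?thesis using a k unfolding adjacent_at_def by (metis DiffI singletonD)
  qed
qed

lemma adjacent_at_exists:
  assumes \<Phi>: "\<Phi> \<in> flags P" and i: "i \<in> {0..n-1}"
  obtains \<Psi> where "adjacent_at i \<Phi> \<Psi>"
proof -
  let ?B = "{H. (face_at \<Phi> (i - 1), H) \<in> face_ord P \<and> (H, face_at \<Phi> (i + 1)) \<in> face_ord P \<and> face_rank P H = i}"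
  have "\<exists>H \<in> ?B. H \<noteq> face_at \<Phi> i" using between_two[OF \<Phi> i] by (auto simp: card_2_iff)
  then obtain H where H: "(face_at \<Phi> (i - 1), H) \<in> face_ord P" "(H, face_at \<Phi> (i + 1)) \<in> face_ord P"
    "face_rank P H = i" "H \<noteq> face_at \<Phi> i" by blast
  define \<Psi> where "\<Psi> = insert H (\<Phi> - {face_at \<Phi> i})"
  have cmp: "(F, H) \<in> face_ord P \<or> (H, F) \<in> face_ord P" if F: "F \<in> \<Phi> - {face_at \<Phi> i}" for F
  proof -
    obtain k where k: "k \<in> {-1..n}" "F = face_at \<Phi> k" using F face_at_obtain[OF \<Phi>] by blast
    then have "k \<le> i - 1 \<or> i + 1 \<le> k" using F by (cases "k = i") auto
    then show ?thesis
      using k i H ord_trans face_at_ord[OF \<Phi>, of k "i - 1"] face_at_ord[OF \<Phi>, of "i + 1" k] by auto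
  qed
  have HH: "(H, H) \<in> face_ord P" using H ord_faces ord_refl by blast
  have chain: "\<Psi> \<in> Chains (face_ord P)"
    using flag_chain[OF \<Phi>] cmp HH unfolding \<Psi>_def Chains_def by fastforce
  have "k \<in> face_rank P ` \<Psi>" if k: "k \<in> {-1..n}" for k
  proof (cases "k = i")
    case True
    then show ?thesis using H by (auto simp: \<Psi>_def)
  next
    case False
    then have "face_at \<Phi> k \<in> \<Psi>"
      using k face_at_in[OF \<Phi> k] face_at_rank[OF \<Phi> k] face_at_rank[OF \<Phi>, of i] i by (auto simp: \<Psi>_def)
    then show ?thesis using face_at_rank[OF \<Phi> k] by (metis imageI)
  qed
  then have \<Psi>: "\<Psi> \<in> flags P" using chain_with_all_ranks_is_flag[OF chain] by blast
  have "face_at \<Psi> i = H" using face_at_eq[OF \<Psi>] H by (auto simp: \<Psi>_def)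
  moreover have "face_at \<Psi> k = face_at \<Phi> k" if k: "k \<in> {-1..n} - {i}" for k
  proof -
    have "face_at \<Phi> k \<in> \<Psi>"
      using k face_at_in[OF \<Phi>, of k] face_at_rank[OF \<Phi>, of k] face_at_rank[OF \<Phi>, of i] i by (auto simp: \<Psi>_def)
    then show ?thesis using face_at_eq[OF \<Psi>] face_at_rank[OF \<Phi>] k by simp
  qed
  ultimately have "adjacent_at i \<Phi> \<Psi>" unfolding adjacent_at_def using \<Phi> \<Psi> i H by auto
  then show ?thesis by (rule that)
qed

text \<open>
  The form in which strong flag-connectedness is used throughout: a set of flags that contains \<open>\<Phi>\<close>
  and is closed under those changes of a single face that occur on a path to \<open>\<Psi>\<close> contains \<open>\<Psi>\<close>.
\<close>

lemma flags_reachable: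
  assumes \<Phi>: "\<Phi> \<in> flags P" and \<Psi>: "\<Psi> \<in> flags P" and S: "\<Phi> \<in> S"
    and closed: "\<And>X Y i. X \<in> S \<Longrightarrow> face_at \<Phi> i \<noteq> face_at \<Psi> i \<Longrightarrow> adjacent_at i X Y \<Longrightarrow> Y \<in> S"
  shows "\<Psi> \<in> S"
proof -
  have "(\<Phi>, \<Psi>) \<in> {(X, Y). X \<in> flags P \<and> Y \<in> flags P \<and> adjacent X Y \<and> \<Phi> \<inter> \<Psi> \<subseteq> X \<and> \<Phi> \<inter> \<Psi> \<subseteq> Y}\<^sup>*"
    using connected \<Phi> \<Psi> unfolding strongly_flag_connected_def by blast
  then show ?thesis
  proof induction
    case base
    show ?case by (rule S)
  next
    case (step X Y)
    then have XY: "X \<in> flags P" "Y \<in> flags P" "adjacent X Y" "\<Phi> \<inter> \<Psi> \<subseteq> X" "\<Phi> \<inter> \<Psi> \<subseteq> Y" by auto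
    obtain i where i: "adjacent_at i X Y" using adjacent_atE[OF XY(1,2,3)] .
    have "face_at \<Phi> i \<noteq> face_at \<Psi> i"
    proof
      assume eq: "face_at \<Phi> i = face_at \<Psi> i"
      have r: "i \<in> {-1..n}" using i by (auto simp: adjacent_at_def)
      then have "face_at \<Phi> i \<in> \<Phi> \<inter> \<Psi>" using face_at_in[OF \<Phi> r] face_at_in[OF \<Psi> r] eq by auto
      then have "face_at X i = face_at \<Phi> i" "face_at Y i = face_at \<Phi> i"
        using XY face_at_eq face_at_rank[OF \<Phi> r] by blast+
      then show False using i by (auto simp: adjacent_at_def)
    qed
    then show ?case using closed step(3) i by blast
  qed
qed

lemma face_in_flag:
  assumes F: "F \<in> faces P" obtains \<Phi> where "\<Phi> \<in> flags P" "F \<in> \<Phi>"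
proof -
  let ?A = "{D \<in> Chains (face_ord P). F \<in> D}"
  have "\<exists>M \<in> ?A. \<forall>D \<in> ?A. M \<subseteq> D \<longrightarrow> D = M"
  proof (rule subset_Zorn_nonempty)
    have "{F} \<in> ?A" using ord_refl[OF F] by (auto simp: Chains_def)
    then show "?A \<noteq> {}" by blast
    fix \<C> assume \<C>: "\<C> \<noteq> {}" "subset.chain ?A \<C>"
    have "(G, H) \<in> face_ord P \<or> (H, G) \<in> face_ord P" if GH: "G \<in> \<Union>\<C>" "H \<in> \<Union>\<C>" for G H
    proof -
      obtain D E where DE: "D \<in> \<C>" "G \<in> D" "E \<in> \<C>" "H \<in> E" using GH by auto
      then have "D \<subseteq> E \<or> E \<subseteq> D" using \<C>(2) by (auto simp: subset.chain_def)
      moreover have "D \<in> Chains (face_ord P)" "E \<in> Chains (face_ord P)"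
        using DE \<C>(2) by (auto simp: subset.chain_def)
      ultimately show ?thesis using DE by (auto simp: Chains_def)
    qed
    moreover have "F \<in> \<Union>\<C>" using \<C> by (auto simp: subset.chain_def)
    ultimately show "\<Union>\<C> \<in> ?A" by (auto simp: Chains_def)
  qed
  then obtain M where M: "M \<in> Chains (face_ord P)" "F \<in> M"
    and max: "\<And>D. D \<in> Chains (face_ord P) \<Longrightarrow> F \<in> D \<Longrightarrow> M \<subseteq> D \<Longrightarrow> D = M" by blast
  then have "M \<in> flags P" unfolding flags_def by blast
  then show ?thesis using that M by blast
qed

end

text \<open>
  Used to see that order isomorphisms between flags respect ranks.
\<close>

lemma strict_mono_int_interval_shift:
  fixes h :: "int \<Rightarrow> int"
  assumes mono: "\<And>i j. a \<le> i \<Longrightarrow> i < j \<Longrightarrow> j \<le> b \<Longrightarrow> h i < h j"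
    and img: "h ` {a..b} = {c..d}" and i: "a \<le> i" "i \<le> b"
  shows "h i = i + (c - a)"
proof -
  have lower: "a + int k \<le> b \<Longrightarrow> c + int k \<le> h (a + int k)" for k
  proof (induction k)
    case 0
    then show ?case using img by (auto simp: set_eq_iff)
  next
    case (Suc k)
    then show ?case using mono[of "a + int k" "a + int (Suc k)"] by simp
  qed
  have ca: "h a = c"
  proof -
    have "c \<in> h ` {a..b}" using img i by (metis atLeastAtMost_iff image_eqI order_trans order_refl)
    then obtain k where k: "a \<le> k" "k \<le> b" "c = h k" by auto
    then show ?thesis using mono[of a k] lower[of 0] by (cases "a = k") auto
  qed
  have step: "h (k + 1) = h k + 1" if k: "a \<le> k" "k < b" for k
  proof (rule ccontr)
    assume "h (k + 1) \<noteq> h k + 1"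
    then have gt: "h k + 1 < h (k + 1)" using mono[of k "k + 1"] k by simp
    moreover have "h k \<in> {c..d}" "h (k + 1) \<in> {c..d}" using img k by auto
    ultimately have "h k + 1 \<in> h ` {a..b}" using img by auto
    then obtain l where l: "a \<le> l" "l \<le> b" "h k + 1 = h l" by auto
    have "l \<le> k \<or> k + 1 \<le> l" by auto
    then show False
    proof
      assume "l \<le> k" then show False using mono[of l k] l k by (cases "l = k") auto
    next
      assume "k + 1 \<le> l" then show False using mono[of "k + 1" l] l k gt by (cases "l = k + 1") auto
    qed
  qed
  have "a + int k \<le> b \<Longrightarrow> h (a + int k) = c + int k" for k
  proof (induction k)
    case (Suc k)
    then show ?case using step[of "a + int k"] by (simp add: algebra_simps)
  qed (simp add: ca)
  from this[of "nat (i - a)"] show ?thesis using i by simp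
qed

section \<open>Automorphisms and distinguished involutions\<close>

lemma aut_carrier:
  "g \<in> carrier (aut_group P) \<longleftrightarrow> g \<in> Bij (faces P) \<and>
    (\<forall>F \<in> faces P. \<forall>G \<in> faces P. (F, G) \<in> face_ord P \<longleftrightarrow> (g F, g G) \<in> face_ord P)"
  by (simp add: aut_group_def)

lemma aut_bij: "g \<in> carrier (aut_group P) \<Longrightarrow> bij_betw g (faces P) (faces P)"
  by (simp add: aut_carrier Bij_def)

lemma aut_face: "g \<in> carrier (aut_group P) \<Longrightarrow> F \<in> faces P \<Longrightarrow> g F \<in> faces P"
  using aut_bij bij_betwE by blast

lemma aut_ord_iff:
  "g \<in> carrier (aut_group P) \<Longrightarrow> F \<in> faces P \<Longrightarrow> G \<in> faces P \<Longrightarrow>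
    (g F, g G) \<in> face_ord P \<longleftrightarrow> (F, G) \<in> face_ord P"
  by (simp add: aut_carrier)

lemma aut_inj: "g \<in> carrier (aut_group P) \<Longrightarrow> F \<in> faces P \<Longrightarrow> G \<in> faces P \<Longrightarrow> g F = g G \<longleftrightarrow> F = G"
  using aut_bij by (metis bij_betw_imp_inj_on inj_on_eq_iff)

lemma aut_eqI:
  assumes "g \<in> carrier (aut_group P)" "h \<in> carrier (aut_group P)" "\<And>F. F \<in> faces P \<Longrightarrow> g F = h F"
  shows "g = h"
  using assms by (auto simp: aut_carrier Bij_def intro: extensionalityI)

lemma aut_mult_apply:
  "g \<in> carrier (aut_group P) \<Longrightarrow> h \<in> carrier (aut_group P) \<Longrightarrow> F \<in> faces P \<Longrightarrow>
    (g \<otimes>\<^bsub>aut_group P\<^esub> h) F = g (h F)"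
  by (simp add: aut_group_def BijGroup_def compose_eq)

lemma aut_one_apply: "F \<in> faces P \<Longrightarrow> \<one>\<^bsub>aut_group P\<^esub> F = F"
  by (simp add: aut_group_def BijGroup_def)

lemma group_aut_group: "group (aut_group P)"
proof -
  let ?H = "{f \<in> Bij (faces P). \<forall>F \<in> faces P. \<forall>G \<in> faces P.
    (F, G) \<in> face_ord P \<longleftrightarrow> (f F, f G) \<in> face_ord P}"
  have "subgroup ?H (BijGroup (faces P))"
  proof (rule group.subgroupI[OF group_BijGroup])
    show "?H \<subseteq> carrier (BijGroup (faces P))" by (auto simp: BijGroup_def)
    have "(\<lambda>x \<in> faces P. x) \<in> ?H" by (simp add: id_Bij)
    then show "?H \<noteq> {}" by blast
    fix f assume f: "f \<in> ?H"
    then have bij: "bij_betw f (faces P) (faces P)" by (simp add: Bij_def)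
    have "inv_into (faces P) f F \<in> faces P \<and> f (inv_into (faces P) f F) = F" if "F \<in> faces P" for F
      using that bij by (metis bij_betw_def f_inv_into_f inv_into_into)
    then have "restrict (inv_into (faces P) f) (faces P) \<in> ?H"
      using f by (simp add: restrict_inv_into_Bij)
    then show "inv\<^bsub>BijGroup (faces P)\<^esub> f \<in> ?H"
      using f by (simp add: inv_BijGroup)
  next
    fix f g assume fg: "f \<in> ?H" "g \<in> ?H"
    have "g F \<in> faces P" if "F \<in> faces P" for F
      using fg that by (auto simp: Bij_def dest: bij_betwE)
    then have "compose (faces P) f g \<in> ?H" using fg by (simp add: compose_Bij compose_eq)
    then show "f \<otimes>\<^bsub>BijGroup (faces P)\<^esub> g \<in> ?H" using fg by (simp add: BijGroup_def)
  qed
  then show ?thesis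
    unfolding aut_group_def by (rule subgroup.subgroup_is_group[OF _ group_BijGroup])
qed

lemma aut_inv_apply:
  assumes g: "g \<in> carrier (aut_group P)" and F: "F \<in> faces P"
  shows "(inv\<^bsub>aut_group P\<^esub> g) (g F) = F"
proof -
  interpret group "aut_group P" by (rule group_aut_group)
  have "(inv\<^bsub>aut_group P\<^esub> g \<otimes>\<^bsub>aut_group P\<^esub> g) F = (inv\<^bsub>aut_group P\<^esub> g) (g F)"
    by (rule aut_mult_apply[OF inv_closed[OF g] g F])
  then show ?thesis using l_inv[OF g] aut_one_apply[OF F] by simp
qed

context abstract_polytope
begin

lemma flag_face: "\<Phi> \<in> flags P \<Longrightarrow> i \<in> {-1..n} \<Longrightarrow> face_at \<Phi> i \<in> faces P"
  using chain_faces flag_chain face_at_in by blast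

lemma flag_subset_faces: "\<Phi> \<in> flags P \<Longrightarrow> \<Phi> \<subseteq> faces P"
  using chain_faces flag_chain by blast

lemma flag_eq_image:
  assumes \<Phi>: "\<Phi> \<in> flags P" shows "\<Phi> = face_at \<Phi> ` {-1..n}"
proof (intro equalityI subsetI)
  fix F assume F: "F \<in> \<Phi>"
  obtain i where "i \<in> {-1..n}" "F = face_at \<Phi> i" using face_at_obtain[OF \<Phi> F] .
  then show "F \<in> face_at \<Phi> ` {-1..n}" by blast
next
  fix F assume "F \<in> face_at \<Phi> ` {-1..n}"
  then show "F \<in> \<Phi>" using face_at_in[OF \<Phi>] by blast
qed

lemma aut_image_flag:
  assumes g: "g \<in> carrier (aut_group P)" and \<Phi>: "\<Phi> \<in> flags P"
  shows "g ` \<Phi> \<in> flags P"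
proof (rule chain_with_all_ranks_is_flag)
  show chain: "g ` \<Phi> \<in> Chains (face_ord P)"
    using flag_chain[OF \<Phi>] flag_subset_faces[OF \<Phi>] aut_ord_iff[OF g]
    by (auto simp: Chains_def subset_iff)
  have inj: "inj_on g \<Phi>"
    using aut_bij[OF g] flag_subset_faces[OF \<Phi>] by (meson bij_betw_imp_inj_on inj_on_subset)
  have "face_rank P ` g ` \<Phi> = {-1..n}"
  proof (rule card_subset_eq)
    show "face_rank P ` g ` \<Phi> \<subseteq> {-1..n}" by (rule chain_rank_range[OF chain])
    have "int (card (face_rank P ` g ` \<Phi>)) = n + 2"
      using flag_card[OF \<Phi>] card_image[OF chain_rank_inj[OF chain]] card_image[OF inj] by simp
    then show "card (face_rank P ` g ` \<Phi>) = card {-1..n}" by simp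
  qed simp
  then show "{-1..n} \<subseteq> face_rank P ` g ` \<Phi>" by simp
qed

lemma aut_face_at:
  assumes g: "g \<in> carrier (aut_group P)" and \<Phi>: "\<Phi> \<in> flags P" and i: "i \<in> {-1..n}"
  shows "face_at (g ` \<Phi>) i = g (face_at \<Phi> i)"
proof -
  define h where "h i = face_rank P (g (face_at \<Phi> i))" for i
  have "h i = i + (-1 - (-1))"
  proof (rule strict_mono_int_interval_shift[of "-1" n h])
    fix k l assume kl: "-1 \<le> k" "k < l" "l \<le> n"
    have F: "face_at \<Phi> k \<in> faces P" "face_at \<Phi> l \<in> faces P" using flag_face[OF \<Phi>] kl by auto
    have "(face_at \<Phi> k, face_at \<Phi> l) \<in> face_ord P" using face_at_ord[OF \<Phi>] kl by auto
    moreover have "face_at \<Phi> k \<noteq> face_at \<Phi> l"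
      using face_at_rank[OF \<Phi>, of k] face_at_rank[OF \<Phi>, of l] kl by auto
    ultimately show "h k < h l"
      unfolding h_def using F aut_ord_iff[OF g F] aut_inj[OF g F] rank_strict by blast
  next
    have "\<Phi> = face_at \<Phi> ` {-1..n}"
      by (rule flag_eq_image[OF \<Phi>])
    then have "h ` {-1..n} = face_rank P ` g ` \<Phi>" unfolding h_def by (metis image_image)
    then show "h ` {-1..n} = {-1..n}" using flag_ranks[OF aut_image_flag[OF g \<Phi>]] by simp
  qed (use i in auto)
  then show ?thesis
    using face_at_eq[OF aut_image_flag[OF g \<Phi>]] face_at_in[OF \<Phi> i] by (simp add: h_def)
qed

lemma aut_rank:
  assumes g: "g \<in> carrier (aut_group P)" and F: "F \<in> faces P"
  shows "face_rank P (g F) = face_rank P F"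
proof -
  obtain \<Phi> where \<Phi>: "\<Phi> \<in> flags P" "F \<in> \<Phi>" using face_in_flag[OF F] .
  then obtain i where i: "i \<in> {-1..n}" "F = face_at \<Phi> i" using face_at_obtain by blast
  then show ?thesis
    using aut_face_at[OF g \<Phi>(1) i(1)] face_at_rank[OF \<Phi>(1) i(1)]
      face_at_rank[OF aut_image_flag[OF g \<Phi>(1)] i(1)] by simp
qed

lemma aut_adjacent_at:
  assumes g: "g \<in> carrier (aut_group P)" and a: "adjacent_at i \<Phi> \<Psi>"
  shows "adjacent_at i (g ` \<Phi>) (g ` \<Psi>)"
proof -
  have f: "\<Phi> \<in> flags P" "\<Psi> \<in> flags P" "i \<in> {-1..n}" using a by (auto simp: adjacent_at_def)
  show ?thesis
    unfolding adjacent_at_def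
  proof (intro conjI ballI)
    show "g ` \<Phi> \<in> flags P" "g ` \<Psi> \<in> flags P" using aut_image_flag[OF g] f by auto
    show "i \<in> {0..n-1}" using a by (simp add: adjacent_at_def)
    show "face_at (g ` \<Phi>) i \<noteq> face_at (g ` \<Psi>) i"
      using a f aut_face_at[OF g] aut_inj[OF g] flag_face by (simp add: adjacent_at_def)
    fix k assume "k \<in> {-1..n} - {i}"
    then show "face_at (g ` \<Phi>) k = face_at (g ` \<Psi>) k"
      using a f aut_face_at[OF g] by (simp add: adjacent_at_def)
  qed
qed

text \<open>
  Being fixed spreads from a flag to its neighbours, since these are determined by the rank in
  which they differ, and hence to all flags.
\<close>

lemma aut_rigid:
  assumes g: "g \<in> carrier (aut_group P)" and \<Phi>: "\<Phi> \<in> flags P"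
    and fix_flag: "\<And>i. i \<in> {-1..n} \<Longrightarrow> g (face_at \<Phi> i) = face_at \<Phi> i"
  shows "g = \<one>\<^bsub>aut_group P\<^esub>"
proof (rule aut_eqI[OF g])
  show "\<one>\<^bsub>aut_group P\<^esub> \<in> carrier (aut_group P)"
    by (rule monoid.one_closed[OF group.is_monoid[OF group_aut_group]])
  fix F assume F: "F \<in> faces P"
  obtain \<Psi> where \<Psi>: "\<Psi> \<in> flags P" "F \<in> \<Psi>" using face_in_flag[OF F] .
  let ?S = "{X \<in> flags P. \<forall>i \<in> {-1..n}. g (face_at X i) = face_at X i}"
  have "\<Psi> \<in> ?S"
  proof (rule flags_reachable[OF \<Phi> \<Psi>(1)])
    show "\<Phi> \<in> ?S" using \<Phi> fix_flag by auto
    fix X Y i assume X: "X \<in> ?S" and a: "adjacent_at i X Y"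
    have Xf: "X \<in> flags P" and Y: "Y \<in> flags P" using a by (auto simp: adjacent_at_def)
    have "g ` X = X"
      using X by (intro flag_eqI[OF aut_image_flag[OF g Xf] Xf]) (simp add: aut_face_at[OF g Xf])
    then have "adjacent_at i X (g ` Y)" using aut_adjacent_at[OF g a] by simp
    then have "g ` Y = Y" by (rule adjacent_at_unique[OF _ a])
    then show "Y \<in> ?S" using Y aut_face_at[OF g Y] by simp
  qed
  then have "g (face_at \<Psi> i) = face_at \<Psi> i" if "i \<in> {-1..n}" for i using that by blast
  then have "g F = F" using face_at_obtain[OF \<Psi>] by metis
  then show "g F = \<one>\<^bsub>aut_group P\<^esub> F" using aut_one_apply[OF F] by simp
qed

lemma aut_eq_on_flag:
  assumes g: "g \<in> carrier (aut_group P)" and h: "h \<in> carrier (aut_group P)" and \<Phi>: "\<Phi> \<in> flags P"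
    and eq: "\<And>i. i \<in> {-1..n} \<Longrightarrow> g (face_at \<Phi> i) = h (face_at \<Phi> i)"
  shows "g = h"
proof -
  interpret A: group "aut_group P" by (rule group_aut_group)
  let ?k = "inv\<^bsub>aut_group P\<^esub> h \<otimes>\<^bsub>aut_group P\<^esub> g"
  have "?k = \<one>\<^bsub>aut_group P\<^esub>"
  proof (rule aut_rigid[OF _ \<Phi>])
    show "?k \<in> carrier (aut_group P)" using g h by simp
    fix i assume i: "i \<in> {-1..n}"
    then show "?k (face_at \<Phi> i) = face_at \<Phi> i"
      using aut_mult_apply g h flag_face[OF \<Phi> i] eq aut_inv_apply[OF h] by (metis A.inv_closed)
  qed
  then show ?thesis using g h by (metis A.inv_closed A.inv_equality A.inv_inv)
qed

text \<open>
  Automorphisms are determined by the image of one flag, and the flag adjacent to \<open>\<Phi>\<close> in a given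
  rank is unique.
\<close>

lemma rho_eqI:
  assumes \<Phi>: "\<Phi> \<in> flags P" and i: "i \<in> {0..n-1}" and g: "g \<in> carrier (aut_group P)"
    and fixes_others: "\<And>k. k \<in> {-1..n} \<Longrightarrow> k \<noteq> i \<Longrightarrow> g (face_at \<Phi> k) = face_at \<Phi> k"
    and moves: "g (face_at \<Phi> i) \<noteq> face_at \<Phi> i"
  shows "rho P \<Phi> i = g"
  unfolding rho_def
proof (rule the_equality)
  have ir: "i \<in> {-1..n}" using i by auto
  have adj: "adjacent_at i \<Phi> (h ` \<Phi>)"
    if h: "h \<in> carrier (aut_group P)" and "\<And>k. k \<in> {-1..n} \<Longrightarrow> k \<noteq> i \<Longrightarrow> h (face_at \<Phi> k) = face_at \<Phi> k"
      and "h (face_at \<Phi> i) \<noteq> face_at \<Phi> i" for h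
    unfolding adjacent_at_def using that i \<Phi> aut_image_flag[OF h \<Phi>] aut_face_at[OF h \<Phi>] by auto
  have "g ` \<Phi> \<noteq> \<Phi>" using moves aut_face_at[OF g \<Phi> ir] by auto
  moreover have "{F \<in> g ` \<Phi>. face_rank P F \<noteq> i} = {F \<in> \<Phi>. face_rank P F \<noteq> i}"
  proof -
    have "g F = F" if F: "F \<in> \<Phi>" "face_rank P F \<noteq> i" for F
    proof -
      obtain k where "k \<in> {-1..n}" "F = face_at \<Phi> k" using face_at_obtain[OF \<Phi> F(1)] .
      then show ?thesis using fixes_others[of k] F face_at_rank[OF \<Phi>, of k] by auto
    qed
    moreover have "face_rank P (g F) = face_rank P F" if "F \<in> \<Phi>" for F
      using aut_rank[OF g] flag_subset_faces[OF \<Phi>] that by auto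
    ultimately have "g F = F \<or> face_rank P F = i \<and> face_rank P (g F) = i" if "F \<in> \<Phi>" for F
      using that by metis
    then show ?thesis by (force simp: image_iff)
  qed
  ultimately show "g \<in> carrier (aut_group P) \<and> g ` \<Phi> \<noteq> \<Phi> \<and>
    {F \<in> g ` \<Phi>. face_rank P F \<noteq> i} = {F \<in> \<Phi>. face_rank P F \<noteq> i}" using g by simp
  fix h assume "h \<in> carrier (aut_group P) \<and> h ` \<Phi> \<noteq> \<Phi> \<and>
    {F \<in> h ` \<Phi>. face_rank P F \<noteq> i} = {F \<in> \<Phi>. face_rank P F \<noteq> i}"
  then have h: "h \<in> carrier (aut_group P)" "h ` \<Phi> \<noteq> \<Phi>"
    "{F \<in> h ` \<Phi>. face_rank P F \<noteq> i} = {F \<in> \<Phi>. face_rank P F \<noteq> i}" by auto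
  have fixh: "h (face_at \<Phi> k) = face_at \<Phi> k" if k: "k \<in> {-1..n}" "k \<noteq> i" for k
  proof -
    have "face_at \<Phi> k \<in> h ` \<Phi>" using h(3) face_at_in[OF \<Phi> k(1)] face_at_rank[OF \<Phi> k(1)] k by auto
    then show ?thesis
      using face_at_eq[OF aut_image_flag[OF h(1) \<Phi>]] aut_face_at[OF h(1) \<Phi> k(1)] face_at_rank[OF \<Phi> k(1)]
      by simp
  qed
  have "h (face_at \<Phi> i) \<noteq> face_at \<Phi> i"
    using flag_eqI[OF aut_image_flag[OF h(1) \<Phi>] \<Phi>] fixh aut_face_at[OF h(1) \<Phi>] h(2) by metis
  then have "h ` \<Phi> = g ` \<Phi>"
    using adjacent_at_unique adj[OF h(1) fixh] adj[OF g fixes_others moves] by blast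
  then show "h = g"
    using aut_face_at[OF h(1) \<Phi>] aut_face_at[OF g \<Phi>] by (intro aut_eq_on_flag[OF h(1) g \<Phi>]) simp
qed

end

lemma carrier_rotation_group:
  assumes "involution_system (aut_group P) (rho P \<Phi>) {0..m-1}"
  shows "carrier (rotation_group m P \<Phi>) = even_gen (aut_group P) (rho P \<Phi>) {0..m-1}"
proof -
  interpret involution_system "aut_group P" "rho P \<Phi>" "{0..m-1}" by (rule assms)
  have "sigma P \<Phi> ` {1..m-1} \<subseteq> carrier (aut_group P)"
    by (auto simp: sigma_def intro!: m_closed r_closed)
  then show ?thesis
    using even_by_consecutive[of m]
    by (simp add: rotation_group_def carrier_subgroup_generated Int_absorb1 sigma_def[abs_def])
qed

locale regular_polytope = abstract_polytope +
  fixes \<Phi> :: "'a set"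
  assumes regular: "regular P" and base: "\<Phi> \<in> flags P"
begin

abbreviation \<rho> where "\<rho> \<equiv> rho P \<Phi>"

abbreviation \<Gamma> where "\<Gamma> \<equiv> gen (aut_group P) \<rho>"

lemma rho_spec:
  assumes i: "i \<in> {0..n-1}"
  shows "\<rho> i \<in> carrier (aut_group P)"
    and "\<And>k. k \<in> {-1..n} \<Longrightarrow> k \<noteq> i \<Longrightarrow> \<rho> i (face_at \<Phi> k) = face_at \<Phi> k"
    and "\<rho> i (face_at \<Phi> i) \<noteq> face_at \<Phi> i"
proof -
  obtain \<Psi> where a: "adjacent_at i \<Phi> \<Psi>" using adjacent_at_exists[OF base i] .
  then have "\<Psi> \<in> flags P" by (simp add: adjacent_at_def)
  then obtain g where g: "g \<in> carrier (aut_group P)" "g ` \<Phi> = \<Psi>"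
    using regular base unfolding regular_def by blast
  have gk: "face_at \<Psi> k = g (face_at \<Phi> k)" if "k \<in> {-1..n}" for k
    using aut_face_at[OF g(1) base that] g(2) by simp
  have fixg: "g (face_at \<Phi> k) = face_at \<Phi> k" if "k \<in> {-1..n}" "k \<noteq> i" for k
    using a that gk[OF that(1)] unfolding adjacent_at_def by (metis DiffI singletonD)
  have mov: "g (face_at \<Phi> i) \<noteq> face_at \<Phi> i"
    using a i gk[of i] unfolding adjacent_at_def by auto
  have "\<rho> i = g" by (rule rho_eqI[OF base i g(1) fixg mov])
  then show "\<rho> i \<in> carrier (aut_group P)"
    "\<And>k. k \<in> {-1..n} \<Longrightarrow> k \<noteq> i \<Longrightarrow> \<rho> i (face_at \<Phi> k) = face_at \<Phi> k"
    "\<rho> i (face_at \<Phi> i) \<noteq> face_at \<Phi> i" using g fixg mov by simp_all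
qed

abbreviation base_face :: "int \<Rightarrow> 'a" where "base_face k \<equiv> face_at \<Phi> k"

lemma base_face_in: "k \<in> {-1..n} \<Longrightarrow> base_face k \<in> faces P"
  by (rule flag_face[OF base])

text \<open>
  The other \<open>i\<close>-face between the base faces of ranks \<open>i - 1\<close> and \<open>i + 1\<close> is determined by these and
  the base face of rank \<open>i\<close>.
\<close>

lemma fixes_reflected_base_face:
  assumes g: "g \<in> carrier (aut_group P)" and i: "i \<in> {0..n-1}"
    and "g (base_face (i - 1)) = base_face (i - 1)" "g (base_face (i + 1)) = base_face (i + 1)"
    and "g (base_face i) = base_face i"
  shows "g (\<rho> i (base_face i)) = \<rho> i (base_face i)"
proof -
  let ?H = "\<rho> i (base_face i)"
  note rs = rho_spec[OF i]
  have r: "i - 1 \<in> {-1..n}" "i \<in> {-1..n}" "i + 1 \<in> {-1..n}" using i by auto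
  note f = base_face_in[OF r(1)] base_face_in[OF r(2)] base_face_in[OF r(3)]
  have Hf: "?H \<in> faces P" using aut_face[OF rs(1) f(2)] .
  have H: "(base_face (i - 1), ?H) \<in> face_ord P" "(?H, base_face (i + 1)) \<in> face_ord P"
    "face_rank P ?H = i" "?H \<noteq> base_face i"
    using aut_ord_iff[OF rs(1) f(1,2)] aut_ord_iff[OF rs(1) f(2,3)] rs(2)[of "i - 1"] rs(2)[of "i + 1"] rs(3)
      face_at_ord[OF base] r aut_rank[OF rs(1) f(2)] face_at_rank[OF base] by auto
  have gH: "(base_face (i - 1), g ?H) \<in> face_ord P" "(g ?H, base_face (i + 1)) \<in> face_ord P"
    "face_rank P (g ?H) = i" "g ?H \<noteq> base_face i"
    using assms(3-5) H aut_ord_iff[OF g f(1) Hf] aut_ord_iff[OF g Hf f(3)] aut_rank[OF g Hf]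
      aut_inj[OF g Hf f(2)] by auto
  show ?thesis by (rule third_between[OF base i gH H])
qed

lemma involutions: "involution_system (aut_group P) \<rho> {0..n-1}"
proof -
  interpret A: group "aut_group P" by (rule group_aut_group)
  show ?thesis
  proof unfold_locales
    fix i assume i: "i \<in> {0..n-1}"
    note rs = rho_spec[OF i]
    show "\<rho> i \<in> carrier (aut_group P)" by (rule rs)
    show "\<rho> i \<otimes>\<^bsub>aut_group P\<^esub> \<rho> i = \<one>\<^bsub>aut_group P\<^esub>"
    proof (rule aut_rigid[OF A.m_closed[OF rs(1) rs(1)] base])
      fix k assume k: "k \<in> {-1..n}"
      show "(\<rho> i \<otimes>\<^bsub>aut_group P\<^esub> \<rho> i) (base_face k) = base_face k"
      proof (cases "k = i")
        case False
        then show ?thesis using rs k aut_mult_apply base_face_in by metis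
      next
        case True
        \<comment> \<open>Both \<open>\<Phi>\<close> and its second image are adjacent to the first image in rank \<open>i\<close>.\<close>
        have a1: "adjacent_at i \<Phi> (\<rho> i ` \<Phi>)"
          unfolding adjacent_at_def
          using rs i base aut_image_flag[OF rs(1) base] aut_face_at[OF rs(1) base] by auto
        have a2: "adjacent_at i (\<rho> i ` \<Phi>) (\<rho> i ` \<rho> i ` \<Phi>)"
          by (rule aut_adjacent_at[OF rs(1) a1])
        have a3: "adjacent_at i (\<rho> i ` \<Phi>) \<Phi>"
          using a1 unfolding adjacent_at_def by (metis (no_types, lifting))
        have "\<rho> i ` \<rho> i ` \<Phi> = \<Phi>" by (rule adjacent_at_unique[OF a2 a3])
        then have "\<rho> i (\<rho> i (base_face k)) = base_face k"
          using aut_face_at[OF rs(1) base k] aut_face_at[OF rs(1) aut_image_flag[OF rs(1) base] k] by simp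
        then show ?thesis using aut_mult_apply[OF rs(1) rs(1) base_face_in[OF k]] by simp
      qed
    qed
  qed
qed

end

sublocale regular_polytope \<subseteq> involution_system "aut_group P" "rho P \<Phi>" "{0..n-1}"
  by (rule involutions)

context regular_polytope
begin

text \<open>
  Both products agree on the base flag, because \<open>\<rho> i\<close> fixes the base faces of ranks \<open>j - 1\<close>, \<open>j\<close>
  and \<open>j + 1\<close>, and conversely.
\<close>

lemma rho_comm:
  assumes i: "i \<in> {0..n-1}" and j: "j \<in> {0..n-1}" and ij: "i + 1 < j"
  shows "\<rho> i \<otimes>\<^bsub>aut_group P\<^esub> \<rho> j = \<rho> j \<otimes>\<^bsub>aut_group P\<^esub> \<rho> i"
proof -
  note ri = rho_spec[OF i] and rj = rho_spec[OF j]
  have fj: "\<rho> i (\<rho> j (base_face j)) = \<rho> j (base_face j)"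
    using fixes_reflected_base_face[OF ri(1) j] ri(2) ij i j by auto
  have fi: "\<rho> j (\<rho> i (base_face i)) = \<rho> i (base_face i)"
    using fixes_reflected_base_face[OF rj(1) i] rj(2) ij i j by auto
  show ?thesis
  proof (rule aut_eq_on_flag[OF m_closed[OF ri(1) rj(1)] m_closed[OF rj(1) ri(1)] base])
    fix k assume k: "k \<in> {-1..n}"
    have "\<rho> i (\<rho> j (base_face k)) = \<rho> j (\<rho> i (base_face k))"
      using fi fj ri(2)[OF k] rj(2)[OF k] ij by (cases "k = i"; cases "k = j") auto
    then show "(\<rho> i \<otimes>\<^bsub>aut_group P\<^esub> \<rho> j) (base_face k) =
        (\<rho> j \<otimes>\<^bsub>aut_group P\<^esub> \<rho> i) (base_face k)"
      using aut_mult_apply[OF ri(1) rj(1) base_face_in[OF k]]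
        aut_mult_apply[OF rj(1) ri(1) base_face_in[OF k]] by simp
  qed
qed

lemma gen_fixes:
  assumes w: "w \<in> \<Gamma> I" and I: "I \<subseteq> {0..n-1}" and k: "k \<in> {-1..n}" "k \<notin> I"
  shows "w (base_face k) = base_face k"
  using w I
proof (induction rule: gen_induct)
  case one
  then show ?case using aut_one_apply base_face_in k by metis
next
  case (step i y)
  then have i: "i \<in> {0..n-1}" "k \<noteq> i" using I k by auto
  have "(\<rho> i \<otimes>\<^bsub>aut_group P\<^esub> y) (base_face k) = \<rho> i (y (base_face k))"
    by (rule aut_mult_apply[OF rho_spec(1)[OF i(1)] gen_carrier[OF I step(2)] base_face_in[OF k(1)]])
  then show ?case using step(3) rho_spec(2)[OF i(1) k(1) i(2)] by simp
qed

text \<open>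
  The images of the base flag under words in the allowed generators are closed under the
  changes of a face on a path to \<open>g ` \<Phi>\<close>, as such a change happens in a rank outside \<open>J\<close>: the
  neighbour of \<open>w ` \<Phi>\<close> in rank \<open>i\<close> is the image of \<open>\<Phi>\<close> under \<open>w \<rho>\<^sub>i\<close>. So \<open>g ` \<Phi>\<close> is among them.
\<close>

lemma stabilizer_generated:
  assumes g: "g \<in> carrier (aut_group P)" and J: "\<And>j. j \<in> J \<Longrightarrow> g (base_face j) = base_face j"
    and JN: "J \<subseteq> {0..n-1}"
  shows "g \<in> \<Gamma> ({0..n-1} - J)"
proof -
  let ?S = "{w ` \<Phi> | w. w \<in> \<Gamma> ({0..n-1} - J)}"
  have sub: "{0..n-1} - J \<subseteq> {0..n-1}" by auto
  have "g ` \<Phi> \<in> ?S"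
  proof (rule flags_reachable[OF base aut_image_flag[OF g base]])
    have "\<one>\<^bsub>aut_group P\<^esub> ` \<Phi> = \<Phi>"
      using flag_subset_faces[OF base] by (auto simp: aut_one_apply subset_iff image_iff)
    then show "\<Phi> \<in> ?S" using gen_one by force
  next
    fix X Y i assume X: "X \<in> ?S" and ne: "base_face i \<noteq> face_at (g ` \<Phi>) i" and a: "adjacent_at i X Y"
    obtain w where w: "w \<in> \<Gamma> ({0..n-1} - J)" "X = w ` \<Phi>" using X by blast
    have wc: "w \<in> carrier (aut_group P)" using gen_carrier[OF sub w(1)] .
    have i: "i \<in> {0..n-1}" using a by (simp add: adjacent_at_def)
    then have "i \<notin> J" using ne aut_face_at[OF g base, of i] J[of i] by auto
    note rs = rho_spec[OF i]
    have "adjacent_at i \<Phi> (\<rho> i ` \<Phi>)"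
      unfolding adjacent_at_def
      using rs i base aut_image_flag[OF rs(1) base] aut_face_at[OF rs(1) base] by auto
    then have "adjacent_at i X (w ` \<rho> i ` \<Phi>)" using aut_adjacent_at[OF wc] w(2) by blast
    then have "Y = w ` \<rho> i ` \<Phi>" using adjacent_at_unique a by blast
    also have "\<dots> = (w \<otimes>\<^bsub>aut_group P\<^esub> \<rho> i) ` \<Phi>"
      unfolding image_image using flag_subset_faces[OF base]
      by (intro image_cong refl) (simp add: aut_mult_apply[OF wc rs(1)] subset_iff)
    finally show "Y \<in> ?S" using gen_mult[OF sub w(1) r_in_gen[of i "{0..n-1} - J"]] i \<open>i \<notin> J\<close> by blast
  qed
  then obtain w where w: "w \<in> \<Gamma> ({0..n-1} - J)" "g ` \<Phi> = w ` \<Phi>" by blast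
  have wc: "w \<in> carrier (aut_group P)" using gen_carrier[OF sub w(1)] .
  have "g = w"
    using aut_face_at[OF g base] aut_face_at[OF wc base] w(2)
    by (intro aut_eq_on_flag[OF g wc base]) simp
  then show ?thesis using w by simp
qed

lemma intersection: "intersection_property (aut_group P) \<rho> {0..n-1}"
  unfolding intersection_property_def
proof (intro allI impI ballI)
  fix J x assume J: "J \<subseteq> {0..n-1}" and x: "x \<in> \<Gamma> {0..n-1}"
    and all: "\<forall>j \<in> J. x \<in> \<Gamma> ({0..n-1} - {j})"
  have "x (base_face j) = base_face j" if j: "j \<in> J" for j
    using gen_fixes[of x "{0..n-1} - {j}" j] all j J by auto
  then show "x \<in> \<Gamma> ({0..n-1} - J)"
    using stabilizer_generated[OF gen_carrier[OF _ x]] J by blast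
qed

text \<open>
  If one \<open>\<rho>\<^sub>i\<close> were an even word then all of them would be, and the rotation subgroup would be
  everything.
\<close>

lemma string_system_if_index_two:
  assumes idx: "card (rcosets\<^bsub>aut_group P\<^esub> carrier (rotation_group n P \<Phi>)) = 2"
  shows "string_system (aut_group P) \<rho> {0..n-1}"
proof
  fix i j assume "i \<in> {0..n-1}" "j \<in> {0..n-1}" "i + 1 < j"
  then show "\<rho> i \<otimes>\<^bsub>aut_group P\<^esub> \<rho> j = \<rho> j \<otimes>\<^bsub>aut_group P\<^esub> \<rho> i"
    by (rule rho_comm)
next
  fix i assume i: "i \<in> {0..n-1}"
  show "\<rho> i \<notin> even_gen (aut_group P) \<rho> {0..n-1}" (is "_ \<notin> ?E")
  proof
    assume odd: "\<rho> i \<in> ?E"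
    have gen: "x \<in> ?E" if x: "x \<in> \<Gamma> {0..n-1}" for x
    proof -
      have "\<rho> i \<otimes>\<^bsub>aut_group P\<^esub> (\<rho> i \<otimes>\<^bsub>aut_group P\<^esub> x) = x"
        using r_cancel[OF i gen_carrier[OF order_refl x]] .
      then show ?thesis using gen_even_cases[OF order_refl i x] even_mult[OF order_refl odd] by metis
    qed
    then have "carrier (aut_group P) \<subseteq> ?E" using stabilizer_generated[of _ "{}"] by auto
    then have E: "?E = carrier (aut_group P)" using even_carrier[OF order_refl] by blast
    have "rcosets\<^bsub>aut_group P\<^esub> carrier (aut_group P) \<subseteq> {carrier (aut_group P)}"
      using coset_join2[OF _ subgroup_self] by (auto simp: RCOSETS_def)
    then have "card (rcosets\<^bsub>aut_group P\<^esub> carrier (aut_group P)) \<le> 1"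
      using card_mono[of "{carrier (aut_group P)}"] by simp
    then show False using idx carrier_rotation_group[OF involutions] E by simp
  qed
next
  fix x assume x: "x \<in> \<Gamma> {0..n-1}"
    and all: "\<And>j. j \<in> {0..n-1} \<Longrightarrow> x \<in> \<Gamma> ({0..n-1} - {j})"
  have "x \<in> \<Gamma> ({0..n-1} - {0..n-1})"
    using intersection x all unfolding intersection_property_def by blast
  then show "x = \<one>\<^bsub>aut_group P\<^esub>" by (simp add: gen_def generate_empty)
qed

end

lemma directly_regular_imp:
  assumes "directly_regular n P" and "\<Phi> \<in> flags P"
  shows "regular_polytope n P \<Phi>" "string_system (aut_group P) (rho P \<Phi>) {0..n-1}"
proof -
  show rp: "regular_polytope n P \<Phi>"
    using assms by (simp add: directly_regular_def regular_polytope_def regular_polytope_axioms_def)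
  show "string_system (aut_group P) (rho P \<Phi>) {0..n-1}"
    using regular_polytope.string_system_if_index_two[OF rp] assms by (simp add: directly_regular_def)
qed

section \<open>Embedding the groups of sections\<close>

text \<open>
  The map \<open>f\<close> is only controlled on the subgroup \<open>H\<close>: conjugation with an isomorphism from a
  section makes sense for automorphisms that preserve this section.
\<close>

locale subgroup_embedding =
  A: group A + B: group B + H: subgroup H A for A (structure) and B (structure) and H +
  fixes f
  assumes hom: "x \<in> H \<Longrightarrow> y \<in> H \<Longrightarrow> f (x \<otimes>\<^bsub>A\<^esub> y) = f x \<otimes>\<^bsub>B\<^esub> f y"
    and closed: "x \<in> H \<Longrightarrow> f x \<in> carrier B"
    and inj: "inj_on f H"
begin

lemma generate_in: "X \<subseteq> H \<Longrightarrow> generate A X \<subseteq> H"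
  by (rule A.generate_subgroup_incl[OF _ H.subgroup_axioms])

lemma generate_image:
  assumes X: "X \<subseteq> H" shows "generate B (f ` X) = f ` generate A X"
proof -
  have AH: "group (A\<lparr>carrier := H\<rparr>)" by (rule H.subgroup_is_group[OF A.group_axioms])
  have "f \<in> hom (A\<lparr>carrier := H\<rparr>) B" using hom closed by (auto simp: hom_def)
  then have "group_hom (A\<lparr>carrier := H\<rparr>) B f"
    using AH B.group_axioms by (simp add: group_hom_def group_hom_axioms_def)
  then have "generate B (f ` X) = f ` generate (A\<lparr>carrier := H\<rparr>) X"
    using group_hom.generate_img[of "A\<lparr>carrier := H\<rparr>" B f X] X by simp
  then show ?thesis using A.generate_consistent[OF X H.subgroup_axioms] by simp
qed

lemma one: "f \<one>\<^bsub>A\<^esub> = \<one>\<^bsub>B\<^esub>"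
  using generate_image[of "{}"] by (simp add: A.generate_empty B.generate_empty)

end

lemma subgroup_embedding_product:
  assumes "subgroup_embedding A B H f" "subgroup_embedding A' B' H' f'"
  shows "subgroup_embedding (A \<times>\<times> A') (B \<times>\<times> B') (H \<times> H') (map_prod f f')"
proof -
  interpret e: subgroup_embedding A B H f by (rule assms)
  interpret e': subgroup_embedding A' B' H' f' by (rule assms)
  have "group (A \<times>\<times> A')" "group (B \<times>\<times> B')"
    by (rule DirProd_group; unfold_locales)+
  moreover have "subgroup (H \<times> H') (A \<times>\<times> A')"
    by (rule DirProd_subgroups; unfold_locales)
  moreover have "inj_on (map_prod f f') (H \<times> H')"
    using e.inj e'.inj by (auto simp: inj_on_def)
  ultimately show ?thesis
    using e.hom e'.hom e.closed e'.closed
    by (auto simp: subgroup_embedding_def subgroup_embedding_axioms_def)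
qed

lemma section_faces:
  assumes "abstract_polytope n P"
  shows "faces (poset_section P G F) = {H. (F, H) \<in> face_ord P \<and> (H, G) \<in> face_ord P}"
proof -
  interpret abstract_polytope n P by (rule assms)
  show ?thesis
    unfolding poset_section_def by (auto simp: Field_def dest: ord_faces intro: ord_refl)
qed

context regular_polytope
begin

text \<open>
  The given isomorphism takes the preimage of \<open>\<Phi>K\<close> to \<open>\<Phi>K\<close>. This preimage extends, by the base faces
  outside the section, to a flag of \<open>P\<close>, and regularity provides an automorphism \<open>g\<close> that maps the
  base flag to it. It preserves the section, so the isomorphism can be preceded by \<open>g\<close>.
\<close>

lemma section_iso_aligned:
  fixes a b :: int and K :: "'k ranked_poset"
  assumes ab: "-1 \<le> a" "a < b" "b \<le> n"
    and K: "abstract_polytope (b - a - 1) K" and \<Phi>K: "\<Phi>K \<in> flags K"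
    and iso: "poset_isomorphic (poset_section P (base_face b) (base_face a)) K"
    and S_def: "S = {H. (base_face a, H) \<in> face_ord P \<and> (H, base_face b) \<in> face_ord P}"
  obtains f where "bij_betw f S (faces K)"
    "\<And>H H'. H \<in> S \<Longrightarrow> H' \<in> S \<Longrightarrow> (f H, f H') \<in> face_ord K \<longleftrightarrow> (H, H') \<in> face_ord P"
    "\<And>i. i \<in> {-1..b - a - 1} \<Longrightarrow> abstract_polytope.face_at K \<Phi>K i = f (base_face (a + 1 + i))"
proof -
  interpret K: abstract_polytope "b - a - 1" K by (rule K)
  let ?F = "base_face a" and ?G = "base_face b"
  have abr: "a \<in> {-1..n}" "b \<in> {-1..n}" using ab by auto
  have SF: "H \<in> faces P" if "H \<in> S" for H using that ord_faces by (auto simp: S_def)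
  obtain \<phi> where \<phi>: "bij_betw \<phi> S (faces K)"
    and \<phi>ord: "\<And>H H'. H \<in> S \<Longrightarrow> H' \<in> S \<Longrightarrow> (H, H') \<in> face_ord P \<longleftrightarrow> (\<phi> H, \<phi> H') \<in> face_ord K"
  proof -
    have fs: "faces (poset_section P ?G ?F) = S"
      unfolding S_def by (rule section_faces[OF abstract_polytope_axioms])
    have "face_ord (poset_section P ?G ?F) = Restr (face_ord P) S"
      by (simp add: poset_section_def S_def)
    then show ?thesis using iso that unfolding poset_isomorphic_def fs by auto
  qed
  have Srank: "a \<le> face_rank P H \<and> face_rank P H \<le> b" if H: "H \<in> S" for H
  proof
    have o: "(?F, H) \<in> face_ord P" "(H, ?G) \<in> face_ord P" using H by (auto simp: S_def)
    show "a \<le> face_rank P H"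
      using rank_strict[OF o(1)] face_at_rank[OF base abr(1)] by (cases "?F = H") auto
    show "face_rank P H \<le> b"
      using rank_strict[OF o(2)] face_at_rank[OF base abr(2)] by (cases "H = ?G") auto
  qed
  \<comment> \<open>The preimage of \<open>\<Phi>K\<close>; it has as many faces as there are ranks from \<open>a\<close> to \<open>b\<close>, so each occurs.\<close>
  define D where "D = {H \<in> S. \<phi> H \<in> \<Phi>K}"
  have DS: "D \<subseteq> S" by (auto simp: D_def)
  have \<phi>D: "\<phi> ` D = \<Phi>K"
    using K.flag_subset_faces[OF \<Phi>K] \<phi> by (auto simp: D_def bij_betw_def image_iff subset_iff)
  have D_chain: "D \<in> Chains (face_ord P)"
    using K.flag_chain[OF \<Phi>K] \<phi>ord by (auto simp: Chains_def D_def)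
  have injD: "inj_on \<phi> D" using \<phi> DS by (meson bij_betw_imp_inj_on inj_on_subset)
  have D_ranks: "face_rank P ` D = {a..b}"
  proof (rule card_subset_eq)
    show "face_rank P ` D \<subseteq> {a..b}" using Srank DS by fastforce
    have "card (face_rank P ` D) = card \<Phi>K"
      using card_image[OF chain_rank_inj[OF D_chain]] card_image[OF injD] \<phi>D by simp
    then have "int (card (face_rank P ` D)) = int (card {a..b})" using K.flag_card[OF \<Phi>K] ab by simp
    then show "card (face_rank P ` D) = card {a..b}" by (simp only: of_nat_eq_iff)
  qed simp
  define E where "E = base_face ` ({-1..n} - {a..b})"
  have DE: "(H, X) \<in> face_ord P \<or> (X, H) \<in> face_ord P" if H: "H \<in> D" and X: "X \<in> E" for H X
  proof -
    obtain k where k: "k \<in> {-1..n}" "k < a \<or> b < k" "X = base_face k" using X by (auto simp: E_def)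
    have o: "(?F, H) \<in> face_ord P" "(H, ?G) \<in> face_ord P" using H DS by (auto simp: S_def)
    from k(2) show ?thesis
    proof
      assume "k < a"
      then have "(X, ?F) \<in> face_ord P" unfolding k(3) by (intro face_at_ord[OF base k(1) abr(1)]) simp
      then show ?thesis using ord_trans[OF _ o(1)] by blast
    next
      assume "b < k"
      then have "(?G, X) \<in> face_ord P" unfolding k(3) by (intro face_at_ord[OF base abr(2) k(1)]) simp
      then show ?thesis using ord_trans[OF o(2)] by blast
    qed
  qed
  have EE: "(X, Y) \<in> face_ord P \<or> (Y, X) \<in> face_ord P" if "X \<in> E" "Y \<in> E" for X Y
  proof -
    have "E \<subseteq> \<Phi>" using face_at_in[OF base] by (auto simp: E_def)
    then show ?thesis using flag_chain[OF base] that unfolding Chains_def by blast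
  qed
  have "D \<union> E \<in> Chains (face_ord P)"
    using D_chain DE EE unfolding Chains_def by blast
  moreover have "{-1..n} \<subseteq> face_rank P ` (D \<union> E)"
  proof
    fix k assume k: "k \<in> {-1..n}"
    show "k \<in> face_rank P ` (D \<union> E)"
    proof (cases "k \<in> {a..b}")
      case True
      then have "k \<in> face_rank P ` D" using D_ranks by blast
      then show ?thesis by blast
    next
      case False
      then have "base_face k \<in> E" using k by (auto simp: E_def)
      then show ?thesis using face_at_rank[OF base k] by (metis UnI2 imageI)
    qed
  qed
  ultimately have \<Psi>: "D \<union> E \<in> flags P" by (rule chain_with_all_ranks_is_flag)
  have at_D: "face_at (D \<union> E) k \<in> D" if "k \<in> {a..b}" for k
  proof -
    have "k \<in> face_rank P ` D" using that D_ranks by simp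
    then obtain H where H: "H \<in> D" "face_rank P H = k" by blast
    then show ?thesis using face_at_eq[OF \<Psi>, of H k] by simp
  qed
  obtain g where g: "g \<in> carrier (aut_group P)" "g ` \<Phi> = D \<union> E"
    using regular base \<Psi> unfolding regular_def by blast
  have gk: "g (base_face k) = face_at (D \<union> E) k" if "k \<in> {-1..n}" for k
    using aut_face_at[OF g(1) base that] g(2) by simp
  have gF: "g ?F = ?F"
  proof -
    have "g ?F \<in> S" "face_rank P (g ?F) = a"
      using gk[OF abr(1)] at_D[of a] DS face_at_rank[OF \<Psi> abr(1)] ab by auto
    then show ?thesis
      using rank_strict[of ?F "g ?F"] face_at_rank[OF base abr(1)] by (cases "?F = g ?F") (auto simp: S_def)
  qed
  have gG: "g ?G = ?G"
  proof -
    have "g ?G \<in> S" "face_rank P (g ?G) = b"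
      using gk[OF abr(2)] at_D[of b] DS face_at_rank[OF \<Psi> abr(2)] ab by auto
    then show ?thesis
      using rank_strict[of "g ?G" ?G] face_at_rank[OF base abr(2)] by (auto simp: S_def)
  qed
  have gS_iff: "g H \<in> S \<longleftrightarrow> H \<in> S" if "H \<in> faces P" for H
    using aut_ord_iff[OF g(1) base_face_in[OF abr(1)] that] aut_ord_iff[OF g(1) that base_face_in[OF abr(2)]] gF gG
    by (simp add: S_def)
  have gS: "bij_betw g S S"
  proof (rule bij_betw_imageI)
    show "inj_on g S" using aut_inj[OF g(1)] SF by (auto intro: inj_onI)
    show "g ` S = S"
    proof (intro equalityI subsetI)
      fix H assume H: "H \<in> S"
      then obtain H0 where "H0 \<in> faces P" "H = g H0" using aut_bij[OF g(1)] SF by (auto simp: bij_betw_def)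
      then show "H \<in> g ` S" using gS_iff H by blast
    qed (use gS_iff SF in auto)
  qed
  let ?f = "\<phi> \<circ> g"
  have f_bij: "bij_betw ?f S (faces K)" by (rule bij_betw_trans[OF gS \<phi>])
  have f_ord: "(?f H, ?f H') \<in> face_ord K \<longleftrightarrow> (H, H') \<in> face_ord P" if "H \<in> S" "H' \<in> S" for H H'
    using that \<phi>ord[of "g H" "g H'"] gS_iff SF aut_ord_iff[OF g(1)] by simp
  have f_base: "?f (base_face k) \<in> \<Phi>K" if "k \<in> {a..b}" for k
    using gk[of k] at_D[OF that] that ab by (auto simp: D_def)
  have base_S: "base_face k \<in> S" if "k \<in> {a..b}" for k
    using that ab face_at_ord[OF base] by (auto simp: S_def)
  define h where "h k = face_rank K (?f (base_face k))" for k
  have h_mono: "h k < h l" if "a \<le> k" "k < l" "l \<le> b" for k l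
  proof -
    have kl: "k \<in> {a..b}" "l \<in> {a..b}" "k \<in> {-1..n}" "l \<in> {-1..n}" using that ab by auto
    have "(base_face k, base_face l) \<in> face_ord P" using face_at_ord[OF base kl(3,4)] that by simp
    moreover have "base_face k \<noteq> base_face l"
      using face_at_rank[OF base kl(3)] face_at_rank[OF base kl(4)] that by auto
    ultimately show ?thesis
      unfolding h_def using f_ord[OF base_S base_S] kl base_S
        K.rank_strict f_bij by (metis bij_betw_imp_inj_on inj_onD)
  qed
  have h_img: "h ` {a..b} = {-1..b - a - 1}"
  proof (rule card_subset_eq)
    show "h ` {a..b} \<subseteq> {-1..b - a - 1}"
      using f_base K.flag_ranks[OF \<Phi>K] unfolding h_def by blast
    have "inj_on h {a..b}" using h_mono by (intro linorder_inj_onI) force+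
    then show "card (h ` {a..b}) = card {-1..b - a - 1}" using ab by (simp add: card_image)
  qed simp
  have "K.face_at \<Phi>K i = ?f (base_face (a + 1 + i))" if i: "i \<in> {-1..b - a - 1}" for i
  proof -
    have "h (a + 1 + i) = a + 1 + i + (-1 - a)"
      by (rule strict_mono_int_interval_shift[OF h_mono h_img]) (use i in auto)
    then show ?thesis using K.face_at_eq[OF \<Phi>K f_base[of "a + 1 + i"]] i by (simp add: h_def)
  qed
  then show ?thesis using that[OF f_bij f_ord] by blast
qed

text \<open>
  Conjugation with the aligned isomorphism \<open>f\<close>. It is injective because an element of the subgroup
  fixes the base faces outside the section, and is determined by its action on the base flag.
  The image of \<open>\<rho>\<^sub>i\<close> changes exactly one face of the base flag of \<open>K\<close>, hence is a distinguished
  involution again; ranks in \<open>K\<close> are lower by \<open>a + 1\<close>.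
\<close>

lemma section_embedding:
  fixes a b :: int and K :: "'k ranked_poset"
  assumes ab: "-1 \<le> a" "a < b" "b \<le> n"
    and K: "abstract_polytope (b - a - 1) K" and \<Phi>K: "\<Phi>K \<in> flags K"
    and iso: "poset_isomorphic (poset_section P (base_face b) (base_face a)) K"
  obtains \<psi> where "subgroup_embedding (aut_group P) (aut_group K) (\<Gamma> {a+1..b-1}) \<psi>"
    "\<And>i. i \<in> {0..b - a - 2} \<Longrightarrow> \<psi> (\<rho> (a + 1 + i)) = rho K \<Phi>K i"
proof -
  interpret K: abstract_polytope "b - a - 1" K by (rule K)
  define S where "S = {H. (base_face a, H) \<in> face_ord P \<and> (H, base_face b) \<in> face_ord P}"
  obtain f where f_bij: "bij_betw f S (faces K)"
    and f_ord: "\<And>H H'. H \<in> S \<Longrightarrow> H' \<in> S \<Longrightarrow> (f H, f H') \<in> face_ord K \<longleftrightarrow> (H, H') \<in> face_ord P"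
    and f_base: "\<And>i. i \<in> {-1..b - a - 1} \<Longrightarrow> K.face_at \<Phi>K i = f (base_face (a + 1 + i))"
    using section_iso_aligned[OF ab K \<Phi>K iso S_def] by blast
  let ?A = "aut_group P" and ?B = "aut_group K" and ?U = "\<Gamma> {a+1..b-1}"
  have U: "{a+1..b-1} \<subseteq> {0..n-1}" using ab by auto
  have abr: "a \<in> {-1..n}" "b \<in> {-1..n}" using ab by auto
  have SF: "H \<in> faces P" if "H \<in> S" for H using that ord_faces by (auto simp: S_def)
  have base_S: "base_face k \<in> S" if "k \<in> {a..b}" for k
    using that ab face_at_ord[OF base] by (auto simp: S_def)
  have Uc: "g \<in> carrier ?A" if "g \<in> ?U" for g using gen_carrier[OF U that] .
  have US: "g H \<in> S \<longleftrightarrow> H \<in> S" if g: "g \<in> ?U" and H: "H \<in> faces P" for g H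
    using aut_ord_iff[OF Uc[OF g] base_face_in[OF abr(1)] H] aut_ord_iff[OF Uc[OF g] H base_face_in[OF abr(2)]]
      gen_fixes[OF g U abr(1)] gen_fixes[OF g U abr(2)] by (simp add: S_def)
  define \<psi> where "\<psi> g = (\<lambda>X \<in> faces K. f (g (inv_into S f X)))" for g
  have fS: "f H \<in> faces K" if "H \<in> S" for H using f_bij that bij_betwE by blast
  have \<psi>f: "\<psi> g (f H) = f (g H)" if "H \<in> S" for g H
    using that fS f_bij by (simp add: \<psi>_def bij_betw_inv_into_left)
  have f_surj: "\<exists>H \<in> S. X = f H" if "X \<in> faces K" for X
    using that f_bij by (auto simp: bij_betw_def)
  have f_inj: "f H = f H' \<longleftrightarrow> H = H'" if "H \<in> S" "H' \<in> S" for H H'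
    using that f_bij by (meson bij_betw_imp_inj_on inj_on_eq_iff)
  have \<psi>_aut: "\<psi> g \<in> carrier ?B" if g: "g \<in> ?U" for g
  proof -
    have gS: "g H \<in> S" if "H \<in> S" for H using US[OF g] SF that by blast
    have "bij_betw (\<psi> g) (faces K) (faces K)"
    proof (rule bij_betw_imageI)
      show "inj_on (\<psi> g) (faces K)"
      proof (rule inj_onI)
        fix X Y assume "X \<in> faces K" "Y \<in> faces K" and eq: "\<psi> g X = \<psi> g Y"
        then obtain H H' where H: "H \<in> S" "X = f H" "H' \<in> S" "Y = f H'" using f_surj by blast
        then have "g H = g H'" using eq \<psi>f gS f_inj by simp
        then show "X = Y" using aut_inj[OF Uc[OF g]] SF H by simp
      qed
      show "\<psi> g ` faces K = faces K"
      proof (intro equalityI subsetI)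
        fix Y assume "Y \<in> \<psi> g ` faces K"
        then show "Y \<in> faces K" using f_surj \<psi>f gS fS by fastforce
      next
        fix Y assume "Y \<in> faces K"
        then obtain H where H: "H \<in> S" "Y = f H" using f_surj by blast
        then obtain H0 where H0: "H0 \<in> faces P" "H = g H0"
          using aut_bij[OF Uc[OF g]] SF by (auto simp: bij_betw_def)
        then have "H0 \<in> S" using US[OF g] H by blast
        then have "Y = \<psi> g (f H0)" "f H0 \<in> faces K" using \<psi>f H H0 fS by auto
        then show "Y \<in> \<psi> g ` faces K" by blast
      qed
    qed
    moreover have "\<psi> g \<in> extensional (faces K)" by (simp add: \<psi>_def)
    moreover have "(X, Y) \<in> face_ord K \<longleftrightarrow> (\<psi> g X, \<psi> g Y) \<in> face_ord K"
      if XY: "X \<in> faces K" "Y \<in> faces K" for X Y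
    proof -
      obtain H H' where H: "H \<in> S" "X = f H" "H' \<in> S" "Y = f H'" using f_surj XY by blast
      then show ?thesis using \<psi>f f_ord gS aut_ord_iff[OF Uc[OF g]] SF by simp
    qed
    ultimately show ?thesis by (simp add: aut_carrier Bij_def)
  qed
  have emb: "subgroup_embedding ?A ?B ?U \<psi>"
  proof (intro subgroup_embedding.intro subgroup_embedding_axioms.intro)
    show "group ?A" "group ?B" by (rule group_aut_group)+
    show "subgroup ?U ?A" by (rule gen_is_subgroup[OF U])
    show "\<psi> g \<in> carrier ?B" if "g \<in> ?U" for g by (rule \<psi>_aut[OF that])
    show "\<psi> (g \<otimes>\<^bsub>?A\<^esub> h) = \<psi> g \<otimes>\<^bsub>?B\<^esub> \<psi> h" if g: "g \<in> ?U" and h: "h \<in> ?U" for g h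
    proof (rule aut_eqI)
      show "\<psi> (g \<otimes>\<^bsub>?A\<^esub> h) \<in> carrier ?B" by (rule \<psi>_aut[OF gen_mult[OF U g h]])
      show "\<psi> g \<otimes>\<^bsub>?B\<^esub> \<psi> h \<in> carrier ?B"
        by (rule monoid.m_closed[OF group.is_monoid[OF group_aut_group] \<psi>_aut[OF g] \<psi>_aut[OF h]])
      fix X assume X: "X \<in> faces K"
      obtain H where H: "H \<in> S" "X = f H" using f_surj[OF X] by blast
      have "h H \<in> S" using US[OF h] H SF by blast
      then show "\<psi> (g \<otimes>\<^bsub>?A\<^esub> h) X = (\<psi> g \<otimes>\<^bsub>?B\<^esub> \<psi> h) X"
        using aut_mult_apply[OF \<psi>_aut[OF g] \<psi>_aut[OF h] X] H \<psi>f
          aut_mult_apply[OF Uc[OF g] Uc[OF h] SF[OF H(1)]] by simp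
    qed
    show "inj_on \<psi> ?U"
    proof (rule inj_onI)
      fix g h assume g: "g \<in> ?U" and h: "h \<in> ?U" and eq: "\<psi> g = \<psi> h"
      show "g = h"
      proof (rule aut_eq_on_flag[OF Uc[OF g] Uc[OF h] base])
        fix k assume k: "k \<in> {-1..n}"
        show "g (base_face k) = h (base_face k)"
        proof (cases "k \<in> {a..b}")
          case True
          have "g (base_face k) \<in> S" "h (base_face k) \<in> S"
            using US[OF g] US[OF h] base_S[OF True] SF by blast+
          then show ?thesis using \<psi>f[OF base_S[OF True]] eq f_inj by metis
        next
          case False
          then show ?thesis using gen_fixes[OF g U k] gen_fixes[OF h U k] by auto
        qed
      qed
    qed
  qed
  have "\<psi> (\<rho> (a + 1 + i)) = rho K \<Phi>K i" if i: "i \<in> {0..b - a - 2}" for i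
  proof -
    let ?r = "\<rho> (a + 1 + i)"
    have iN: "a + 1 + i \<in> {0..n-1}" "a + 1 + i \<in> {a+1..b-1}" using i ab by auto
    note rs = rho_spec[OF iN(1)]
    have rU: "?r \<in> ?U" using r_in_gen[OF iN(2)] .
    have act: "\<psi> ?r (K.face_at \<Phi>K k) = f (?r (base_face (a + 1 + k)))" if k: "k \<in> {-1..b - a - 1}" for k
      using f_base[OF k] \<psi>f base_S[of "a + 1 + k"] k by simp
    have "rho K \<Phi>K i = \<psi> ?r"
    proof (rule K.rho_eqI[OF \<Phi>K _ \<psi>_aut[OF rU]])
      show "i \<in> {0..b - a - 1 - 1}" using i by auto
      fix k assume k: "k \<in> {-1..b - a - 1}" "k \<noteq> i"
      then show "\<psi> ?r (K.face_at \<Phi>K k) = K.face_at \<Phi>K k"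
        using act[OF k(1)] f_base[OF k(1)] rs(2)[of "a + 1 + k"] ab by simp
    next
      have ii: "i \<in> {-1..b - a - 1}" using i by auto
      have bS: "base_face (a + 1 + i) \<in> S" using base_S i by auto
      then have "?r (base_face (a + 1 + i)) \<in> S" using US[OF rU] SF by blast
      then show "\<psi> ?r (K.face_at \<Phi>K i) \<noteq> K.face_at \<Phi>K i"
        using act[OF ii] f_base[OF ii] f_inj[OF _ bS] rs(3) by simp
    qed
    then show ?thesis by simp
  qed
  then show ?thesis using that emb by blast
qed

lemma bottom_face_eq: "bottom_face P = base_face (-1)"
proof -
  obtain B where B: "B \<in> faces P" "face_rank P B = -1" "\<forall>G \<in> faces P. (B, G) \<in> face_ord P"
    using least_face by auto
  have "-1 \<le> n" using rank_range[OF B(1)] B by auto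
  then have r: "-1 \<in> {-1..n}" by simp
  have BB: "base_face (-1) = B"
    using B base_face_in[OF r] face_at_rank[OF base r] rank_strict[of B "base_face (-1)"] by fastforce
  show ?thesis unfolding bottom_face_def
    by (rule the_equality) (use B BB ord_antisym in auto)
qed

lemma top_face_eq: "top_face P = base_face n"
proof -
  obtain B where B: "B \<in> faces P" "face_rank P B = n" "\<forall>G \<in> faces P. (G, B) \<in> face_ord P"
    using greatest_face by auto
  have "-1 \<le> n" using rank_range[OF B(1)] B by auto
  then have r: "n \<in> {-1..n}" by simp
  have BB: "base_face n = B"
    using B base_face_in[OF r] face_at_rank[OF base r] rank_strict[of "base_face n" B] by fastforce
  show ?thesis unfolding top_face_def
    by (rule the_equality) (use B BB ord_antisym in auto)
qed

lemma base_sections: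
  assumes n: "1 \<le> n"
  shows "has_facets n P K \<Longrightarrow> poset_isomorphic (poset_section P (base_face (n - 1)) (base_face (-1))) K"
    and "has_vertex_figures P L \<Longrightarrow> poset_isomorphic (poset_section P (base_face n) (base_face 0)) L"
    and "has_medial_sections n P M \<Longrightarrow> poset_isomorphic (poset_section P (base_face (n - 1)) (base_face 0)) M"
proof -
  have r: "0 \<in> {-1..n}" "n - 1 \<in> {-1..n}" using n by auto
  note f = base_face_in[OF r(1)] face_at_rank[OF base r(1)] base_face_in[OF r(2)] face_at_rank[OF base r(2)]
  have "(base_face 0, base_face (n - 1)) \<in> face_ord P" using face_at_ord[OF base r] n by simp
  then show "has_facets n P K \<Longrightarrow> poset_isomorphic (poset_section P (base_face (n - 1)) (base_face (-1))) K"
    and "has_vertex_figures P L \<Longrightarrow> poset_isomorphic (poset_section P (base_face n) (base_face 0)) L"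
    and "has_medial_sections n P M \<Longrightarrow> poset_isomorphic (poset_section P (base_face (n - 1)) (base_face 0)) M"
    using f unfolding has_facets_def has_vertex_figures_def has_medial_sections_def
      bottom_face_eq top_face_eq by blast+
qed

end

section \<open>The coset poset of a string system\<close>

text \<open>
  With chambers also assigned the two improper faces, incidence has a uniform description without
  case distinctions. This serves coset posets, polygons and the segment.
\<close>

lemma bounded_poset_chambers:
  fixes fc :: "int \<Rightarrow> 'c \<Rightarrow> 'g mix_face"
  assumes n: "0 \<le> n" and C: "C \<noteq> {}"
    and bot: "\<And>z. fc (-1) z = MinFace" and top: "\<And>z. fc n z = MaxFace"
    and S: "S = {fc i z | i z. i \<in> {0..n-1} \<and> z \<in> C}"
    and proper: "\<And>i z. i \<in> {0..n-1} \<Longrightarrow> fc i z \<noteq> MinFace \<and> fc i z \<noteq> MaxFace"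
    and R: "\<And>i j x y. i \<in> {0..n-1} \<Longrightarrow> j \<in> {0..n-1} \<Longrightarrow> x \<in> C \<Longrightarrow> y \<in> C \<Longrightarrow>
      R (fc i x) (fc j y) \<longleftrightarrow> i < j \<and> (\<exists>z \<in> C. fc i z = fc i x \<and> fc j z = fc j y)"
  shows "face_ord (bounded_poset n S R) = {(fc i z, fc j z) | i j z. -1 \<le> i \<and> i \<le> j \<and> j \<le> n \<and> z \<in> C}"
    (is "_ = ?T")
proof -
  let ?U = "insert MinFace (insert MaxFace S)"
  have in_T: "(fc i z, fc j z) \<in> ?T" if "-1 \<le> i" "i \<le> j" "j \<le> n" "z \<in> C" for i j z
    using that by blast
  have U: "\<exists>i z. i \<in> {-1..n} \<and> z \<in> C \<and> u = fc i z" if u: "u \<in> ?U" for u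
  proof -
    obtain z where z: "z \<in> C" using C by blast
    consider "u = MinFace" | "u = MaxFace" | "u \<in> S" using u by blast
    then show ?thesis
    proof cases
      case 1
      then show ?thesis using z n bot[of z] by (intro exI[of _ "-1"] exI[of _ z]) simp
    next
      case 2
      then show ?thesis using z n top[of z] by (intro exI[of _ n] exI[of _ z]) simp
    next
      case 3
      then obtain i w where "u = fc i w" "i \<in> {0..n-1}" "w \<in> C" unfolding S by blast
      then show ?thesis by (intro exI[of _ i] exI[of _ w]) auto
    qed
  qed
  have fcU: "fc i z \<in> ?U" if "i \<in> {-1..n}" "z \<in> C" for i z
  proof -
    consider "i = -1" | "i = n" | "i \<in> {0..n-1}" using \<open>i \<in> {-1..n}\<close> by fastforce
    then show ?thesis
    proof cases
      case 3
      then show ?thesis using that unfolding S by blast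
    qed (simp_all add: bot top)
  qed
  show ?thesis
  proof (intro equalityI subsetI)
    fix p assume "p \<in> face_ord (bounded_poset n S R)"
    then obtain u v where p: "p = (u, v)" and uv: "u \<in> ?U" "v \<in> ?U"
      and rel: "u = v \<or> u = MinFace \<or> v = MaxFace \<or> u \<in> S \<and> v \<in> S \<and> R u v"
      unfolding bounded_poset_def by auto
    obtain i x where x: "i \<in> {-1..n}" "x \<in> C" "u = fc i x" using U[OF uv(1)] by blast
    obtain j y where y: "j \<in> {-1..n}" "y \<in> C" "v = fc j y" using U[OF uv(2)] by blast
    from rel consider "u = v" | "u = MinFace" | "v = MaxFace" | "u \<in> S" "v \<in> S" "R u v" by blast
    then show "p \<in> ?T"
    proof cases
      case 1
      then show ?thesis using in_T[of i i x] x p by simp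
    next
      case 2
      then show ?thesis using in_T[of "-1" j y] y p bot[of y] by simp
    next
      case 3
      then show ?thesis using in_T[of i n x] x p top[of x] by simp
    next
      case 4
      obtain i' x' where x': "u = fc i' x'" "i' \<in> {0..n-1}" "x' \<in> C" using 4(1) unfolding S by blast
      obtain j' y' where y': "v = fc j' y'" "j' \<in> {0..n-1}" "y' \<in> C" using 4(2) unfolding S by blast
      obtain z where "z \<in> C" "fc i' z = u" "fc j' z = v" "i' < j'"
        using R[OF x'(2) y'(2) x'(3) y'(3)] 4(3) x' y' by auto
      then show ?thesis using in_T[of i' j' z] x' y' p by auto
    qed
  next
    fix p assume "p \<in> ?T"
    then obtain i j z where z: "p = (fc i z, fc j z)" "-1 \<le> i" "i \<le> j" "j \<le> n" "z \<in> C" by blast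
    have uv: "fc i z \<in> ?U" "fc j z \<in> ?U" using fcU z by auto
    have "fc i z = fc j z \<or> fc i z = MinFace \<or> fc j z = MaxFace \<or> fc i z \<in> S \<and> fc j z \<in> S \<and> R (fc i z) (fc j z)"
    proof (cases "i = j \<or> i = -1 \<or> j = n")
      case True
      then show ?thesis using bot[of z] top[of z] by auto
    next
      case False
      then have ij: "i \<in> {0..n-1}" "j \<in> {0..n-1}" "i < j" using z by auto
      then have "R (fc i z) (fc j z)" using R[OF ij(1,2) z(5) z(5)] z(5) by blast
      moreover have "fc i z \<in> S" "fc j z \<in> S" using ij z(5) unfolding S by blast+
      ultimately show ?thesis by blast
    qed
    then show "p \<in> face_ord (bounded_poset n S R)"
      using uv z(1) unfolding bounded_poset_def by simp
  qed
qed

locale coset_geometry = string_system A r "{0..n-1}"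
  for A :: "'g monoid" (structure) and r :: "int \<Rightarrow> 'g" and n :: int +
  fixes \<beta> :: "int \<Rightarrow> 'g"
  assumes rank: "3 \<le> n" and \<beta>: "i \<in> {1..n-1} \<Longrightarrow> \<beta> i = r (i - 1) \<otimes> r i"
begin

abbreviation "N \<equiv> {0..n-1}"
abbreviation "\<Delta> \<equiv> gen A r"
abbreviation "E \<equiv> even_gen A r N"
abbreviation "G \<equiv> A\<lparr>carrier := E\<rparr>"

lemma gen_word_eq: "1 \<le> i \<Longrightarrow> i \<le> j \<Longrightarrow> j \<le> n - 1 \<Longrightarrow> gen_word G \<beta> i j = r (i - 1) \<otimes> r j"
proof (induction "nat (j - i)" arbitrary: i)
  case 0
  then have "i = j" by simp
  then show ?case using 0 \<beta>[of i] by (simp add: gen_word_def r_closed)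
next
  case (Suc k)
  then have ij: "i < j" by simp
  have IH: "gen_word G \<beta> (i + 1) j = r i \<otimes> r j"
    using Suc(1)[of "i + 1"] Suc(2-) ij by simp
  have "gen_word G \<beta> i j = \<beta> i \<otimes> gen_word G \<beta> (i + 1) j"
    using ij by (simp add: gen_word_def upto_rec1)
  also have "\<dots> = r (i - 1) \<otimes> r j"
    unfolding IH using \<beta>[of i] Suc(2-) ij r_closed r_cancel by (simp add: m_assoc)
  finally show ?case .
qed

lemma gen_subgroup_eq:
  assumes I: "I \<subseteq> N" shows "gen_subgroup n G \<beta> I = even_gen A r I"
proof -
  let ?X = "{r a \<otimes> r b | a b. a \<in> I \<and> b \<in> I \<and> a < b}"
  have "{gen_word G \<beta> i j | i j. 1 \<le> i \<and> i \<le> j \<and> j \<le> n - 1 \<and> i - 1 \<in> I \<and> j \<in> I} = ?X"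
  proof (intro equalityI subsetI)
    fix x assume "x \<in> {gen_word G \<beta> i j | i j. 1 \<le> i \<and> i \<le> j \<and> j \<le> n - 1 \<and> i - 1 \<in> I \<and> j \<in> I}"
    then obtain i j where ij: "x = gen_word G \<beta> i j" "1 \<le> i" "i \<le> j" "j \<le> n - 1" "i - 1 \<in> I" "j \<in> I" by blast
    then have "x = r (i - 1) \<otimes> r j" using gen_word_eq by simp
    then show "x \<in> ?X" using ij by force
  next
    fix x assume "x \<in> ?X"
    then obtain a b where ab: "x = r a \<otimes> r b" "a \<in> I" "b \<in> I" "a < b" by blast
    then have "a \<in> N" "b \<in> N" using I by blast+
    then have "x = gen_word G \<beta> (a + 1) b" "0 \<le> a" "b \<le> n - 1" using gen_word_eq[of "a + 1" b] ab by auto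
    then show "x \<in> {gen_word G \<beta> i j | i j. 1 \<le> i \<and> i \<le> j \<and> j \<le> n - 1 \<and> i - 1 \<in> I \<and> j \<in> I}"
      using ab by (intro CollectI exI[of _ "a + 1"] exI[of _ b]) auto
  qed
  then have "gen_subgroup n G \<beta> I = generate G ?X" by (simp add: gen_subgroup_def)
  also have "\<dots> = generate A ?X"
    by (rule generate_consistent; use I in \<open>auto intro!: pair_in_even even_is_subgroup\<close>)
  also have "\<dots> = even_gen A r I"
  proof
    show "generate A ?X \<subseteq> even_gen A r I"
      unfolding even_gen_def by (rule mono_generate) blast
    have sub: "subgroup (generate A ?X) A"
      by (rule generate_is_subgroup) (use I in \<open>auto simp: subset_iff intro!: m_closed r_closed\<close>)
    show "even_gen A r I \<subseteq> generate A ?X"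
      unfolding even_gen_def
    proof (rule generate_subgroup_incl[OF _ sub], clarify)
      fix a b assume ab: "a \<in> I" "b \<in> I"
      consider "a < b" | "a = b" | "b < a" by linarith
      then show "r a \<otimes> r b \<in> generate A ?X"
      proof cases
        case 1
        then show ?thesis using ab by (intro generate.incl) blast
      next
        case 2
        then show ?thesis using ab I by (simp add: r_sq generate.one subset_iff)
      next
        case 3
        then have "r b \<otimes> r a \<in> generate A ?X" using ab by (intro generate.incl) blast
        then have "inv (r b \<otimes> r a) \<in> generate A ?X" using subgroup.m_inv_closed[OF sub] by blast
        then show ?thesis using ab I by (simp add: inv_mult_group r_closed r_inv subset_iff)
      qed
    qed
  qed
  finally show ?thesis .
qed

lemma chamber_carrier: "x \<in> \<Delta> N \<Longrightarrow> x \<in> carrier A"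
  by (rule gen_carrier[OF order_refl])

lemma E_chamber: "x \<in> E \<Longrightarrow> x \<in> \<Delta> N"
  using even_subset_gen[OF order_refl] by blast

lemma in_coset_iff:
  assumes I: "I \<subseteq> N" and x: "x \<in> carrier A"
  shows "z \<in> \<Delta> I #> x \<longleftrightarrow> z \<in> carrier A \<and> z \<otimes> inv x \<in> \<Delta> I"
proof
  assume "z \<in> \<Delta> I #> x"
  then obtain h where h: "h \<in> \<Delta> I" "z = h \<otimes> x" by (auto simp: r_coset_def)
  then show "z \<in> carrier A \<and> z \<otimes> inv x \<in> \<Delta> I" using gen_carrier[OF I h(1)] x by (simp add: m_assoc)
next
  assume z: "z \<in> carrier A \<and> z \<otimes> inv x \<in> \<Delta> I"
  then have "z = (z \<otimes> inv x) \<otimes> x" using x by (simp add: m_assoc)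
  then show "z \<in> \<Delta> I #> x" using z by (auto simp: r_coset_def)
qed

lemma coset_sym: "I \<subseteq> N \<Longrightarrow> x \<in> carrier A \<Longrightarrow> y \<in> carrier A \<Longrightarrow> x \<otimes> inv y \<in> \<Delta> I \<Longrightarrow> y \<otimes> inv x \<in> \<Delta> I"
  using gen_inv[of I "x \<otimes> inv y"] by (simp add: inv_mult_group)

lemma coset_trans:
  assumes "I \<subseteq> N" "x \<in> carrier A" "y \<in> carrier A" "z \<in> carrier A" "x \<otimes> inv y \<in> \<Delta> I" "y \<otimes> inv z \<in> \<Delta> I"
  shows "x \<otimes> inv z \<in> \<Delta> I"
proof -
  have "x \<otimes> inv z = (x \<otimes> inv y) \<otimes> (y \<otimes> inv z)"
    using assms(2-4) by (metis inv_closed inv_solve_left m_assoc m_closed)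
  then show ?thesis using gen_mult[OF assms(1,5,6)] by simp
qed

text \<open>
  The subgroup for a nonempty \<open>I\<close> has elements of both parities, so passing to even parts of cosets
  loses nothing.
\<close>

lemma even_representative:
  assumes I: "I \<subseteq> N" "I \<noteq> {}" and x: "x \<in> \<Delta> N"
  obtains z where "z \<in> E" "z \<otimes> inv x \<in> \<Delta> I"
proof -
  obtain i where i: "i \<in> I" using I by blast
  then have iN: "i \<in> N" using I by blast
  have c: "x \<in> carrier A" "r i \<in> carrier A" using chamber_carrier[OF x] r_closed[OF iN] by auto
  have "x \<otimes> inv x \<in> \<Delta> I" "(r i \<otimes> x) \<otimes> inv x \<in> \<Delta> I"
    using c gen_one r_in_gen[OF i] by (simp_all add: m_assoc)
  then show ?thesis using gen_even_cases[OF order_refl iN x] that by blast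
qed

text \<open>
  Chambers are all elements of \<open>\<Delta> N\<close>, including the odd ones; only the even part of a coset is a face
  of the poset. For \<open>i = -1\<close> and \<open>i = n\<close> one has \<open>N - {i} = N\<close>, which fits the fact that all chambers
  share these faces.
\<close>

definition fc :: "int \<Rightarrow> 'g \<Rightarrow> 'g mix_face" where
  "fc i x = (if i = -1 then MinFace else if i = n then MaxFace
    else CosetFace i ((\<Delta> (N - {i}) #> x) \<inter> E))"

lemma two_in_N: "N - {i, j} \<noteq> {}"
proof -
  have "0 \<in> N" "1 \<in> N" "2 \<in> N" using rank by auto
  moreover have "0 \<notin> {i, j} \<or> 1 \<notin> {i, j} \<or> 2 \<notin> {i, j}" by auto
  ultimately show ?thesis by blast
qed

lemma fc_eq_iff:
  assumes x: "x \<in> \<Delta> N" and y: "y \<in> \<Delta> N"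
  shows "fc i x = fc i y \<longleftrightarrow> i = -1 \<or> i = n \<or> x \<otimes> inv y \<in> \<Delta> (N - {i})"
proof (cases "i = -1 \<or> i = n")
  case True
  then show ?thesis by (auto simp: fc_def)
next
  case False
  let ?I = "N - {i}"
  note xc = chamber_carrier[OF x] and yc = chamber_carrier[OF y]
  have I: "?I \<subseteq> N" "?I \<noteq> {}" using two_in_N[of i i] by auto
  have "(\<Delta> ?I #> x) \<inter> E = (\<Delta> ?I #> y) \<inter> E \<longleftrightarrow> x \<otimes> inv y \<in> \<Delta> ?I"
  proof
    assume eq: "(\<Delta> ?I #> x) \<inter> E = (\<Delta> ?I #> y) \<inter> E"
    obtain z where z: "z \<in> E" "z \<otimes> inv x \<in> \<Delta> ?I" using even_representative[OF I x] .
    have zc: "z \<in> carrier A" using chamber_carrier E_chamber z by blast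
    then have "z \<in> (\<Delta> ?I #> y)" using eq z in_coset_iff[OF I(1) xc] by blast
    then show "x \<otimes> inv y \<in> \<Delta> ?I"
      using in_coset_iff[OF I(1) yc] coset_trans[OF I(1) xc zc yc] coset_sym[OF I(1) zc xc z(2)] by blast
  next
    assume r: "x \<otimes> inv y \<in> \<Delta> ?I"
    have "z \<in> \<Delta> ?I #> x \<longleftrightarrow> z \<in> \<Delta> ?I #> y" for z
      using in_coset_iff[OF I(1)] xc yc coset_trans[OF I(1) _ xc yc _ r]
        coset_trans[OF I(1) _ yc xc _ coset_sym[OF I(1) xc yc r]] by blast
    then show "(\<Delta> ?I #> x) \<inter> E = (\<Delta> ?I #> y) \<inter> E" by blast
  qed
  then show ?thesis using False by (simp add: fc_def)
qed

lemma fc_eqI: "x \<in> \<Delta> N \<Longrightarrow> y \<in> \<Delta> N \<Longrightarrow> x \<otimes> inv y \<in> \<Delta> I \<Longrightarrow> I \<subseteq> N \<Longrightarrow> i \<notin> I \<Longrightarrow> fc i x = fc i y"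
  using fc_eq_iff gen_mono[of I "N - {i}"] by blast

text \<open>
  It is here that the rank is at least 3: an index different from \<open>i\<close> and \<open>j\<close> is needed to find an
  even element among the chambers with two prescribed faces.
\<close>

lemma fc_even_meet:
  assumes x: "x \<in> \<Delta> N" and y: "y \<in> \<Delta> N" and ij: "i \<in> N" "j \<in> N"
  shows "((\<Delta> (N - {i}) #> x) \<inter> E) \<inter> ((\<Delta> (N - {j}) #> y) \<inter> E) \<noteq> {} \<longleftrightarrow>
    (\<exists>z \<in> \<Delta> N. fc i z = fc i x \<and> fc j z = fc j y)"
proof
  note xc = chamber_carrier[OF x] and yc = chamber_carrier[OF y]
  assume "((\<Delta> (N - {i}) #> x) \<inter> E) \<inter> ((\<Delta> (N - {j}) #> y) \<inter> E) \<noteq> {}"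
  then obtain z where z: "z \<in> E" "z \<in> \<Delta> (N - {i}) #> x" "z \<in> \<Delta> (N - {j}) #> y" by blast
  have zN: "z \<in> \<Delta> N" using E_chamber z(1) .
  have "fc i z = fc i x"
    using z(2) in_coset_iff[OF _ xc] fc_eq_iff[OF zN x] by auto
  moreover have "fc j z = fc j y"
    using z(3) in_coset_iff[OF _ yc] fc_eq_iff[OF zN y] by auto
  ultimately show "\<exists>z \<in> \<Delta> N. fc i z = fc i x \<and> fc j z = fc j y" using zN by blast
next
  note xc = chamber_carrier[OF x] and yc = chamber_carrier[OF y]
  assume "\<exists>z \<in> \<Delta> N. fc i z = fc i x \<and> fc j z = fc j y"
  then obtain u where u: "u \<in> \<Delta> N" "fc i u = fc i x" "fc j u = fc j y" by blast
  obtain z where z: "z \<in> E" "z \<otimes> inv u \<in> \<Delta> (N - {i, j})"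
    using even_representative[OF _ two_in_N u(1)] by blast
  have zN: "z \<in> \<Delta> N" using E_chamber z(1) .
  have "fc i z = fc i u" "fc j z = fc j u" using fc_eqI[OF zN u(1) z(2)] by auto
  then have "fc i z = fc i x" "fc j z = fc j y" using u by auto
  then have "z \<otimes> inv x \<in> \<Delta> (N - {i})" "z \<otimes> inv y \<in> \<Delta> (N - {j})"
    using fc_eq_iff[OF zN x, of i] fc_eq_iff[OF zN y, of j] ij by auto
  then have "z \<in> \<Delta> (N - {i}) #> x" "z \<in> \<Delta> (N - {j}) #> y"
    using in_coset_iff[OF _ xc] in_coset_iff[OF _ yc] chamber_carrier[OF zN] by auto
  then show "((\<Delta> (N - {i}) #> x) \<inter> E) \<inter> ((\<Delta> (N - {j}) #> y) \<inter> E) \<noteq> {}" using z(1) by blast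
qed

lemma proper_faces:
  "{CosetFace j C | j C. 0 \<le> j \<and> j \<le> n - 1 \<and> C \<in> rcosets\<^bsub>G\<^esub> (gen_subgroup n G \<beta> (N - {j}))} =
    {fc i z | i z. i \<in> N \<and> z \<in> \<Delta> N}"
proof -
  have coset: "gen_subgroup n G \<beta> (N - {j}) #>\<^bsub>G\<^esub> a = (\<Delta> (N - {j}) #> a) \<inter> E" if a: "a \<in> E" for a j
  proof -
    have ac: "a \<in> carrier A" using chamber_carrier E_chamber a by blast
    have I: "N - {j} \<subseteq> N" by blast
    have "gen_subgroup n G \<beta> (N - {j}) = \<Delta> (N - {j}) \<inter> E"
      using gen_subgroup_eq[OF I] even_part[OF I] by simp
    moreover have "(\<Delta> (N - {j}) \<inter> E) #>\<^bsub>G\<^esub> a = (\<Delta> (N - {j}) #> a) \<inter> E"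
    proof (intro equalityI subsetI)
      fix z assume "z \<in> (\<Delta> (N - {j}) \<inter> E) #>\<^bsub>G\<^esub> a"
      then obtain h where "h \<in> \<Delta> (N - {j})" "h \<in> E" "z = h \<otimes> a" by (auto simp: r_coset_def)
      then show "z \<in> (\<Delta> (N - {j}) #> a) \<inter> E"
        using even_mult[OF order_refl _ a] by (auto simp: r_coset_def)
    next
      fix z assume "z \<in> (\<Delta> (N - {j}) #> a) \<inter> E"
      then obtain h where h: "h \<in> \<Delta> (N - {j})" "z \<in> E" "z = h \<otimes> a" by (auto simp: r_coset_def)
      then have "h = z \<otimes> inv a" using gen_carrier[OF I] ac by (simp add: m_assoc)
      then have "h \<in> E" using even_mult[OF order_refl h(2) even_inv[OF order_refl a]] by simp
      then show "z \<in> (\<Delta> (N - {j}) \<inter> E) #>\<^bsub>G\<^esub> a" using h by (auto simp: r_coset_def)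
    qed
    ultimately show ?thesis by simp
  qed
  show ?thesis
  proof (intro equalityI subsetI)
    fix F assume "F \<in> {CosetFace j C | j C. 0 \<le> j \<and> j \<le> n - 1 \<and> C \<in> rcosets\<^bsub>G\<^esub> (gen_subgroup n G \<beta> (N - {j}))}"
    then obtain j C where F: "F = CosetFace j C" "j \<in> N" "C \<in> rcosets\<^bsub>G\<^esub> (gen_subgroup n G \<beta> (N - {j}))" by auto
    then obtain a where a: "a \<in> E" "C = gen_subgroup n G \<beta> (N - {j}) #>\<^bsub>G\<^esub> a" by (auto simp: RCOSETS_def)
    then have "F = fc j a" using coset[OF a(1)] F by (simp add: fc_def)
    then show "F \<in> {fc i z | i z. i \<in> N \<and> z \<in> \<Delta> N}" using F E_chamber[OF a(1)] by blast
  next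
    fix F assume "F \<in> {fc i z | i z. i \<in> N \<and> z \<in> \<Delta> N}"
    then obtain j z where z: "F = fc j z" "j \<in> N" "z \<in> \<Delta> N" by blast
    obtain a where a: "a \<in> E" "a \<otimes> inv z \<in> \<Delta> (N - {j})"
      using even_representative[of "N - {j}" z] two_in_N[of j j] z(3) by auto
    have "F = fc j a" using fc_eqI[OF E_chamber[OF a(1)] z(3) a(2)] z(1) by simp
    then have "F = CosetFace j (gen_subgroup n G \<beta> (N - {j}) #>\<^bsub>G\<^esub> a)"
      using coset[OF a(1)] z(2) by (simp add: fc_def)
    moreover have "gen_subgroup n G \<beta> (N - {j}) #>\<^bsub>G\<^esub> a \<in> rcosets\<^bsub>G\<^esub> (gen_subgroup n G \<beta> (N - {j}))"
      using a(1) by (auto simp: RCOSETS_def)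
    ultimately show "F \<in> {CosetFace j C | j C. 0 \<le> j \<and> j \<le> n - 1 \<and> C \<in> rcosets\<^bsub>G\<^esub> (gen_subgroup n G \<beta> (N - {j}))}"
      using z(2) by auto
  qed
qed

lemma coset_poset_ord:
  "face_ord (coset_poset n G \<beta>) = {(fc i z, fc j z) | i j z. -1 \<le> i \<and> i \<le> j \<and> j \<le> n \<and> z \<in> \<Delta> N}"
  unfolding coset_poset_def proper_faces
proof (rule bounded_poset_chambers)
  show "0 \<le> n" using rank by simp
  show "\<Delta> N \<noteq> {}" using gen_one by blast
  show "fc (-1) z = MinFace" "fc n z = MaxFace" for z using rank by (simp_all add: fc_def)
  show "fc i z \<noteq> MinFace \<and> fc i z \<noteq> MaxFace" if "i \<in> N" for i z using that by (simp add: fc_def)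
  fix i j x y assume ij: "i \<in> N" "j \<in> N" and xy: "x \<in> \<Delta> N" "y \<in> \<Delta> N"
  then show "(\<exists>j' C k D. fc i x = CosetFace j' C \<and> fc j y = CosetFace k D \<and> j' < k \<and> C \<inter> D \<noteq> {}) \<longleftrightarrow>
      i < j \<and> (\<exists>z \<in> \<Delta> N. fc i z = fc i x \<and> fc j z = fc j y)"
    unfolding fc_even_meet[OF xy ij, symmetric] by (simp add: fc_def)
qed simp

text \<open>
  Gluing: if \<open>x = v u y\<close> where \<open>v\<close> only involves indices above \<open>j\<close> and \<open>u\<close> only those below, then
  \<open>u y\<close> has the lower faces of \<open>x\<close> and the upper faces of \<open>y\<close>.
\<close>

lemma chambers: "chamber_poset n (coset_poset n G \<beta>) (\<Delta> N) fc"
proof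
  show "0 \<le> n" using rank by simp
  show "\<Delta> N \<noteq> {}" using gen_one by blast
  show "face_ord (coset_poset n G \<beta>) = {(fc i z, fc j z) | i j z. -1 \<le> i \<and> i \<le> j \<and> j \<le> n \<and> z \<in> \<Delta> N}"
    by (rule coset_poset_ord)
  show "face_rank (coset_poset n G \<beta>) (fc i z) = i" for i z
    by (simp add: coset_poset_def bounded_poset_def fc_def)
  show "fc (-1) z = fc (-1) w" "fc n z = fc n w" for z w using rank by (simp_all add: fc_def)
  fix x y j assume x: "x \<in> \<Delta> N" and y: "y \<in> \<Delta> N" and j: "-1 \<le> j" "j \<le> n" and eq: "fc j x = fc j y"
  note xc = chamber_carrier[OF x] and yc = chamber_carrier[OF y]
  have I: "N - {j} \<subseteq> N" by blast
  have "x \<otimes> inv y \<in> \<Delta> N" using gen_mult[OF order_refl x gen_inv[OF order_refl y]] .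
  moreover have "N - {j} = N" if "j = -1 \<or> j = n" using that by auto
  ultimately have "x \<otimes> inv y \<in> \<Delta> (N - {j})" using eq fc_eq_iff[OF x y, of j] by metis
  then obtain u v where uv: "u \<in> \<Delta> ((N - {j}) \<inter> {..<j})" "v \<in> \<Delta> ((N - {j}) \<inter> {j<..})" "x \<otimes> inv y = u \<otimes> v"
    using gen_split[OF I, of j] by blast
  have sub: "(N - {j}) \<inter> {..<j} \<subseteq> N" "(N - {j}) \<inter> {j<..} \<subseteq> N" by auto
  have c: "u \<in> carrier A" "v \<in> carrier A" using gen_carrier sub uv by blast+
  have comm: "u \<otimes> v = v \<otimes> u"
    by (rule gen_commute[OF sub _ uv(1,2)]) auto
  define z where "z = u \<otimes> y"
  have uN: "u \<in> \<Delta> N" using uv(1) gen_mono[OF sub(1)] by blast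
  have zN: "z \<in> \<Delta> N" unfolding z_def by (rule gen_mult[OF order_refl uN y])
  have zy: "z \<otimes> inv y = u" unfolding z_def using c yc by (simp add: m_assoc)
  have "x = (x \<otimes> inv y) \<otimes> y" using xc yc by (simp add: m_assoc)
  then have xz: "x = v \<otimes> z" unfolding z_def uv(3) comm using c yc by (simp add: m_assoc)
  have "x \<otimes> inv z = v" unfolding xz using c chamber_carrier[OF zN] by (simp add: m_assoc)
  then have "fc i x = fc i z" if "i \<in> {-1..j}" for i
    using fc_eqI[OF x zN _ sub(2), of i] uv(2) that by auto
  moreover have "fc k z = fc k y" if "k \<in> {j..n}" for k
    using fc_eqI[OF zN y _ sub(1), of k] uv(1) zy that by auto
  ultimately show "\<exists>z \<in> \<Delta> N. (\<forall>i \<in> {-1..j}. fc i z = fc i x) \<and> (\<forall>k \<in> {j..n}. fc k z = fc k y)"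
    using zN by metis
qed

text \<open>
  Left multiplication with \<open>r i\<close> is passage to the chamber adjacent in rank \<open>i\<close>.
\<close>

lemma fc_reflect:
  assumes w: "w \<in> \<Delta> N" and i: "i \<in> N"
  shows "fc i (r i \<otimes> w) \<noteq> fc i w" "k \<noteq> i \<Longrightarrow> fc k (r i \<otimes> w) = fc k w" "r i \<otimes> w \<in> \<Delta> N"
proof -
  show rN: "r i \<otimes> w \<in> \<Delta> N" by (rule gen_mult[OF order_refl r_in_gen[OF i] w])
  have q: "(r i \<otimes> w) \<otimes> inv w = r i" using r_closed[OF i] chamber_carrier[OF w] by (simp add: m_assoc)
  show "fc i (r i \<otimes> w) \<noteq> fc i w"
    using fc_eq_iff[OF rN w, of i] q r_notin_complement[OF i] i by auto
  show "fc k (r i \<otimes> w) = fc k w" if "k \<noteq> i"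
    by (rule fc_eqI[OF rN w, of "{i}"]) (use q r_in_gen[of i "{i}"] i that in auto)
qed

text \<open>
  If \<open>x\<close> and \<open>y\<close> share the faces with ranks in \<open>J\<close>, then \<open>y x\<^sup>-\<^sup>1\<close> is a word in the other generators,
  and its letters describe a path. For the diamond condition, faces between those of ranks \<open>i - 1\<close>
  and \<open>i + 1\<close> come from words without these two indices; there \<open>r i\<close> commutes with all other
  letters and may be collected into a single factor.
\<close>

lemma polytope_if_intersection_property:
  assumes ip: "intersection_property A r N"
  shows "abstract_polytope n (coset_poset n G \<beta>)"
proof -
  interpret chamber_poset n "coset_poset n G \<beta>" "\<Delta> N" fc by (rule chambers)
  have "polytopal_chamber_poset n (coset_poset n G \<beta>) (\<Delta> N) fc"
  proof
    fix x y assume x: "x \<in> \<Delta> N" and y: "y \<in> \<Delta> N"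
    note xc = chamber_carrier[OF x] and yc = chamber_carrier[OF y]
    let ?R = "{(z, w). z \<in> \<Delta> N \<and> w \<in> \<Delta> N \<and>
      (\<exists>i \<in> {-1..n}. fc i z \<noteq> fc i w \<and> (\<forall>k \<in> {-1..n}. k \<noteq> i \<longrightarrow> fc k z = fc k w)) \<and>
      (\<forall>k \<in> {-1..n}. fc k x = fc k y \<longrightarrow> fc k z = fc k x \<and> fc k w = fc k x)}"
    define J where "J = {j \<in> N. fc j x = fc j y}"
    let ?I = "N - J"
    have I: "?I \<subseteq> N" by blast
    have "y \<otimes> inv x \<in> \<Delta> ?I"
    proof (rule intersection_propertyD[OF ip])
      show "J \<subseteq> N" by (auto simp: J_def)
      show "y \<otimes> inv x \<in> \<Delta> N" by (rule gen_mult[OF order_refl y gen_inv[OF order_refl x]])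
      fix j assume "j \<in> J"
      then have "j \<in> N" "fc j y = fc j x" by (auto simp: J_def)
      then show "y \<otimes> inv x \<in> \<Delta> (N - {j})" using fc_eq_iff[OF y x, of j] by auto
    qed
    have near: "fc k (w \<otimes> x) = fc k x" if w: "w \<in> \<Delta> ?I" and k: "k \<in> {-1..n}" "fc k x = fc k y" for w k
    proof -
      have "w \<in> \<Delta> N" using w gen_mono[OF I] by blast
      then have "w \<otimes> x \<in> \<Delta> N" using gen_mult[OF order_refl _ x] by blast
      moreover have "(w \<otimes> x) \<otimes> inv x = w" using gen_carrier[OF I w] xc by (simp add: m_assoc)
      moreover have "k \<notin> ?I" using k by (auto simp: J_def)
      ultimately show ?thesis using fc_eqI[OF _ x _ I] w by simp
    qed
    have path: "(x, w \<otimes> x) \<in> ?R\<^sup>*" if "w \<in> \<Delta> ?I" for w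
      using that I
    proof (induction rule: gen_induct)
      case one
      then show ?case using xc by simp
    next
      case (step i w)
      have iN: "i \<in> N" using step by blast
      have wN: "w \<otimes> x \<in> \<Delta> N"
        using gen_mult[OF order_refl _ x] step(2) gen_mono[OF I] by blast
      have eq: "(r i \<otimes> w) \<otimes> x = r i \<otimes> (w \<otimes> x)"
        using r_closed[OF iN] gen_carrier[OF I step(2)] xc by (simp add: m_assoc)
      have rw: "r i \<otimes> w \<in> \<Delta> ?I" by (rule gen_mult[OF I r_in_gen[OF step(1)] step(2)])
      note fr = fc_reflect[OF wN iN]
      have ir: "i \<in> {-1..n}" using iN by auto
      have ex: "\<exists>l \<in> {-1..n}. fc l (w \<otimes> x) \<noteq> fc l (r i \<otimes> (w \<otimes> x)) \<and>
          (\<forall>k \<in> {-1..n}. k \<noteq> l \<longrightarrow> fc k (w \<otimes> x) = fc k (r i \<otimes> (w \<otimes> x)))"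
        using fr(1,2) ir by metis
      have al: "\<forall>k \<in> {-1..n}. fc k x = fc k y \<longrightarrow>
          fc k (w \<otimes> x) = fc k x \<and> fc k (r i \<otimes> (w \<otimes> x)) = fc k x"
        using near[OF step(2)] near[OF rw] unfolding eq by blast
      have "(w \<otimes> x, r i \<otimes> (w \<otimes> x)) \<in> ?R"
        unfolding mem_Collect_eq case_prod_conv
        by (rule conjI[OF wN conjI[OF fr(3) conjI[OF ex al]]])
      then show ?case unfolding eq using step(3) by (rule rtrancl_into_rtrancl[rotated])
    qed
    have "(y \<otimes> inv x) \<otimes> x = y" using xc yc by (simp add: m_assoc)
    then have "(x, y) \<in> ?R\<^sup>*" using path[OF \<open>y \<otimes> inv x \<in> \<Delta> ?I\<close>] by simp
    then show "\<exists>u \<in> \<Delta> N. (\<forall>k \<in> {-1..n}. fc k u = fc k y) \<and> (x, u) \<in> ?R\<^sup>*" using y by blast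
  next
    fix z i assume z: "z \<in> \<Delta> N" and i: "0 \<le> i" "i \<le> n - 1"
    note zc = chamber_carrier[OF z]
    have iN: "i \<in> N" using i by simp
    note fr = fc_reflect[OF z iN]
    have split: "v \<in> \<Delta> (N - {i}) \<or> r i \<otimes> v \<in> \<Delta> (N - {i})" if "v \<in> \<Delta> (N - {i - 1, i + 1})" for v
    proof -
      have I: "N - {i - 1, i + 1} \<subseteq> N" "N - {i} \<subseteq> N" by blast+
      from that I(1) show ?thesis
      proof (induction rule: gen_induct)
        case one
        then show ?case using gen_one by blast
      next
        case (step k v)
        have kN: "k \<in> N" using step by blast
        have c: "r k \<in> carrier A" "r i \<in> carrier A" "v \<in> carrier A"
          using r_closed[OF kN] r_closed[OF iN] gen_carrier[OF I(1) step(2)] by auto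
        show ?case
        proof (cases "k = i")
          case True
          then show ?thesis using step(3) r_cancel[OF iN c(3)] by auto
        next
          case False
          then have far: "k + 1 < i \<or> i + 1 < k" using step(1) by auto
          then have comm: "r i \<otimes> r k = r k \<otimes> r i" using r_comm[OF kN iN] r_comm[OF iN kN] by auto
          have "r i \<otimes> (r k \<otimes> v) = (r i \<otimes> r k) \<otimes> v" using c by (simp add: m_assoc)
          also have "\<dots> = r k \<otimes> (r i \<otimes> v)" using c comm by (simp add: m_assoc)
          finally have "r i \<otimes> (r k \<otimes> v) = r k \<otimes> (r i \<otimes> v)" .
          moreover have "r k \<in> \<Delta> (N - {i})" using r_in_gen[of k "N - {i}"] kN False by blast
          ultimately show ?thesis using step(3) gen_mult[OF I(2)] by metis
        qed
      qed
    qed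
    have "fc i u = fc i z \<or> fc i u = fc i (r i \<otimes> z)"
      if u: "u \<in> \<Delta> N" and eq: "fc (i - 1) u = fc (i - 1) z" "fc (i + 1) u = fc (i + 1) z" for u
    proof -
      note uc = chamber_carrier[OF u]
      \<comment> \<open>Not \<open>u z\<^sup>-\<^sup>1\<close>: with this choice the factor \<open>r i\<close> of \<open>split\<close> ends up next to \<open>z\<close>.\<close>
      let ?v = "z \<otimes> inv u"
      have vN: "?v \<in> \<Delta> N" using gen_mult[OF order_refl z gen_inv[OF order_refl u]] .
      have "?v \<in> \<Delta> (N - ({i - 1, i + 1} \<inter> N))"
      proof (rule intersection_propertyD[OF ip _ vN])
        fix j assume j: "j \<in> {i - 1, i + 1} \<inter> N"
        then have "fc j z = fc j u" using eq by auto
        then show "?v \<in> \<Delta> (N - {j})" using fc_eq_iff[OF z u, of j] j by auto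
      qed blast
      moreover have "N - ({i - 1, i + 1} \<inter> N) = N - {i - 1, i + 1}" by blast
      ultimately have "?v \<in> \<Delta> (N - {i}) \<or> r i \<otimes> ?v \<in> \<Delta> (N - {i})" using split by simp
      moreover have "r i \<otimes> ?v = (r i \<otimes> z) \<otimes> inv u" using r_closed[OF iN] zc uc by (simp add: m_assoc)
      ultimately show ?thesis using fc_eq_iff[OF z u, of i] fc_eq_iff[OF fr(3) u, of i] by metis
    qed
    then show "\<exists>w \<in> \<Delta> N. fc i w \<noteq> fc i z \<and> fc (i - 1) w = fc (i - 1) z \<and> fc (i + 1) w = fc (i + 1) z \<and>
      (\<forall>u \<in> \<Delta> N. fc (i - 1) u = fc (i - 1) z \<and> fc (i + 1) u = fc (i + 1) z \<longrightarrow>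
        fc i u = fc i z \<or> fc i u = fc i w)"
      using fr by (intro bexI[of _ "r i \<otimes> z"]) auto
  qed
  then show ?thesis by (rule polytopal_chamber_poset.abstract_polytope)
qed

text \<open>
  A flag path from the chamber \<open>1\<close> to \<open>x\<close> that keeps the faces with ranks in \<open>J\<close> only visits chambers
  of words in the other generators, because adjacent flags are unique. The last of these chambers
  has the same faces as \<open>x\<close>, and equals \<open>x\<close> since only the identity stabilizes all faces.
\<close>

lemma intersection_property_if_polytope:
  assumes "abstract_polytope n (coset_poset n G \<beta>)"
  shows "intersection_property A r N"
  unfolding intersection_property_def
proof (intro allI impI ballI)
  interpret X: abstract_polytope n "coset_poset n G \<beta>" by (rule assms)
  interpret C: chamber_poset n "coset_poset n G \<beta>" "\<Delta> N" fc by (rule chambers)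
  fix J x assume J: "J \<subseteq> N" and x: "x \<in> \<Delta> N" and all: "\<forall>j \<in> J. x \<in> \<Delta> (N - {j})"
  note xc = chamber_carrier[OF x]
  let ?I = "N - J"
  have I: "?I \<subseteq> N" by blast
  have one: "\<one> \<in> \<Delta> N" by (rule gen_one)
  have flag: "C.chamber_flag z \<in> flags (coset_poset n G \<beta>)" if "z \<in> \<Delta> N" for z
    using that C.flags_eq by blast
  have at: "X.face_at (C.chamber_flag z) i = fc i z" if "z \<in> \<Delta> N" "i \<in> {-1..n}" for z i
    using that X.face_at_eq[OF flag[OF that(1)]] C.rank C.chamber_flagI by auto
  let ?S = "{C.chamber_flag w | w. w \<in> \<Delta> ?I}"
  have "C.chamber_flag x \<in> ?S"
  proof (rule X.flags_reachable[OF flag[OF one] flag[OF x]])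
    show "C.chamber_flag \<one> \<in> ?S" using gen_one by blast
    fix \<Phi> \<Psi> i assume \<Phi>: "\<Phi> \<in> ?S"
      and ne: "X.face_at (C.chamber_flag \<one>) i \<noteq> X.face_at (C.chamber_flag x) i"
      and adj: "X.adjacent_at i \<Phi> \<Psi>"
    obtain w where w: "\<Phi> = C.chamber_flag w" "w \<in> \<Delta> ?I" using \<Phi> by blast
    have wN: "w \<in> \<Delta> N" using w(2) gen_mono[OF I] by blast
    have i: "i \<in> N" using adj by (simp add: X.adjacent_at_def)
    then have ir: "i \<in> {-1..n}" by auto
    have "i \<notin> J"
    proof
      assume "i \<in> J"
      then have "fc i x = fc i \<one>" using all fc_eq_iff[OF x one, of i] xc by auto
      then show False using ne at[OF one ir] at[OF x ir] by simp
    qed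
    note fr = fc_reflect[OF wN i]
    have "X.adjacent_at i \<Phi> (C.chamber_flag (r i \<otimes> w))"
      unfolding X.adjacent_at_def w(1)
      using flag[OF wN] flag[OF fr(3)] i at[OF wN] at[OF fr(3)] fr(1)[symmetric] fr(2) by auto
    then have "\<Psi> = C.chamber_flag (r i \<otimes> w)" using X.adjacent_at_unique adj by blast
    moreover have "r i \<otimes> w \<in> \<Delta> ?I"
      using gen_mult[OF I r_in_gen w(2), of i] i \<open>i \<notin> J\<close> by blast
    ultimately show "\<Psi> \<in> ?S" by blast
  qed
  then obtain w where w: "C.chamber_flag x = C.chamber_flag w" "w \<in> \<Delta> ?I" by blast
  have wN: "w \<in> \<Delta> N" using w(2) gen_mono[OF I] by blast
  have "x \<otimes> inv w = \<one>"
  proof (rule faithful)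
    show "x \<otimes> inv w \<in> \<Delta> N" by (rule gen_mult[OF order_refl x gen_inv[OF order_refl wN]])
    fix j assume j: "j \<in> N"
    then have "fc j x = fc j w" using C.chamber_flag_eq_iff[OF x wN] w(1) by auto
    then show "x \<otimes> inv w \<in> \<Delta> (N - {j})" using fc_eq_iff[OF x wN, of j] j by auto
  qed
  then have "x = w" using xc chamber_carrier[OF wN] by (metis inv_closed inv_equality inv_inv)
  then show "x \<in> \<Delta> ?I" using w(2) by simp
qed

theorem polytope_iff_intersection_property:
  "abstract_polytope n (coset_poset n G \<beta>) \<longleftrightarrow> intersection_property A r N"
  using polytope_if_intersection_property intersection_property_if_polytope by blast

end

section \<open>Reduction of the intersection property to its extreme instance\<close>

context string_system
begin

text \<open>
  The argument is by peeling off factors. An element \<open>x\<close> of the subgroup for \<open>N - {j}\<close> splits as \<open>u v\<close>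
  into its parts below and above \<open>j\<close>. If \<open>x\<close> also avoids the index 0, then so does \<open>u\<close>: both \<open>v\<close> and
  \<open>x\<close> do, and so \<open>u\<close> lies in the meet of the two end subgroups. This settles elements without the
  index 0 by the property of the upper end. In general, with \<open>j\<close> the least element of \<open>J\<close>, the
  factor \<open>u\<close> avoids \<open>J\<close> and \<open>v\<close> avoids the index 0.
\<close>

lemma intersection_property_from_ends:
  assumes N: "N = {0..n-1}"
    and low: "intersection_property A r {0..n-2}" and high: "intersection_property A r {1..n-1}"
    and meet: "gen A r {0..n-2} \<inter> gen A r {1..n-1} \<subseteq> gen A r {1..n-2}"
  shows "intersection_property A r N"
  unfolding intersection_property_def
proof (intro allI impI ballI)
  let ?F = "{0..n-2}" and ?L = "{1..n-1}"
  have FL: "?F \<subseteq> N" "?L \<subseteq> N" using N by auto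
  \<comment> \<open>The case of an element without the index 0 and a single \<open>j\<close>.\<close>
  have one: "x \<in> gen A r (?L - {j})"
    if x: "x \<in> gen A r ?L" "x \<in> gen A r (N - {j})" and j: "j \<in> N" for x j
  proof -
    have I: "N - {j} \<subseteq> N" by blast
    obtain u v where uv: "u \<in> gen A r ((N - {j}) \<inter> {..<j})" "v \<in> gen A r ((N - {j}) \<inter> {j<..})" "x = u \<otimes> v"
      using gen_split[OF I _ x(2), of j] by blast
    have "(N - {j}) \<inter> {j<..} \<subseteq> ?L - {j}" using j N by auto
    then have vL: "v \<in> gen A r (?L - {j})" using uv(2) gen_mono by blast
    then have vL': "v \<in> gen A r ?L" using gen_mono[of "?L - {j}" ?L] by blast
    have "(N - {j}) \<inter> {..<j} \<subseteq> {0..j-1}" using N by auto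
    then have uF: "u \<in> gen A r {0..j-1}" using uv(1) gen_mono by blast
    have sF: "{0..j-1} \<subseteq> ?F" using j N by auto
    have c: "u \<in> carrier A" "v \<in> carrier A"
      using gen_carrier[OF order_trans[OF sF FL(1)] uF] gen_carrier[OF FL(2) vL'] by auto
    have "u = x \<otimes> inv v" using uv(3) c by (simp add: m_assoc)
    then have "u \<in> gen A r ?L" using gen_mult[OF FL(2) x(1) gen_inv[OF FL(2) vL']] by simp
    then have "u \<in> gen A r {1..n-2}" using meet uF gen_mono[OF sF] by blast
    then have "u \<in> gen A r ({0..j-1} \<inter> {1..n-2})"
      by (intro intersection_property_pairwise[OF low FL(1) sF _ uF]) auto
    moreover have "{0..j-1} \<inter> {1..n-2} \<subseteq> ?L - {j}" by auto
    ultimately have "u \<in> gen A r (?L - {j})" using gen_mono by blast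
    then show ?thesis unfolding uv(3) using vL FL by (auto intro!: gen_mult)
  qed
  have two: "x \<in> gen A r (N - J)"
    if x: "x \<in> gen A r ?L" "\<And>j. j \<in> J \<Longrightarrow> x \<in> gen A r (N - {j})" and J: "J \<subseteq> N" for x J
  proof -
    have "x \<in> gen A r (?L - (J \<inter> ?L))"
    proof (rule intersection_propertyD[OF high _ x(1)])
      fix j assume "j \<in> J \<inter> ?L"
      then show "x \<in> gen A r (?L - {j})" using one[OF x(1) x(2)] J by blast
    qed blast
    then show ?thesis using gen_mono[of "?L - (J \<inter> ?L)" "N - J"] FL by blast
  qed
  fix J x assume J: "J \<subseteq> N" and x: "x \<in> gen A r N" and all: "\<forall>j \<in> J. x \<in> gen A r (N - {j})"
  show "x \<in> gen A r (N - J)"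
  proof (cases "J = {}")
    case True
    then show ?thesis using x by simp
  next
    case False
    have "finite J" using J N finite_subset by auto
    define m where "m = Min J"
    have m: "m \<in> J" "\<And>j. j \<in> J \<Longrightarrow> m \<le> j" using False \<open>finite J\<close> by (auto simp: m_def)
    have I: "N - {m} \<subseteq> N" by blast
    obtain u v where uv: "u \<in> gen A r ((N - {m}) \<inter> {..<m})" "v \<in> gen A r ((N - {m}) \<inter> {m<..})" "x = u \<otimes> v"
      using gen_split[OF I, of m x] all m(1) by blast
    have "(N - {m}) \<inter> {..<m} \<subseteq> N - J" using m(2) by force
    then have u: "u \<in> gen A r (N - J)" using uv(1) gen_mono by blast
    have uN: "u \<in> gen A r (N - {j})" if "j \<in> J" for j
      using u gen_mono[of "N - J" "N - {j}"] that by blast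
    have "m \<in> N" using m(1) J by blast
    then have "(N - {m}) \<inter> {m<..} \<subseteq> ?L" using N by auto
    then have v: "v \<in> gen A r ?L" using uv(2) gen_mono by blast
    have c: "u \<in> carrier A" "v \<in> carrier A"
      using gen_carrier[OF _ u] gen_carrier[OF FL(2) v] by auto
    have "v = inv u \<otimes> x" using uv(3) c by (simp flip: m_assoc)
    then have "v \<in> gen A r (N - {j})" if "j \<in> J" for j
      using gen_mult[of "N - {j}", OF _ gen_inv[OF _ uN[OF that]]] all that by auto
    then have "v \<in> gen A r (N - J)" using two[OF v _ J] by blast
    then show ?thesis unfolding uv(3) using u by (auto intro!: gen_mult)
  qed
qed

text \<open>
  An odd element of the meet becomes even after multiplication with a generator that both
  subgroups contain.
\<close>

lemma gen_meet_from_even_meet: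
  assumes FL: "F \<subseteq> N" "L \<subseteq> N" and i: "i \<in> F" "i \<in> L"
    and meet: "even_gen A r F \<inter> even_gen A r L \<subseteq> even_gen A r (F \<inter> L)"
  shows "gen A r F \<inter> gen A r L \<subseteq> gen A r (F \<inter> L)"
proof
  have sub: "F \<inter> L \<subseteq> N" using FL by blast
  have iN: "i \<in> N" using FL i by blast
  have even_case: "y \<in> gen A r (F \<inter> L)" if y: "y \<in> even_gen A r F" "y \<in> gen A r L" for y
  proof -
    have "y \<in> even_gen A r L" using y even_part[OF FL(2)] even_mono[OF FL(1)] by blast
    then show ?thesis using meet y even_subset_gen[OF sub] by blast
  qed
  fix x assume x: "x \<in> gen A r F \<inter> gen A r L"
  then have xc: "x \<in> carrier A" using gen_carrier[OF FL(1)] by blast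
  show "x \<in> gen A r (F \<inter> L)"
    using gen_even_cases[OF FL(1) i(1), of x]
  proof
    show "x \<in> gen A r F" using x by blast
    show "x \<in> gen A r (F \<inter> L)" if "x \<in> even_gen A r F" using even_case that x by blast
    assume "r i \<otimes> x \<in> even_gen A r F"
    then have "r i \<otimes> x \<in> gen A r (F \<inter> L)"
      using even_case gen_mult[OF FL(2) r_in_gen[OF i(2)]] x by blast
    then have "r i \<otimes> (r i \<otimes> x) \<in> gen A r (F \<inter> L)"
      using gen_mult[OF sub r_in_gen] i by blast
    then show "x \<in> gen A r (F \<inter> L)" using r_cancel[OF iN xc] by simp
  qed
qed

lemma even_meet:
  assumes ip: "intersection_property A r N" and IJ: "I \<subseteq> N" "J \<subseteq> N"
  shows "even_gen A r I \<inter> even_gen A r J \<subseteq> even_gen A r (I \<inter> J)"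
proof
  fix x assume x: "x \<in> even_gen A r I \<inter> even_gen A r J"
  then have "x \<in> gen A r (I \<inter> J)"
    using even_subset_gen[OF IJ(1)] even_subset_gen[OF IJ(2)]
    by (intro intersection_property_pairwise[OF ip order_refl IJ]) blast+
  moreover have "I \<inter> J \<subseteq> N" using IJ by blast
  ultimately show "x \<in> even_gen A r (I \<inter> J)" using x even_mono[OF IJ(1)] even_part by blast
qed

text \<open>
  The facets and vertex-figures of 3-polytopes are polygons, whose mix is not a coset poset; there
  the intersection property comes for free.
\<close>

lemma intersection_property_rank_2:
  assumes N: "N = {0..1}" shows "intersection_property A r N"
  unfolding intersection_property_def
proof (intro allI impI ballI)
  fix J x assume J: "J \<subseteq> N" and x: "x \<in> gen A r N" and all: "\<forall>j \<in> J. x \<in> gen A r (N - {j})"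
  have "N = {0, 1}" using N by auto
  then consider "J = {}" | j where "J = {j}" | "J = N" using J by auto
  then show "x \<in> gen A r (N - J)"
  proof cases
    case 3
    then have "x = \<one>" using faithful x all by blast
    then show ?thesis using gen_one by simp
  qed (use x all in auto)
qed

end

section \<open>Direct products and transfer along embeddings\<close>

lemma generate_product_subset:
  assumes "group A" "group B" "X \<subseteq> carrier A" "Y \<subseteq> carrier B" "Z \<subseteq> X \<times> Y"
  shows "generate (A \<times>\<times> B) Z \<subseteq> generate A X \<times> generate B Y"
proof -
  interpret A: group A by (rule assms)
  interpret B: group B by (rule assms)
  interpret AB: group "A \<times>\<times> B" by (rule DirProd_group[OF assms(1,2)])
  have "subgroup (generate A X \<times> generate B Y) (A \<times>\<times> B)"
    by (rule DirProd_subgroups[OF assms(1) A.generate_is_subgroup assms(2) B.generate_is_subgroup]) (use assms in auto)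
  moreover have "Z \<subseteq> generate A X \<times> generate B Y"
    using assms(5) by (auto intro: generate.incl)
  ultimately show ?thesis using AB.generate_subgroup_incl by blast
qed

locale involution_pair = P: involution_system A r N + Q: involution_system B s N
  for A (structure) and B (structure) and r :: "int \<Rightarrow> 'a" and s :: "int \<Rightarrow> 'b" and N
begin

sublocale involution_system "A \<times>\<times> B" "\<lambda>i. (r i, s i)" N
proof (rule involution_system.intro)
  show "group (A \<times>\<times> B)" by (rule DirProd_group; unfold_locales)
  show "involution_system_axioms (A \<times>\<times> B) (\<lambda>i. (r i, s i)) N"
    by (rule involution_system_axioms.intro) (auto simp: P.r_closed Q.r_closed P.r_sq Q.r_sq)
qed

lemma gen_subset_product:
  "I \<subseteq> N \<Longrightarrow> gen (A \<times>\<times> B) (\<lambda>i. (r i, s i)) I \<subseteq> gen A r I \<times> gen B s I"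
  unfolding gen_def
  by (rule generate_product_subset[OF P.is_group Q.is_group])
    (auto simp: subset_iff P.r_closed Q.r_closed)

lemma even_subset_product:
  "I \<subseteq> N \<Longrightarrow> even_gen (A \<times>\<times> B) (\<lambda>i. (r i, s i)) I \<subseteq> even_gen A r I \<times> even_gen B s I"
  unfolding even_gen_def
  by (rule generate_product_subset[OF P.is_group Q.is_group])
    (auto simp: subset_iff P.r_closed Q.r_closed)

end

lemma string_system_product:
  assumes "string_system A r N" "string_system B s N"
  shows "string_system (A \<times>\<times> B) (\<lambda>i. (r i, s i)) N"
proof -
  interpret P: string_system A r N by (rule assms)
  interpret Q: string_system B s N by (rule assms)
  interpret involution_pair A B r s N by unfold_locales
  show ?thesis
  proof
    show "(r i, s i) \<otimes>\<^bsub>A \<times>\<times> B\<^esub> (r j, s j) = (r j, s j) \<otimes>\<^bsub>A \<times>\<times> B\<^esub> (r i, s i)"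
      if "i \<in> N" "j \<in> N" "i + 1 < j" for i j
      using P.r_comm[OF that] Q.r_comm[OF that] by simp
    show "(r i, s i) \<notin> even_gen (A \<times>\<times> B) (\<lambda>i. (r i, s i)) N" if "i \<in> N" for i
      using P.parity[OF that] even_subset_product[OF order_refl] by auto
    fix x assume x: "x \<in> gen (A \<times>\<times> B) (\<lambda>i. (r i, s i)) N"
      and all: "\<And>j. j \<in> N \<Longrightarrow> x \<in> gen (A \<times>\<times> B) (\<lambda>i. (r i, s i)) (N - {j})"
    have "fst x = \<one>\<^bsub>A\<^esub>"
    proof (rule P.faithful)
      show "fst x \<in> gen A r N" using x gen_subset_product[OF order_refl] by auto
      show "fst x \<in> gen A r (N - {j})" if "j \<in> N" for j
        using all[OF that] gen_subset_product[of "N - {j}"] by auto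
    qed
    moreover have "snd x = \<one>\<^bsub>B\<^esub>"
    proof (rule Q.faithful)
      show "snd x \<in> gen B s N" using x gen_subset_product[OF order_refl] by auto
      show "snd x \<in> gen B s (N - {j})" if "j \<in> N" for j
        using all[OF that] gen_subset_product[of "N - {j}"] by auto
    qed
    ultimately show "x = \<one>\<^bsub>A \<times>\<times> B\<^esub>" by (metis one_DirProd prod.collapse)
  qed
qed

text \<open>
  The offset \<open>c\<close> comes from the position of a section: generator \<open>i\<close> of the section corresponds to
  generator \<open>c + i\<close> of the whole polytope.
\<close>

locale shifted_embedding = subgroup_embedding A B H f
  for A (structure) and B (structure) and H and f +
  fixes r s and c m :: int
  assumes in_H: "i \<in> {0..m-1} \<Longrightarrow> r (c + i) \<in> H"
    and f_r: "i \<in> {0..m-1} \<Longrightarrow> f (r (c + i)) = s i"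
begin

lemma gen_image_eq:
  assumes I: "I \<subseteq> {0..m-1}"
  shows "gen B s I = f ` gen A r ((+) c ` I)" "gen A r ((+) c ` I) \<subseteq> H"
proof -
  have X: "r ` (+) c ` I \<subseteq> H" using in_H I by auto
  have "s ` I = f ` (r ` (+) c ` I)" using f_r I by (auto simp: image_image intro!: image_cong)
  then show "gen B s I = f ` gen A r ((+) c ` I)" unfolding gen_def using generate_image[OF X] by simp
  show "gen A r ((+) c ` I) \<subseteq> H" unfolding gen_def by (rule generate_in[OF X])
qed

lemma even_image_eq:
  assumes I: "I \<subseteq> {0..m-1}"
  shows "even_gen B s I = f ` even_gen A r ((+) c ` I)" "even_gen A r ((+) c ` I) \<subseteq> H"
proof -
  let ?X = "{r a \<otimes>\<^bsub>A\<^esub> r b | a b. a \<in> (+) c ` I \<and> b \<in> (+) c ` I}"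
  have rI: "r (c + i) \<in> H" "f (r (c + i)) = s i" if "i \<in> I" for i using in_H f_r I that by auto
  have X: "?X \<subseteq> H" using rI by (auto intro: H.m_closed)
  have "{s a \<otimes>\<^bsub>B\<^esub> s b | a b. a \<in> I \<and> b \<in> I} = f ` ?X"
  proof (intro equalityI subsetI)
    fix x assume "x \<in> {s a \<otimes>\<^bsub>B\<^esub> s b | a b. a \<in> I \<and> b \<in> I}"
    then obtain a b where ab: "a \<in> I" "b \<in> I" "x = s a \<otimes>\<^bsub>B\<^esub> s b" by blast
    then have "x = f (r (c + a) \<otimes>\<^bsub>A\<^esub> r (c + b))" using hom rI by simp
    then show "x \<in> f ` ?X" using ab by blast
  next
    fix x assume "x \<in> f ` ?X"
    then obtain a b where ab: "a \<in> I" "b \<in> I" "x = f (r (c + a) \<otimes>\<^bsub>A\<^esub> r (c + b))" by blast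
    then have "x = s a \<otimes>\<^bsub>B\<^esub> s b" using hom rI by simp
    then show "x \<in> {s a \<otimes>\<^bsub>B\<^esub> s b | a b. a \<in> I \<and> b \<in> I}" using ab by blast
  qed
  then show "even_gen B s I = f ` even_gen A r ((+) c ` I)"
    unfolding even_gen_def using generate_image[OF X] by simp
  show "even_gen A r ((+) c ` I) \<subseteq> H" unfolding even_gen_def by (rule generate_in[OF X])
qed

lemma in_gen_iff:
  "I \<subseteq> {0..m-1} \<Longrightarrow> y \<in> H \<Longrightarrow> f y \<in> gen B s I \<longleftrightarrow> y \<in> gen A r ((+) c ` I)"
  using gen_image_eq[of I] inj by (auto simp: inj_on_image_mem_iff)

lemma shift_diff: "(+) c ` (I - {j}) = (+) c ` I - {c + j}"
  by (simp add: image_set_diff)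

text \<open>
  An element of the subgroup for a section lies in every subgroup omitting an index outside the
  section, which is why faithfulness is inherited.
\<close>

lemma string_system_image:
  assumes "string_system A r N" and N: "(+) c ` {0..m-1} \<subseteq> N"
  shows "string_system B s {0..m-1}"
proof -
  interpret S: string_system A r N by (rule assms)
  let ?M = "{0..m-1}" and ?M' = "(+) c ` {0..m-1}"
  show ?thesis
  proof
    fix i assume i: "i \<in> ?M"
    then have ci: "c + i \<in> N" using N by blast
    note ri = in_H[OF i] and si = f_r[OF i, symmetric]
    show "s i \<in> carrier B" unfolding si by (rule closed[OF ri])
    have "s i \<otimes>\<^bsub>B\<^esub> s i = f (r (c + i) \<otimes>\<^bsub>A\<^esub> r (c + i))" unfolding si using hom ri by simp
    then show "s i \<otimes>\<^bsub>B\<^esub> s i = \<one>\<^bsub>B\<^esub>" using S.r_sq[OF ci] one by simp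
    show "s i \<notin> even_gen B s ?M"
    proof
      assume "s i \<in> even_gen B s ?M"
      then have "f (r (c + i)) \<in> f ` even_gen A r ?M'" using even_image_eq(1)[OF order_refl] si by simp
      then have "r (c + i) \<in> even_gen A r ?M'"
        using inj_on_image_mem_iff[OF inj ri even_image_eq(2)[OF order_refl]] by simp
      then show False using S.parity[OF ci] S.even_mono[OF N] by blast
    qed
    fix j assume j: "j \<in> ?M" and ij: "i + 1 < j"
    have "r (c + i) \<otimes>\<^bsub>A\<^esub> r (c + j) = r (c + j) \<otimes>\<^bsub>A\<^esub> r (c + i)"
    proof (rule S.r_comm[OF ci])
      show "c + j \<in> N" using N j by blast
      show "c + i + 1 < c + j" using ij by simp
    qed
    then show "s i \<otimes>\<^bsub>B\<^esub> s j = s j \<otimes>\<^bsub>B\<^esub> s i"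
      using hom[OF ri in_H[OF j]] hom[OF in_H[OF j] ri] f_r[OF i] f_r[OF j] by simp
  next
    fix x assume x: "x \<in> gen B s ?M" and all: "\<And>j. j \<in> ?M \<Longrightarrow> x \<in> gen B s (?M - {j})"
    obtain y where y: "y \<in> gen A r ?M'" "x = f y" using x gen_image_eq(1)[OF order_refl] by blast
    have yH: "y \<in> H" using y gen_image_eq(2)[OF order_refl] by blast
    have "y = \<one>\<^bsub>A\<^esub>"
    proof (rule S.faithful)
      show "y \<in> gen A r N" using y(1) S.gen_mono[OF N] by blast
      fix k assume "k \<in> N"
      show "y \<in> gen A r (N - {k})"
      proof (cases "k \<in> ?M'")
        case True
        then obtain j where j: "j \<in> ?M" "k = c + j" by blast
        have "y \<in> gen A r (?M' - {k})"
          using in_gen_iff[of "?M - {j}" y] yH all[OF j(1)] y(2) j(2) shift_diff by auto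
        then show ?thesis using S.gen_mono[of "?M' - {k}" "N - {k}"] N by blast
      next
        case False
        then show ?thesis using y(1) S.gen_mono[of ?M' "N - {k}"] N by blast
      qed
    qed
    then show "x = \<one>\<^bsub>B\<^esub>" using y(2) one by simp
  qed
qed

lemma intersection_property_pullback:
  assumes ip: "intersection_property B s {0..m-1}"
  shows "intersection_property A r ((+) c ` {0..m-1})"
  unfolding intersection_property_def
proof (intro allI impI ballI)
  let ?M = "{0..m-1}" and ?M' = "(+) c ` {0..m-1}"
  fix J' y assume J': "J' \<subseteq> ?M'" and y: "y \<in> gen A r ?M'" and all: "\<forall>j \<in> J'. y \<in> gen A r (?M' - {j})"
  obtain J where J: "J \<subseteq> ?M" "J' = (+) c ` J" using J' unfolding subset_image_iff by blast
  have yH: "y \<in> H" using y gen_image_eq(2)[OF order_refl] by blast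
  have "f y \<in> gen B s (?M - J)"
  proof (rule intersection_propertyD[OF ip J(1)])
    show "f y \<in> gen B s ?M" using in_gen_iff[OF order_refl yH] y by simp
    fix j assume j: "j \<in> J"
    then have "y \<in> gen A r ((+) c ` (?M - {j}))" using all J(2) shift_diff by auto
    then show "f y \<in> gen B s (?M - {j})" using in_gen_iff[of "?M - {j}" y] yH by blast
  qed
  then have "y \<in> gen A r ((+) c ` (?M - J))" using in_gen_iff[of "?M - J" y] yH by blast
  then show "y \<in> gen A r (?M' - J')" unfolding J(2) by (simp add: image_set_diff)
qed

end

section \<open>Mixes of polytopes and of their sections\<close>

lemma mix_group_eq:
  assumes "involution_system (aut_group X) (rho X \<Phi>) {0..m-1}"
    and "involution_system (aut_group Y) (rho Y \<Psi>) {0..m-1}"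
  shows "mix_group m X \<Phi> Y \<Psi> = (aut_group X \<times>\<times> aut_group Y)
    \<lparr>carrier := even_gen (aut_group X \<times>\<times> aut_group Y) (\<lambda>i. (rho X \<Phi> i, rho Y \<Psi> i)) {0..m-1}\<rparr>"
proof -
  interpret involution_pair "aut_group X" "aut_group Y" "rho X \<Phi>" "rho Y \<Psi>" "{0..m-1}"
    using assms by (rule involution_pair.intro)
  let ?A = "aut_group X \<times>\<times> aut_group Y" and ?r = "\<lambda>i. (rho X \<Phi> i, rho Y \<Psi> i)"
  let ?D = "even_gen (aut_group X) (rho X \<Phi>) {0..m-1} \<times> even_gen (aut_group Y) (rho Y \<Psi>) {0..m-1}"
  let ?R = "rotation_group m X \<Phi> \<times>\<times> rotation_group m Y \<Psi>"
  have R: "?R = ?A\<lparr>carrier := ?D\<rparr>"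
    using carrier_rotation_group[OF assms(1)] carrier_rotation_group[OF assms(2)]
    by (simp add: DirProd_def rotation_group_def)
  have gens: "mix_gen X \<Phi> Y \<Psi> ` {1..m-1} = (\<lambda>i. ?r (i - 1) \<otimes>\<^bsub>?A\<^esub> ?r i) ` {1..m-1}"
    by (rule image_cong) (simp_all add: mix_gen_def sigma_def)
  have sub: "mix_gen X \<Phi> Y \<Psi> ` {1..m-1} \<subseteq> ?D"
    unfolding gens by (auto intro!: P.pair_in_even Q.pair_in_even)
  have subg: "subgroup ?D ?A"
    by (rule DirProd_subgroups) (auto intro: P.even_is_subgroup Q.even_is_subgroup P.is_group Q.is_group)
  have "generate ?R (mix_gen X \<Phi> Y \<Psi> ` {1..m-1}) = generate ?A (mix_gen X \<Phi> Y \<Psi> ` {1..m-1})"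
    unfolding R by (rule generate_consistent[OF sub subg])
  also have "\<dots> = even_gen ?A ?r {0..m-1}"
    unfolding gens by (rule even_by_consecutive) simp
  finally have "generate ?R (carrier ?R \<inter> mix_gen X \<Phi> Y \<Psi> ` {1..m-1}) = even_gen ?A ?r {0..m-1}"
    using sub unfolding R by (simp add: Int_absorb1)
  then show ?thesis
    unfolding mix_group_def subgroup_generated_def by (simp add: R)
qed

lemma mix_is_direct_product_iff:
  assumes "involution_system (aut_group X) (rho X \<Phi>) {0..m-1}"
    and "involution_system (aut_group Y) (rho Y \<Psi>) {0..m-1}"
  shows "mix_is_direct_product m X \<Phi> Y \<Psi> \<longleftrightarrow>
    even_gen (aut_group X \<times>\<times> aut_group Y) (\<lambda>i. (rho X \<Phi> i, rho Y \<Psi> i)) {0..m-1} =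
    even_gen (aut_group X) (rho X \<Phi>) {0..m-1} \<times> even_gen (aut_group Y) (rho Y \<Psi>) {0..m-1}"
  unfolding mix_is_direct_product_def mix_group_eq[OF assms]
  using carrier_rotation_group[OF assms(1)] carrier_rotation_group[OF assms(2)] by simp

lemma mix_polytopal_iff:
  assumes m: "3 \<le> m"
    and X: "string_system (aut_group X) (rho X \<Phi>) {0..m-1}"
    and Y: "string_system (aut_group Y) (rho Y \<Psi>) {0..m-1}"
  shows "mix_polytopal m X \<Phi> Y \<Psi> \<longleftrightarrow>
    intersection_property (aut_group X \<times>\<times> aut_group Y) (\<lambda>i. (rho X \<Phi> i, rho Y \<Psi> i)) {0..m-1}"
proof -
  let ?A = "aut_group X \<times>\<times> aut_group Y" and ?r = "\<lambda>i. (rho X \<Phi> i, rho Y \<Psi> i)"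
  interpret P: string_system "aut_group X" "rho X \<Phi>" "{0..m-1}" by (rule X)
  interpret Q: string_system "aut_group Y" "rho Y \<Psi>" "{0..m-1}" by (rule Y)
  interpret S: string_system ?A ?r "{0..m-1}" by (rule string_system_product[OF X Y])
  interpret coset_geometry ?A ?r m "mix_gen X \<Phi> Y \<Psi>"
    by unfold_locales (use m in \<open>auto simp: mix_gen_def sigma_def\<close>)
  have "mix m X \<Phi> Y \<Psi> = coset_poset m G (mix_gen X \<Phi> Y \<Psi>)"
    using m mix_group_eq[OF P.involution_system_axioms Q.involution_system_axioms] by (simp add: mix_def)
  then show ?thesis unfolding mix_polytopal_def using polytope_iff_intersection_property by simp
qed

text \<open>
  For the facets \<open>a = -1\<close> and \<open>b = n - 1\<close>, for the vertex-figures \<open>a = 0\<close> and \<open>b = n\<close>, and for the medial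
  sections \<open>a = 0\<close> and \<open>b = n - 1\<close>.
\<close>

lemma mix_section:
  fixes a b n :: int
  assumes P: "regular_polytope n P \<Phi>P" "string_system (aut_group P) (rho P \<Phi>P) {0..n-1}"
    and Q: "regular_polytope n Q \<Phi>Q" "string_system (aut_group Q) (rho Q \<Phi>Q) {0..n-1}"
    and ab: "-1 \<le> a" "a < b" "b \<le> n" and m: "m = b - a - 1"
    and K: "abstract_polytope m K" "\<Phi>K \<in> flags K"
      "poset_isomorphic (poset_section P (abstract_polytope.face_at P \<Phi>P b) (abstract_polytope.face_at P \<Phi>P a)) K"
    and K': "abstract_polytope m K'" "\<Phi>K' \<in> flags K'"
      "poset_isomorphic (poset_section Q (abstract_polytope.face_at Q \<Phi>Q b) (abstract_polytope.face_at Q \<Phi>Q a)) K'"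
  shows "mix_is_direct_product m K \<Phi>K K' \<Phi>K' \<longleftrightarrow>
      even_gen (aut_group P \<times>\<times> aut_group Q) (\<lambda>i. (rho P \<Phi>P i, rho Q \<Phi>Q i)) {a+1..b-1} =
      even_gen (aut_group P) (rho P \<Phi>P) {a+1..b-1} \<times> even_gen (aut_group Q) (rho Q \<Phi>Q) {a+1..b-1}"
    and "2 \<le> m \<Longrightarrow> mix_polytopal m K \<Phi>K K' \<Phi>K' \<Longrightarrow>
      intersection_property (aut_group P \<times>\<times> aut_group Q) (\<lambda>i. (rho P \<Phi>P i, rho Q \<Phi>Q i)) {a+1..b-1}"
proof -
  interpret P: regular_polytope n P \<Phi>P by (rule P)
  interpret Q: regular_polytope n Q \<Phi>Q by (rule Q)
  let ?AP = "aut_group P" and ?AQ = "aut_group Q" and ?BP = "aut_group K" and ?BQ = "aut_group K'"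
  let ?A = "?AP \<times>\<times> ?AQ" and ?r = "\<lambda>i. (rho P \<Phi>P i, rho Q \<Phi>Q i)"
  let ?B = "?BP \<times>\<times> ?BQ" and ?s = "\<lambda>i. (rho K \<Phi>K i, rho K' \<Phi>K' i)"
  let ?I = "{a+1..b-1}"
  let ?UP = "gen ?AP (rho P \<Phi>P) ?I" and ?UQ = "gen ?AQ (rho Q \<Phi>Q) ?I"
  obtain \<psi> where \<psi>: "subgroup_embedding ?AP ?BP ?UP \<psi>"
    "\<And>i. i \<in> {0..b - a - 2} \<Longrightarrow> \<psi> (rho P \<Phi>P (a + 1 + i)) = rho K \<Phi>K i"
    using P.section_embedding[OF ab _ K(2,3)] K(1) m by blast
  obtain \<psi>' where \<psi>': "subgroup_embedding ?AQ ?BQ ?UQ \<psi>'"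
    "\<And>i. i \<in> {0..b - a - 2} \<Longrightarrow> \<psi>' (rho Q \<Phi>Q (a + 1 + i)) = rho K' \<Phi>K' i"
    using Q.section_embedding[OF ab _ K'(2,3)] K'(1) m by blast
  have inP: "rho P \<Phi>P (a + 1 + i) \<in> ?UP" "rho Q \<Phi>Q (a + 1 + i) \<in> ?UQ" if "i \<in> {0..m-1}" for i
    using that m P.r_in_gen[of "a + 1 + i" ?I] Q.r_in_gen[of "a + 1 + i" ?I] by auto
  have ms: "{0..b - a - 2} = {0..m-1}" using m by auto
  have seP: "shifted_embedding ?AP ?BP ?UP \<psi> (rho P \<Phi>P) (rho K \<Phi>K) (a + 1) m"
    using \<psi> inP unfolding ms by (simp add: shifted_embedding_def shifted_embedding_axioms_def)
  have seQ: "shifted_embedding ?AQ ?BQ ?UQ \<psi>' (rho Q \<Phi>Q) (rho K' \<Phi>K') (a + 1) m"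
    using \<psi>' inP unfolding ms by (simp add: shifted_embedding_def shifted_embedding_axioms_def)
  have se: "shifted_embedding ?A ?B (?UP \<times> ?UQ) (map_prod \<psi> \<psi>') ?r ?s (a + 1) m"
    using subgroup_embedding_product[OF \<psi>(1) \<psi>'(1)] \<psi>(2) \<psi>'(2) inP unfolding ms
    by (simp add: shifted_embedding_def shifted_embedding_axioms_def)
  interpret eP: shifted_embedding ?AP ?BP ?UP \<psi> "rho P \<Phi>P" "rho K \<Phi>K" "a + 1" m by (rule seP)
  interpret eQ: shifted_embedding ?AQ ?BQ ?UQ \<psi>' "rho Q \<Phi>Q" "rho K' \<Phi>K'" "a + 1" m by (rule seQ)
  interpret e: shifted_embedding ?A ?B "?UP \<times> ?UQ" "map_prod \<psi> \<psi>'" ?r ?s "a + 1" m by (rule se)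
  have I: "(+) (a + 1) ` {0..m-1} = ?I" using m by simp
  have IN: "?I \<subseteq> {0..n-1}" using ab by auto
  have sK: "string_system ?BP (rho K \<Phi>K) {0..m-1}"
    by (rule eP.string_system_image[OF P(2)]) (simp only: I IN)
  have sK': "string_system ?BQ (rho K' \<Phi>K') {0..m-1}"
    by (rule eQ.string_system_image[OF Q(2)]) (simp only: I IN)
  interpret SK: string_system ?BP "rho K \<Phi>K" "{0..m-1}" by (rule sK)
  interpret SK': string_system ?BQ "rho K' \<Phi>K'" "{0..m-1}" by (rule sK')
  note evP = eP.even_image_eq[OF order_refl, unfolded I]
    and evQ = eQ.even_image_eq[OF order_refl, unfolded I]
    and ev = e.even_image_eq[OF order_refl, unfolded I]
  have img: "map_prod \<psi> \<psi>' ` (even_gen ?AP (rho P \<Phi>P) ?I \<times> even_gen ?AQ (rho Q \<Phi>Q) ?I) =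
      \<psi> ` even_gen ?AP (rho P \<Phi>P) ?I \<times> \<psi>' ` even_gen ?AQ (rho Q \<Phi>Q) ?I"
    by (auto simp: image_iff)
  have "mix_is_direct_product m K \<Phi>K K' \<Phi>K' \<longleftrightarrow>
      map_prod \<psi> \<psi>' ` even_gen ?A ?r ?I =
      map_prod \<psi> \<psi>' ` (even_gen ?AP (rho P \<Phi>P) ?I \<times> even_gen ?AQ (rho Q \<Phi>Q) ?I)"
    unfolding mix_is_direct_product_iff[OF SK.involution_system_axioms SK'.involution_system_axioms]
      img evP(1) evQ(1) ev(1) ..
  also have "\<dots> \<longleftrightarrow> even_gen ?A ?r ?I = even_gen ?AP (rho P \<Phi>P) ?I \<times> even_gen ?AQ (rho Q \<Phi>Q) ?I"
    by (rule inj_on_image_eq_iff[OF e.inj ev(2)]) (use evP(2) evQ(2) in blast)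
  finally show "mix_is_direct_product m K \<Phi>K K' \<Phi>K' \<longleftrightarrow>
      even_gen ?A ?r ?I = even_gen ?AP (rho P \<Phi>P) ?I \<times> even_gen ?AQ (rho Q \<Phi>Q) ?I" .
  assume m2: "2 \<le> m" and poly: "mix_polytopal m K \<Phi>K K' \<Phi>K'"
  have "intersection_property ?B ?s {0..m-1}"
  proof (cases "m = 2")
    case True
    show ?thesis
      by (rule string_system.intersection_property_rank_2[OF string_system_product[OF sK sK']])
        (simp add: True)
  next
    case False
    then show ?thesis using mix_polytopal_iff[OF _ sK sK'] m2 poly by simp
  qed
  then have "intersection_property ?A ?r ((+) (a + 1) ` {0..m-1})"
    by (rule e.intersection_property_pullback)
  then show "intersection_property ?A ?r ?I" unfolding I .
qed

section \<open>Ranks one and two\<close>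

text \<open>
  Chambers are the integers, as in a walk around the boundary (repeatedly, if \<open>m > 0\<close>): step \<open>2 q\<close> is the
  edge \<open>q\<close> with its first vertex \<open>q\<close>, and step \<open>2 q + 1\<close> the same edge with its second vertex \<open>q + 1\<close>.
  For \<open>m = 1\<close> the only edge would have just one vertex.
\<close>

lemma polygon_is_polytope:
  assumes m: "m \<noteq> 1" shows "abstract_polytope 2 (polygon m :: 'g mix_face ranked_poset)"
proof -
  define fc :: "int \<Rightarrow> int \<Rightarrow> 'g mix_face" where
    "fc i k = (if i = -1 then MinFace else if i = 0 then Vertex (((k + 1) div 2) mod int m)
      else if i = 1 then Edge ((k div 2) mod int m) else MaxFace)" for i k
  define Z where "Z = {k :: int. m = 0 \<or> 0 \<le> k \<and> k < int m}"
  define R :: "'g mix_face \<Rightarrow> 'g mix_face \<Rightarrow> bool" where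
    "R x y \<longleftrightarrow> (\<exists>a b. x = Vertex a \<and> y = Edge b \<and> ([a = b] (mod int m) \<or> [a = b + 1] (mod int m)))" for x y
  have poly: "polygon m = bounded_poset 2 (Vertex ` Z \<union> Edge ` Z) R"
    by (simp add: polygon_def Z_def R_def[abs_def] Let_def)
  have Z_mod: "x mod int m \<in> Z" for x
    by (cases "m = 0") (auto simp: Z_def)
  have Z_id: "x mod int m = x" if "x \<in> Z" for x
    using that by (auto simp: Z_def)
  have two: "i = 0 \<or> i = 1" if "i \<in> {0..2 - 1}" for i :: int
    using that by auto
  have fc_simps: "fc (-1) k = MinFace" "fc 0 k = Vertex (((k + 1) div 2) mod int m)"
    "fc 1 k = Edge ((k div 2) mod int m)" "fc 2 k = MaxFace" for k by (simp_all add: fc_def)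
  have even0: "fc 0 (2 * q) = Vertex (q mod int m)" "fc 1 (2 * q) = Edge (q mod int m)" for q
    by (simp_all add: fc_simps)
  have odd0: "fc 0 (2 * q + 1) = Vertex ((q + 1) mod int m)" "fc 1 (2 * q + 1) = Edge (q mod int m)" for q
    by (simp_all add: fc_simps ac_simps)
  have prev0: "fc 0 (2 * q - 1) = Vertex (q mod int m)" "fc 1 (2 * q - 1) = Edge ((q - 1) mod int m)" for q
  proof -
    have "(2 * q - 1) div 2 = q - 1" by presburger
    then show "fc 0 (2 * q - 1) = Vertex (q mod int m)" "fc 1 (2 * q - 1) = Edge ((q - 1) mod int m)"
      by (simp_all add: fc_simps)
  qed
  have parity: "\<exists>q. k = 2 * q \<or> k = 2 * q + 1" for k :: int by presburger
  have succ_ne: "(q + 1) mod int m \<noteq> q mod int m" for q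
  proof
    assume "(q + 1) mod int m = q mod int m"
    then have "int m dvd (q + 1) - q" by (simp add: mod_eq_dvd_iff)
    then show False using m by simp
  qed
  have Rfc: "R (fc i x) (fc j y) \<longleftrightarrow> i < j \<and> (\<exists>z \<in> UNIV. fc i z = fc i x \<and> fc j z = fc j y)"
    if i: "i \<in> {0..2 - 1}" and j: "j \<in> {0..2 - 1}" for i j x y
  proof (cases "i = 0 \<and> j = 1")
    case False
    then show ?thesis using two[OF i] two[OF j] by (auto simp: R_def fc_simps)
  next
    case True
    let ?a = "((x + 1) div 2)" and ?b = "y div 2"
    have "R (fc 0 x) (fc 1 y) \<longleftrightarrow> ?a mod int m = ?b mod int m \<or> ?a mod int m = (?b + 1) mod int m"
      by (auto simp: R_def fc_simps cong_def mod_simps)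
    also have "\<dots> \<longleftrightarrow> (\<exists>z. fc 0 z = fc 0 x \<and> fc 1 z = fc 1 y)"
    proof
      assume "?a mod int m = ?b mod int m \<or> ?a mod int m = (?b + 1) mod int m"
      then show "\<exists>z. fc 0 z = fc 0 x \<and> fc 1 z = fc 1 y"
      proof
        assume "?a mod int m = ?b mod int m"
        then show ?thesis using even0[of ?b] by (intro exI[of _ "2 * ?b"]) (simp add: fc_simps)
      next
        assume "?a mod int m = (?b + 1) mod int m"
        then show ?thesis using odd0[of ?b] by (intro exI[of _ "2 * ?b + 1"]) (simp add: fc_simps)
      qed
    next
      assume "\<exists>z. fc 0 z = fc 0 x \<and> fc 1 z = fc 1 y"
      then obtain z where z: "fc 0 z = fc 0 x" "fc 1 z = fc 1 y" by blast
      obtain q where "z = 2 * q \<or> z = 2 * q + 1" using parity by blast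
      then show "?a mod int m = ?b mod int m \<or> ?a mod int m = (?b + 1) mod int m"
      proof
        assume "z = 2 * q"
        then show ?thesis using z even0[of q] by (simp add: fc_simps)
      next
        assume "z = 2 * q + 1"
        then have "(q + 1) mod int m = ?a mod int m" "q mod int m = ?b mod int m"
          using z odd0[of q] by (simp_all add: fc_simps)
        then show ?thesis by (metis mod_add_left_eq)
      qed
    qed
    finally show ?thesis using True by simp
  qed
  have faces: "Vertex ` Z \<union> Edge ` Z = {fc i z | i z. i \<in> {0..2 - 1} \<and> z \<in> UNIV}"
  proof (intro equalityI subsetI)
    fix F :: "'g mix_face" assume "F \<in> Vertex ` Z \<union> Edge ` Z"
    then consider a where "a \<in> Z" "F = Vertex a" | a where "a \<in> Z" "F = Edge a" by blast
    then show "F \<in> {fc i z | i z. i \<in> {0..2 - 1} \<and> z \<in> UNIV}"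
    proof cases
      case 1
      then have "F = fc 0 (2 * a)" using Z_id even0 by simp
      then show ?thesis by force
    next
      case 2
      then have "F = fc 1 (2 * a)" using Z_id even0 by simp
      then show ?thesis by force
    qed
  next
    fix F :: "'g mix_face" assume "F \<in> {fc i z | i z. i \<in> {0..2 - 1} \<and> z \<in> UNIV}"
    then obtain i z where "F = fc i z" "i \<in> {0..2 - 1}" by blast
    then show "F \<in> Vertex ` Z \<union> Edge ` Z" using two[of i] Z_mod by (auto simp: fc_simps)
  qed
  have ord: "face_ord (polygon m) = {(fc i z, fc j z) | i j z. -1 \<le> i \<and> i \<le> j \<and> j \<le> 2 \<and> z \<in> UNIV}"
    unfolding poly
  proof (rule bounded_poset_chambers)
    show "fc i z \<noteq> MinFace \<and> fc i z \<noteq> MaxFace" if "i \<in> {0..2 - 1}" for i z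
      using two[OF that] by (auto simp: fc_simps)
  qed (simp_all only: fc_simps faces Rfc, simp_all)
  have ranks: "i = -1 \<or> i = 0 \<or> i = 1 \<or> i = 2" if "-1 \<le> i" "i \<le> 2" for i :: int using that by auto
  have rk: "face_rank (polygon m) (fc i z) = i" if "-1 \<le> i" "i \<le> 2" for i z
    using ranks[OF that] unfolding poly by (auto simp: bounded_poset_def fc_simps)
  have diamond: "\<exists>w. fc i w \<noteq> fc i z \<and> fc (i - 1) w = fc (i - 1) z \<and> fc (i + 1) w = fc (i + 1) z \<and>
      (\<forall>u. fc (i - 1) u = fc (i - 1) z \<and> fc (i + 1) u = fc (i + 1) z \<longrightarrow>
        fc i u = fc i z \<or> fc i u = fc i w)" if i: "0 \<le> i" "i \<le> 1" for i z
  proof -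
    obtain q where q: "z = 2 * q \<or> z = 2 * q + 1" using parity by blast
    have pq: "(q' + 1) mod int m = (q + 1) mod int m" if "q' mod int m = q mod int m" for q q'
      using that by (metis mod_add_left_eq)
    have mq: "(q' - 1) mod int m = (q - 1) mod int m" if "q' mod int m = q mod int m" for q q'
      using that by (metis mod_diff_left_eq)
    consider "i = 0" | "i = 1" using i by linarith
    then show ?thesis
    proof cases
      case 1
      have only: "fc 0 u = Vertex (q mod int m) \<or> fc 0 u = Vertex ((q + 1) mod int m)"
        if eu: "fc 1 u = Edge (q mod int m)" for u
      proof -
        obtain q' where q': "u = 2 * q' \<or> u = 2 * q' + 1" using parity by blast
        then have qq: "q' mod int m = q mod int m" using eu even0[of q'] odd0[of q'] by auto
        from q' show ?thesis
        proof
          assume "u = 2 * q'" then show ?thesis using even0(1)[of q'] qq by simp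
        next
          assume "u = 2 * q' + 1" then show ?thesis using odd0(1)[of q'] pq[OF qq] by simp
        qed
      qed
      from q show ?thesis
      proof
        assume z: "z = 2 * q"
        show ?thesis unfolding 1 z
          by (rule exI[of _ "2 * q + 1"])
            (use succ_ne[of q] only in \<open>auto simp: even0 odd0 fc_simps(1)\<close>)
      next
        assume z: "z = 2 * q + 1"
        show ?thesis unfolding 1 z
          by (rule exI[of _ "2 * q"])
            (use succ_ne[of q, symmetric] only in \<open>auto simp: even0 odd0 fc_simps(1)\<close>)
      qed
    next
      case 2
      \<comment> \<open>The vertex of \<open>z\<close>; its two edges are \<open>p\<close> and \<open>p - 1\<close>.\<close>
      define p where "p = (z + 1) div 2"
      have z: "z = 2 * p \<or> z = 2 * p - 1" unfolding p_def by presburger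
      have only: "fc 1 u = Edge (p mod int m) \<or> fc 1 u = Edge ((p - 1) mod int m)"
        if eu: "fc 0 u = Vertex (p mod int m)" for u
      proof -
        define p' where "p' = (u + 1) div 2"
        have u: "u = 2 * p' \<or> u = 2 * p' - 1" unfolding p'_def by presburger
        have pp: "p' mod int m = p mod int m" using eu by (simp add: fc_simps p'_def)
        from u show ?thesis
        proof
          assume "u = 2 * p'" then show ?thesis using even0(2)[of p'] pp by simp
        next
          assume "u = 2 * p' - 1" then show ?thesis using prev0(2)[of p'] mq[OF pp] by simp
        qed
      qed
      have ne: "p mod int m \<noteq> (p - 1) mod int m" using succ_ne[of "p - 1"] by simp
      from z show ?thesis
      proof
        assume z: "z = 2 * p"
        show ?thesis unfolding 2 z
          by (rule exI[of _ "2 * p - 1"])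
            (use ne[symmetric] only in \<open>auto simp: even0 prev0 fc_simps(4)\<close>)
      next
        assume z: "z = 2 * p - 1"
        show ?thesis unfolding 2 z
          by (rule exI[of _ "2 * p"])
            (use ne only in \<open>auto simp: even0 prev0 fc_simps(4)\<close>)
      qed
    qed
  qed
  have "polytopal_chamber_poset 2 (polygon m) UNIV fc"
  proof
    show "\<exists>z \<in> UNIV. (\<forall>i \<in> {-1..j}. fc i z = fc i x) \<and> (\<forall>k \<in> {j..2}. fc k z = fc k y)"
      if j: "-1 \<le> j" "j \<le> 2" and eq: "fc j x = fc j y" for x y j
    proof (cases "j \<le> 0")
      case True
      have "fc i y = fc i x" if "i \<in> {-1..j}" for i
      proof -
        have "i = -1 \<or> i = j" using that True j by auto
        then show ?thesis using eq by (auto simp: fc_simps(1))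
      qed
      then show ?thesis by blast
    next
      case False
      have "fc i x = fc i y" if "i \<in> {j..2}" for i
      proof -
        have "i = j \<or> i = 2" using that False j by auto
        then show ?thesis using eq by (auto simp: fc_simps(4))
      qed
      then show ?thesis by blast
    qed
    fix x y
    let ?R = "{(z, w). z \<in> UNIV \<and> w \<in> UNIV \<and>
      (\<exists>i \<in> {-1..2}. fc i z \<noteq> fc i w \<and> (\<forall>k \<in> {-1..2}. k \<noteq> i \<longrightarrow> fc k z = fc k w)) \<and>
      (\<forall>k \<in> {-1..2}. fc k x = fc k y \<longrightarrow> fc k z = fc k x \<and> fc k w = fc k x)}"
    have "{-1..2} = {-1, 0, 1, 2 :: int}" by auto
    then have all: "(\<forall>k \<in> {-1..2}. Q k) \<longleftrightarrow> Q (-1) \<and> Q 0 \<and> Q 1 \<and> Q 2" for Q :: "int \<Rightarrow> bool" by simp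
    have ends: "fc (-1) k = fc (-1) l" "fc 2 k = fc 2 l" for k l by (simp_all add: fc_simps)
    have RI: "(z, w) \<in> ?R" if "fc i z \<noteq> fc i w" "i \<in> {0, 1}" "fc (1 - i) z = fc (1 - i) w"
      "\<forall>k \<in> {0, 1}. fc k x = fc k y \<longrightarrow> fc k z = fc k x \<and> fc k w = fc k x" for z w i
    proof -
      have "\<forall>k \<in> {-1..2}. k \<noteq> i \<longrightarrow> fc k z = fc k w"
        unfolding all using that(1-3) ends by auto
      then have "\<exists>i \<in> {-1..2}. fc i z \<noteq> fc i w \<and> (\<forall>k \<in> {-1..2}. k \<noteq> i \<longrightarrow> fc k z = fc k w)"
        using that(1,2) by (intro bexI[of _ i]) auto
      moreover have "\<forall>k \<in> {-1..2}. fc k x = fc k y \<longrightarrow> fc k z = fc k x \<and> fc k w = fc k x"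
        unfolding all using that(4) ends by auto
      ultimately show ?thesis by simp
    qed
    show "\<exists>u \<in> UNIV. (\<forall>k \<in> {-1..2}. fc k u = fc k y) \<and> (x, u) \<in> ?R\<^sup>*"
    proof (cases "fc 0 x = fc 0 y \<or> fc 1 x = fc 1 y")
      case False
      have step: "(k, k + 1) \<in> ?R \<and> (k + 1, k) \<in> ?R" for k
      proof -
        obtain q where "k = 2 * q \<or> k = 2 * q + 1" using parity by blast
        then have "\<exists>i \<in> {0, 1}. fc i k \<noteq> fc i (k + 1) \<and> fc (1 - i) k = fc (1 - i) (k + 1)"
        proof
          assume "k = 2 * q"
          then show ?thesis using even0[of q] odd0[of q] succ_ne[of q] by auto
        next
          assume "k = 2 * q + 1"
          then show ?thesis using odd0[of q] even0[of "q + 1"] succ_ne[of q] by (auto simp: algebra_simps)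
        qed
        then obtain i where i: "i \<in> {0, 1}" "fc i k \<noteq> fc i (k + 1)" "fc (1 - i) k = fc (1 - i) (k + 1)"
          by blast
        have nf: "\<forall>k \<in> {0, 1}. fc k x = fc k y \<longrightarrow> fc k z = fc k x \<and> fc k w = fc k x" for z w
          using False by simp
        show ?thesis
          by (rule conjI[OF RI[OF i(2,1,3) nf] RI[OF i(2)[symmetric] i(1) i(3)[symmetric] nf]])
      qed
      have "(x, k) \<in> ?R\<^sup>*" for k
      proof (induction k rule: int_induct[where k = x])
        case (step1 k)
        then show ?case using step[of k] by (meson rtrancl_into_rtrancl)
      next
        case (step2 k)
        have "(k, k - 1) \<in> ?R" using step[of "k - 1", THEN conjunct2] by (simp only: diff_add_cancel)
        then show ?case using step2(2) by (rule rtrancl_into_rtrancl[rotated])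
      qed simp
      then show ?thesis by blast
    next
      case True
      show ?thesis
      proof (cases "fc 0 x = fc 0 y \<and> fc 1 x = fc 1 y")
        case True
        then have "\<forall>k \<in> {-1..2}. fc k x = fc k y" unfolding all using ends by auto
        then show ?thesis by blast
      next
        case False
        with \<open>fc 0 x = fc 0 y \<or> fc 1 x = fc 1 y\<close>
        have "\<exists>i \<in> {0, 1 :: int}. fc i x \<noteq> fc i y \<and> fc (1 - i) x = fc (1 - i) y" by auto
        then obtain i where i: "i \<in> {0, 1 :: int}" "fc i x \<noteq> fc i y" "fc (1 - i) x = fc (1 - i) y"
          by blast
        have "(x, y) \<in> ?R" by (rule RI[OF i(2,1,3)]) simp
        then show ?thesis by blast
      qed
    qed
  qed (use ord rk diamond fc_simps in auto)
  then show ?thesis by (rule polytopal_chamber_poset.abstract_polytope)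
qed

lemma segment_is_polytope:
  "abstract_polytope 1 (bounded_poset 1 {Vertex 0, Vertex 1} (\<lambda>x y. False) :: 'g mix_face ranked_poset)"
    (is "abstract_polytope 1 ?X")
proof -
  define fc :: "int \<Rightarrow> int \<Rightarrow> 'g mix_face" where
    "fc i k = (if i = -1 then MinFace else if i = 0 then Vertex k else MaxFace)" for i k
  have ranks: "i = -1 \<or> i = 0 \<or> i = 1" if "-1 \<le> i" "i \<le> 1" for i :: int using that by auto
  have fc_simps: "fc (-1) k = MinFace" "fc 0 k = Vertex k" "fc 1 k = MaxFace" for k
    by (simp_all add: fc_def)
  have ord: "face_ord ?X = {(fc i z, fc j z) | i j z. -1 \<le> i \<and> i \<le> j \<and> j \<le> 1 \<and> z \<in> {0, 1}}"
  proof (rule bounded_poset_chambers)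
    show "{Vertex 0, Vertex 1} = {fc i z | i z. i \<in> {0..1 - 1} \<and> z \<in> {0, 1}}"
      by (auto simp: fc_def)
  qed (auto simp: fc_def)
  have "polytopal_chamber_poset 1 ?X {0, 1} fc"
  proof
    show "face_rank ?X (fc i z) = i" if "-1 \<le> i" "i \<le> 1" for i z
      using ranks[OF that] by (auto simp: bounded_poset_def fc_simps)
    show "\<exists>z \<in> {0, 1}. (\<forall>i \<in> {-1..j}. fc i z = fc i x) \<and> (\<forall>k \<in> {j..1}. fc k z = fc k y)"
      if x: "x \<in> {0, 1}" and y: "y \<in> {0, 1}" and j: "-1 \<le> j" "j \<le> 1" and eq: "fc j x = fc j y" for x y j
    proof (cases "j \<le> 0")
      case True
      have "fc i y = fc i x" if "i \<in> {-1..j}" for i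
      proof -
        have "i = -1 \<or> i = j" using that True j by auto
        then show ?thesis using eq by (auto simp: fc_simps)
      qed
      then show ?thesis using y by blast
    next
      case False
      then have "j = 1" using j by simp
      then have "fc i x = fc i y" if "i \<in> {j..1}" for i using that by (auto simp: fc_simps)
      then show ?thesis using x by blast
    qed
    fix x y :: int assume x: "x \<in> {0, 1}" and y: "y \<in> {0, 1}"
    let ?R = "{(z, w). z \<in> {0, 1} \<and> w \<in> {0, 1} \<and>
      (\<exists>i \<in> {-1..1}. fc i z \<noteq> fc i w \<and> (\<forall>k \<in> {-1..1}. k \<noteq> i \<longrightarrow> fc k z = fc k w)) \<and>
      (\<forall>k \<in> {-1..1}. fc k x = fc k y \<longrightarrow> fc k z = fc k x \<and> fc k w = fc k x)}"
    have "{-1..1} = {-1, 0, 1 :: int}" by auto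
    then have all: "(\<forall>k \<in> {-1..1}. Q k) \<longleftrightarrow> Q (-1) \<and> Q 0 \<and> Q 1" for Q :: "int \<Rightarrow> bool" by simp
    have "(x, y) \<in> ?R" if "x \<noteq> y"
    proof -
      have "\<exists>i \<in> {-1..1}. fc i x \<noteq> fc i y \<and> (\<forall>k \<in> {-1..1}. k \<noteq> i \<longrightarrow> fc k x = fc k y)"
        by (rule bexI[of _ 0]) (use that in \<open>auto simp: all fc_simps\<close>)
      then show ?thesis using x y that by (simp add: all fc_simps)
    qed
    then have "(x, y) \<in> ?R\<^sup>*" by (cases "x = y") auto
    then show "\<exists>u \<in> {0, 1}. (\<forall>k \<in> {-1..1}. fc k u = fc k y) \<and> (x, u) \<in> ?R\<^sup>*"
      using y by blast
  next
    fix z i :: int assume z: "z \<in> {0, 1}" and "0 \<le> i" "i \<le> 1 - 1"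
    then have i: "i = 0" by simp
    show "\<exists>w \<in> {0, 1}. fc i w \<noteq> fc i z \<and> fc (i - 1) w = fc (i - 1) z \<and> fc (i + 1) w = fc (i + 1) z \<and>
      (\<forall>u \<in> {0, 1}. fc (i - 1) u = fc (i - 1) z \<and> fc (i + 1) u = fc (i + 1) z \<longrightarrow>
        fc i u = fc i z \<or> fc i u = fc i w)"
      unfolding i by (rule bexI[of _ "1 - z"]) (use z in \<open>auto simp: fc_simps\<close>)
  qed (use ord fc_simps in auto)
  then show ?thesis by (rule polytopal_chamber_poset.abstract_polytope)
qed

text \<open>
  Infinitely many vertices are counted as 0; otherwise two flags adjacent in rank 0 show two
  vertices.
\<close>

lemma num_vertices_ne_1:
  assumes "abstract_polytope n P" "1 \<le> n" "\<Phi> \<in> flags P"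
  shows "num_vertices P \<noteq> 1"
proof
  interpret abstract_polytope n P by (rule assms)
  assume "num_vertices P = 1"
  then obtain V where V: "{F \<in> faces P. face_rank P F = 0} = {V}"
    unfolding num_vertices_def by (auto simp: card_1_singleton_iff)
  obtain \<Psi> where a: "adjacent_at 0 \<Phi> \<Psi>" using adjacent_at_exists[OF assms(3), of 0] assms(2) by auto
  then have \<Psi>: "\<Psi> \<in> flags P" "face_at \<Phi> 0 \<noteq> face_at \<Psi> 0" by (auto simp: adjacent_at_def)
  have "face_at X 0 = V" if "X \<in> flags P" for X
    using flag_face[OF that, of 0] face_at_rank[OF that, of 0] V assms(2) by auto
  then show False using \<Psi> assms(3) by simp
qed

lemma mix_is_direct_product_trivial:
  assumes "m \<le> 1" shows "mix_is_direct_product m X \<Phi> Y \<Psi>"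
proof -
  have e: "{1..m-1} = {}" using assms by simp
  interpret X: group "aut_group X" by (rule group_aut_group)
  interpret Y: group "aut_group Y" by (rule group_aut_group)
  have "group (rotation_group m X \<Phi> \<times>\<times> rotation_group m Y \<Psi>)"
    unfolding rotation_group_def by (rule DirProd_group) simp_all
  then interpret XY: group "rotation_group m X \<Phi> \<times>\<times> rotation_group m Y \<Psi>" .
  show ?thesis
    unfolding mix_is_direct_product_def mix_group_def carrier_subgroup_generated
    by (simp add: rotation_group_def e XY.generate_empty[unfolded rotation_group_def e, simplified]
        X.generate_empty Y.generate_empty carrier_subgroup_generated)
qed

section \<open>The mix of two polytopes\<close>

theorem theorem3p13:
  fixes n :: int
    and P :: "'p ranked_poset" and K :: "'k ranked_poset"
    and L :: "'l ranked_poset" and M :: "'m ranked_poset"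
    and Q :: "'q ranked_poset" and K' :: "'k1 ranked_poset"
    and L' :: "'l1 ranked_poset" and M' :: "'m1 ranked_poset"
  assumes "directly_regular n P"
    and "abstract_polytope (n - 1) K" and "has_facets n P K"
    and "abstract_polytope (n - 1) L" and "has_vertex_figures P L"
    and "abstract_polytope (n - 2) M" and "has_medial_sections n P M"
    and "directly_regular n Q"
    and "abstract_polytope (n - 1) K'" and "has_facets n Q K'"
    and "abstract_polytope (n - 1) L'" and "has_vertex_figures Q L'"
    and "abstract_polytope (n - 2) M'" and "has_medial_sections n Q M'"
    and base_flags: "\<Phi>P \<in> flags P" "\<Phi>K \<in> flags K" "\<Phi>L \<in> flags L" "\<Phi>M \<in> flags M"
      "\<Phi>Q \<in> flags Q" "\<Phi>K' \<in> flags K'" "\<Phi>L' \<in> flags L'" "\<Phi>M' \<in> flags M'"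
    and "mix_polytopal (n - 1) K \<Phi>K K' \<Phi>K'"
    and "mix_polytopal (n - 1) L \<Phi>L L' \<Phi>L'"
    and "mix_is_direct_product (n - 1) K \<Phi>K K' \<Phi>K'"
    and "mix_is_direct_product (n - 1) L \<Phi>L L' \<Phi>L'"
  shows "mix_polytopal n P \<Phi>P Q \<Phi>Q \<longleftrightarrow> mix_is_direct_product (n - 2) M \<Phi>M M' \<Phi>M'"
proof -
  interpret M: abstract_polytope "n - 2" M by (rule assms)
  have "-1 \<le> n - 2" using M.least_face M.rank_range by force
  then consider "n = 1" | "n = 2" | "3 \<le> n" by linarith
  then show ?thesis
  proof cases
    case 1
    have "mix_polytopal n P \<Phi>P Q \<Phi>Q"
      using segment_is_polytope unfolding 1 mix_polytopal_def mix_def by simp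
    then show ?thesis using mix_is_direct_product_trivial[of "n - 2" M \<Phi>M M' \<Phi>M'] 1 by simp
  next
    case 2
    have "num_vertices P \<noteq> 1" "num_vertices Q \<noteq> 1"
      using num_vertices_ne_1[of n] assms(1,8) base_flags 2 by (auto simp: directly_regular_def)
    then have lcm: "lcm (num_vertices P) (num_vertices Q) \<noteq> 1" by (metis dvd_lcm1 nat_dvd_1_iff_1)
    have mix: "mix n P \<Phi>P Q \<Phi>Q = polygon (lcm (num_vertices P) (num_vertices Q))"
      by (simp add: mix_def 2)
    have "mix_polytopal n P \<Phi>P Q \<Phi>Q"
      unfolding mix_polytopal_def mix unfolding 2 by (rule polygon_is_polytope[OF lcm])
    then show ?thesis using mix_is_direct_product_trivial[of "n - 2" M \<Phi>M M' \<Phi>M'] 2 by simp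
  next
    case 3
    note rP = directly_regular_imp[OF assms(1) base_flags(1)]
      and rQ = directly_regular_imp[OF assms(8) base_flags(5)]
    interpret P: regular_polytope n P \<Phi>P by (rule rP)
    interpret Q: regular_polytope n Q \<Phi>Q by (rule rQ)
    interpret SP: string_system "aut_group P" "rho P \<Phi>P" "{0..n-1}" by (rule rP)
    interpret SQ: string_system "aut_group Q" "rho Q \<Phi>Q" "{0..n-1}" by (rule rQ)
    let ?A = "aut_group P \<times>\<times> aut_group Q" and ?r = "\<lambda>i. (rho P \<Phi>P i, rho Q \<Phi>Q i)"
    let ?N = "{0..n-1}" and ?F = "{0..n-2}" and ?L = "{1..n-1}" and ?M = "{1..n-2}"
    let ?eP = "even_gen (aut_group P) (rho P \<Phi>P)" and ?eQ = "even_gen (aut_group Q) (rho Q \<Phi>Q)"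
    interpret S: string_system ?A ?r ?N by (rule string_system_product[OF rP(2) rQ(2)])
    interpret pair: involution_pair "aut_group P" "aut_group Q" "rho P \<Phi>P" "rho Q \<Phi>Q" ?N by unfold_locales
    have sub: "?F \<subseteq> ?N" "?L \<subseteq> ?N" "?M \<subseteq> ?N" "?M \<subseteq> ?F" "?M \<subseteq> ?L" and FL: "?F \<inter> ?L = ?M" by auto
    have "1 \<le> n" using 3 by simp
    note secP = P.base_sections[OF this] and secQ = Q.base_sections[OF this]
    note KP = secP(1)[OF assms(3)] and LP = secP(2)[OF assms(5)] and MP = secP(3)[OF assms(7)]
    note KQ = secQ(1)[OF assms(10)] and LQ = secQ(2)[OF assms(12)] and MQ = secQ(3)[OF assms(14)]
    have F: "even_gen ?A ?r ?F = ?eP ?F \<times> ?eQ ?F" "intersection_property ?A ?r ?F"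
      using mix_section[OF rP rQ, of "-1" "n - 1" "n - 1", OF _ _ _ _ assms(2) base_flags(2) KP
          assms(9) base_flags(6) KQ] 3 assms(23,25) by simp_all
    have L: "even_gen ?A ?r ?L = ?eP ?L \<times> ?eQ ?L" "intersection_property ?A ?r ?L"
      using mix_section[OF rP rQ, of 0 n "n - 1", OF _ _ _ _ assms(4) base_flags(3) LP
          assms(11) base_flags(7) LQ] 3 assms(24,26) by simp_all
    have M: "mix_is_direct_product (n - 2) M \<Phi>M M' \<Phi>M' \<longleftrightarrow> even_gen ?A ?r ?M = ?eP ?M \<times> ?eQ ?M"
      using mix_section(1)[OF rP rQ, of 0 "n - 1" "n - 2", OF _ _ _ _ assms(6) base_flags(4) MP
          assms(13) base_flags(8) MQ] 3 by simp
    have meet: "?eP ?F \<inter> ?eP ?L \<subseteq> ?eP ?M" "?eQ ?F \<inter> ?eQ ?L \<subseteq> ?eQ ?M"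
      using SP.even_meet[OF P.intersection sub(1,2)] SQ.even_meet[OF Q.intersection sub(1,2)]
      unfolding FL .
    have "intersection_property ?A ?r ?N \<longleftrightarrow> even_gen ?A ?r ?M = ?eP ?M \<times> ?eQ ?M"
    proof
      assume ip: "intersection_property ?A ?r ?N"
      show "even_gen ?A ?r ?M = ?eP ?M \<times> ?eQ ?M"
      proof
        show "even_gen ?A ?r ?M \<subseteq> ?eP ?M \<times> ?eQ ?M" by (rule pair.even_subset_product[OF sub(3)])
        have "?eP ?M \<times> ?eQ ?M \<subseteq> even_gen ?A ?r ?F \<inter> even_gen ?A ?r ?L"
          unfolding F(1) L(1)
          using P.even_mono[OF sub(4)] P.even_mono[OF sub(5)] Q.even_mono[OF sub(4)] Q.even_mono[OF sub(5)]
          by blast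
        then show "?eP ?M \<times> ?eQ ?M \<subseteq> even_gen ?A ?r ?M"
          using S.even_meet[OF ip sub(1,2)] unfolding FL by blast
      qed
    next
      assume M_eq: "even_gen ?A ?r ?M = ?eP ?M \<times> ?eQ ?M"
      have "even_gen ?A ?r ?F \<inter> even_gen ?A ?r ?L \<subseteq> even_gen ?A ?r (?F \<inter> ?L)"
        unfolding F(1) L(1) FL M_eq using meet by blast
      then have "gen ?A ?r ?F \<inter> gen ?A ?r ?L \<subseteq> gen ?A ?r ?M"
        using S.gen_meet_from_even_meet[OF sub(1,2), of 1] 3 FL by simp
      then show "intersection_property ?A ?r ?N"
        using S.intersection_property_from_ends[OF refl F(2) L(2)] by simp
    qed
    then show ?thesis using mix_polytopal_iff[OF 3 rP(2) rQ(2)] M by simp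
  qed
qed

end
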